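(* Let $N\ge2$, $d\ge1$, and let $S^{\{n\}}$ ($n=1,2,\dots$) and $S$ be $d\times d$ matrix functions in $L^1(\mathbb T^N)^{d\times d}$ which are positive definite a.e. and satisfy $\log\det S^{\{n\}},\log\det S\in L^1(\mathbb T^N)$. Suppose $S^{\{n\}}\rightarrowtail S$ in $L^1(\mathbb T^N)$ and, for a.e. $(t_2,\dots,t_N)\in\mathbb T^{N-1}$, $$\int_{\mathbb T}\log\det S^{\{n\}}(t_1,t_2,\dots,t_N)\,|dt_1|\to\int_{\mathbb T}\log\det S(t_1,t_2,\dots,t_N)\,|dt_1|.$$ Let $S^{\{n\}}=S^{\{n\}}_{+,1}\big(S^{\{n\}}_{+,1}\big)^*$ and $S=S_{+,1}S_{+,1}^*$ be the first-variable spectral factorizations (defined below). Then $S^{\{n\}}_{+,1}\rightarrowtail S_{+,1}$ in $L^2(\mathbb T^N)$.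
   Context: $\mathbb T$ is the unit circle, $\mathbb D$ the open unit disk, $A^*$ the Hermitian conjugate; convergence of matrix functions is entrywise. Convergence "restricted to hyperplanes": a sequence $f_n\in L^2(\mathbb T^N)$ satisfies $f_n\rightarrowtail f$ in $L^p(\mathbb T^N)$ ($p\ge1$) if $f_n\to f$ in $L^p(\mathbb T^N)$ and, for each $l=2,\dots,N$ and a.e. $(t_l,\dots,t_N)\in\mathbb T^{N-l+1}$, $f_n(\cdot,t_l,\dots,t_N)\to f(\cdot,t_l,\dots,t_N)$ in $L^p(\mathbb T^{l-1})$ as functions of $(t_1,\dots,t_{l-1})$. First-variable spectral factor: for a positive definite $S\in L^1(\mathbb T^N)^{d\times d}$ with $\log\det S\in L^1(\mathbb T^N)$, $S_{+,1}$ denotes the matrix function such that, for a.e. $(t_2,\dots,t_N)$, $S_{+,1}(\cdot,t_2,\dots,t_N)$ is the one-variable outer spectral factor of $S(\cdot,t_2,\dots,t_N)$: its entries belong to the Hardy space $\mathbf H^2$ of the disk (identified with boundary values), its determinant is an outer function, $S(\cdot,t_2,\dots,t_N)=S_{+,1}(\cdot,t_2,\dots,t_N)S_{+,1}(\cdot,t_2,\dots,t_N)^*$ a.e. on $\mathbb T$, and its value at $z=0$ is positive definite (which determines it uniquely). *)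

theory Defs
  imports "HOL-Probability.Probability"
begin

definition T_meas :: "complex measure" where
  "T_meas = distr (restrict_space lborel {0..<2*pi}) borel cis"

text \<open>Product measure on T^I; points are functions nat => complex,
  extensional on I. The torus T^N uses coordinates 0..N-1
  (coordinate 0 is the paper's first variable t_1).\<close>
definition torus_on :: "nat set \<Rightarrow> (nat \<Rightarrow> complex) measure" where
  "torus_on I = PiM I (\<lambda>_. T_meas)"

abbreviation torus :: "nat \<Rightarrow> (nat \<Rightarrow> complex) measure" where
  "torus N \<equiv> torus_on {..<N}"

definition adjm :: "complex^'d^'d \<Rightarrow> complex^'d^'d" where
  "adjm A = (\<chi> i j. cnj (A $ j $ i))"

definition pos_def :: "complex^'d^'d \<Rightarrow> bool" where
  "pos_def A \<longleftrightarrow> adjm A = A \<and>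
     (\<forall>x::complex^'d. x \<noteq> 0 \<longrightarrow> Re (\<Sum>i\<in>UNIV. \<Sum>j\<in>UNIV. cnj (x $ i) * A $ i $ j * x $ j) > 0)"

definition memLp :: "'a measure \<Rightarrow> real \<Rightarrow> ('a \<Rightarrow> complex) \<Rightarrow> bool" where
  "memLp M p f \<longleftrightarrow> f \<in> borel_measurable M \<and> (\<integral>\<^sup>+ x. ennreal (cmod (f x) powr p) \<partial>M) < \<infinity>"

definition Lp_conv :: "'a measure \<Rightarrow> real \<Rightarrow> (nat \<Rightarrow> 'a \<Rightarrow> complex) \<Rightarrow> ('a \<Rightarrow> complex) \<Rightarrow> bool" where
  "Lp_conv M p fs f \<longleftrightarrow> (\<forall>n. memLp M p (fs n)) \<and> memLp M p f \<and>
     (\<lambda>n. \<integral>\<^sup>+ x. ennreal (cmod (fs n x - f x) powr p) \<partial>M) \<longlonglongrightarrow> 0"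

text \<open>f_n converges to f in L^p(T^N) restricted to hyperplanes. The paper's
  index l = 2..N corresponds to m = l - 1 in 1..N-1: the free coordinates are
  0..m-1 (t_1..t_{l-1}) and the fixed ones m..N-1 (t_l..t_N).\<close>
definition Lp_rconv :: "nat \<Rightarrow> real \<Rightarrow> (nat \<Rightarrow> (nat \<Rightarrow> complex) \<Rightarrow> complex)
    \<Rightarrow> ((nat \<Rightarrow> complex) \<Rightarrow> complex) \<Rightarrow> bool" where
  "Lp_rconv N p fs f \<longleftrightarrow> Lp_conv (torus N) p fs f \<and>
     (\<forall>m\<in>{1..<N}. AE y in torus_on {m..<N}.
        Lp_conv (torus_on {..<m}) p
          (\<lambda>n x. fs n (merge {..<m} {m..<N} (x, y)))
          (\<lambda>x. f (merge {..<m} {m..<N} (x, y))))"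

definition mat_Lp_rconv :: "nat \<Rightarrow> real \<Rightarrow> (nat \<Rightarrow> (nat \<Rightarrow> complex) \<Rightarrow> complex^'d^'d)
    \<Rightarrow> ((nat \<Rightarrow> complex) \<Rightarrow> complex^'d^'d) \<Rightarrow> bool" where
  "mat_Lp_rconv N p Fs F \<longleftrightarrow>
     (\<forall>i j. Lp_rconv N p (\<lambda>n x. Fs n x $ i $ j) (\<lambda>x. F x $ i $ j))"

text \<open>H^2 identified with boundary values: L^2 functions on T with vanishing
  negative Fourier coefficients.\<close>
definition H2 :: "(complex \<Rightarrow> complex) \<Rightarrow> bool" where
  "H2 g \<longleftrightarrow> memLp T_meas 2 g \<and>
     (\<forall>k::nat. k \<ge> 1 \<longrightarrow> (\<integral>w. g w * w ^ k \<partial>T_meas) = 0)"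

definition cauchy_ext :: "(complex \<Rightarrow> complex) \<Rightarrow> complex \<Rightarrow> complex" where
  "cauchy_ext g z = (1 / (2 * pi)) * (\<integral>w. g w * w / (w - z) \<partial>T_meas)"

definition mat_ext :: "(complex \<Rightarrow> complex^'d^'d) \<Rightarrow> complex \<Rightarrow> complex^'d^'d" where
  "mat_ext G z = (\<chi> i j. cauchy_ext (\<lambda>w. G w $ i $ j) z)"

definition is_outer :: "(complex \<Rightarrow> complex) \<Rightarrow> (complex \<Rightarrow> complex) \<Rightarrow> bool" where
  "is_outer D psi \<longleftrightarrow> integrable T_meas (\<lambda>w. ln (cmod (psi w))) \<and>
     (\<exists>c. cmod c = 1 \<and> (\<forall>z. cmod z < 1 \<longrightarrow>
        D z = c * exp ((1 / (2 * pi)) *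
          (\<integral>w. (w + z) / (w - z) * complex_of_real (ln (cmod (psi w))) \<partial>T_meas))))"

definition outer_spectral_factor ::
    "(complex \<Rightarrow> complex^'d^'d) \<Rightarrow> (complex \<Rightarrow> complex^'d^'d) \<Rightarrow> bool" where
  "outer_spectral_factor Phi G \<longleftrightarrow>
     (\<forall>i j. H2 (\<lambda>w. G w $ i $ j)) \<and>
     is_outer (\<lambda>z. det (mat_ext G z)) (\<lambda>w. det (G w)) \<and>
     (AE w in T_meas. Phi w = G w ** adjm (G w)) \<and>
     pos_def (mat_ext G 0)"

definition first_var_factor :: "nat \<Rightarrow> ((nat \<Rightarrow> complex) \<Rightarrow> complex^'d^'d)
    \<Rightarrow> ((nat \<Rightarrow> complex) \<Rightarrow> complex^'d^'d) \<Rightarrow> bool" where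
  "first_var_factor N S F \<longleftrightarrow>
     (\<forall>i j. (\<lambda>x. F x $ i $ j) \<in> borel_measurable (torus N)) \<and>
     (AE y in torus_on {1..<N}.
        outer_spectral_factor (\<lambda>t. S (y(0 := t))) (\<lambda>t. F (y(0 := t))))"

end

theory Submission
  imports Defs "HOL-Complex_Analysis.Cauchy_Integral_Formula"
begin

text \<open>In one variable, let \<open>S\<^sub>n = G\<^sub>n G\<^sub>n\<^sup>*\<close> and \<open>S = G G\<^sup>*\<close>. Since \<open>det G\<close> is outer, there are bounded
  analytic matrices \<open>\<Phi>\<close> with \<open>\<Phi> G\<close> arbitrarily close to the identity in \<open>L\<^sup>2\<close>. Then
  \<open>\<parallel>\<Phi> G\<^sub>n\<parallel>\<^sup>2 = \<integral> tr (\<Phi> S\<^sub>n \<Phi>\<^sup>*)\<close> tends to \<open>\<parallel>\<Phi> G\<parallel>\<^sup>2\<close>, which is almost \<open>d\<close> for the normalised measure, while the mean value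
  \<open>\<Phi>(0) G\<^sub>n(0)\<close> has a determinant of modulus almost 1, because \<open>|det G\<^sub>n(0)|\<^sup>2\<close> is the exponential of the mean of
  \<open>log det S\<^sub>n\<close>. Hadamard's inequality and AM-GM force \<open>G(0)\<^sup>-\<^sup>1 G\<^sub>n(0)\<close> to be asymptotically unitary, so
  \<open>G\<^sub>n(0) \<rightarrow> G(0)\<close> by positivity. Hence \<open>\<Phi> G\<^sub>n\<close> differs little from its mean, and thus from \<open>\<Phi> G\<close>;
  this gives weak convergence \<open>G\<^sub>n \<rightarrow> G\<close>, which is strong because the norms converge.
  In several variables one applies this on almost every slice in \<open>t\<^sub>1\<close> and integrates out the remaining
  variables by dominated convergence, \<open>2 tr S\<^sub>n + 2 tr S\<close> being a majorant of \<open>\<parallel>F\<^sub>n - F\<parallel>\<^sup>2\<close>.\<close>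

subsection \<open>Complex matrices\<close>

text \<open>The obstacle is that \<open>G\<close> need not have a bounded inverse: the bound on an
  approximate inverse \<open>P\<close> may deteriorate as \<open>P ** G\<close> comes closer to the
  identity. This fixes the order of limits: first \<open>P\<close> is chosen, then \<open>n\<close>
  tends to infinity, and only then is the accuracy improved. Three facts about \<open>P\<close> are
  retained: the constant \<open>C\<close> by which it multiplies means, the smallness of
  \<open>P ** G - mat 1\<close>, and that the norm of \<open>P ** Gs n\<close> depends on
  \<open>Gs n\<close> through \<open>Qs n\<close> alone. To return from \<open>P ** Dif n\<close> to
  \<open>Dif n\<close> one does not invert \<open>P\<close>; \<open>G\<close> itself serves as its
  approximate inverse, on the set where \<open>G\<close> and its inverse are bounded. Off that set a
  small integral of \<open>|G|^2\<close> suffices, because expanding \<open>sqnorm (Gs n)\<close>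
  around \<open>G\<close> calls for the pairing with the single function \<open>G\<close>. Boundary
  values are handled in L2 norm only: \<open>P\<close> is a dilation of a matrix analytic in the
  disc, and no radial limit of that matrix is taken.\<close>

lemma norm_matrix_sq: "(norm (A::complex^'n^'m))\<^sup>2 = (\<Sum>i\<in>UNIV. \<Sum>j\<in>UNIV. (cmod (A$i$j))\<^sup>2)"
  by (simp add: norm_vec_def L2_set_def real_sqrt_pow2 sum_nonneg)

lemma norm_vec_sq: "(norm (v::complex^'n))\<^sup>2 = (\<Sum>i\<in>UNIV. (cmod (v$i))\<^sup>2)"
  by (simp add: norm_vec_def L2_set_def real_sqrt_pow2 sum_nonneg)

lemma mult_cnj_eq: "z * cnj z = (complex_of_real (cmod z))\<^sup>2"
  by (metis complex_norm_square of_real_power)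

lemma norm_matrix_sq_rows: "(norm (A::complex^'n^'m))\<^sup>2 = (\<Sum>i\<in>UNIV. (norm (A$i))\<^sup>2)"
  by (simp add: norm_vec_def L2_set_def real_sqrt_pow2 sum_nonneg)

lemma norm_entry_le: "cmod ((A::complex^'n^'m)$i$j) \<le> norm A"
  using Finite_Cartesian_Product.norm_nth_le[of A i] Finite_Cartesian_Product.norm_nth_le[of "A$i" j]
  by linarith

text \<open>Cauchy-Schwarz for each entry; \<open>norm\<close> on this type is the Frobenius
  norm.\<close>

lemma norm_matrix_mult_le:
  fixes A :: "complex^'n^'m" and B :: "complex^'p^'n"
  shows "norm (A ** B) \<le> norm A * norm B"
proof -
  have entry: "(cmod ((A ** B)$i$j))\<^sup>2 \<le> (\<Sum>k\<in>UNIV. (cmod (A$i$k))\<^sup>2) * (\<Sum>k\<in>UNIV. (cmod (B$k$j))\<^sup>2)" for i j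
  proof -
    have "cmod ((A ** B)$i$j) \<le> (\<Sum>k\<in>UNIV. cmod (A$i$k) * cmod (B$k$j))"
      unfolding matrix_matrix_mult_def by (simp add: sum_norm_le norm_mult)
    then have "(cmod ((A ** B)$i$j))\<^sup>2 \<le> (\<Sum>k\<in>UNIV. cmod (A$i$k) * cmod (B$k$j))\<^sup>2"
      by (intro power_mono) auto
    also have "\<dots> \<le> (\<Sum>k\<in>UNIV. (cmod (A$i$k))\<^sup>2) * (\<Sum>k\<in>UNIV. (cmod (B$k$j))\<^sup>2)"
      by (rule Cauchy_Schwarz_ineq_sum)
    finally show ?thesis .
  qed
  have "(norm (A ** B))\<^sup>2 \<le> (\<Sum>i\<in>UNIV. \<Sum>j\<in>UNIV. (\<Sum>k\<in>UNIV. (cmod (A$i$k))\<^sup>2) * (\<Sum>k\<in>UNIV. (cmod (B$k$j))\<^sup>2))"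
    unfolding norm_matrix_sq by (intro sum_mono entry)
  also have "\<dots> = (norm A)\<^sup>2 * (\<Sum>j\<in>UNIV. \<Sum>k\<in>UNIV. (cmod (B$k$j))\<^sup>2)"
    unfolding norm_matrix_sq by (simp add: sum_product)
  also have "\<dots> = (norm A * norm B)\<^sup>2"
    unfolding power_mult_distrib norm_matrix_sq[of B] by (subst sum.swap) simp
  finally show ?thesis
    by (rule power2_le_imp_le) simp
qed

lemma bounded_bilinear_matrix_mult:
  "bounded_bilinear ((**) :: complex^'n^'m \<Rightarrow> complex^'p^'n \<Rightarrow> complex^'p^'m)"
proof (unfold_locales, goal_cases)
  case (5)
  show ?case using norm_matrix_mult_le by (intro exI[of _ 1]) auto
qed (auto simp: matrix_matrix_mult_def vec_eq_iff sum.distrib algebra_simps scaleR_sum_right)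

text \<open>Makes limits and differences of matrix products available as
  \<open>matrix_mult.tendsto\<close>, \<open>matrix_mult.diff_left\<close> and so on.\<close>

interpretation matrix_mult: bounded_bilinear "(**) :: complex^'n^'m \<Rightarrow> complex^'p^'n \<Rightarrow> complex^'p^'m"
  by (rule bounded_bilinear_matrix_mult)

lemma adjm_mult: "adjm (A ** B) = adjm B ** adjm A"
  by (simp add: adjm_def matrix_matrix_mult_def vec_eq_iff mult.commute)

lemma adjm_diff: "adjm (A - B) = adjm A - adjm B"
  by (simp add: adjm_def vec_eq_iff)

lemma det_adjm: "det (adjm A) = cnj (det A)"
proof -
  have "det (adjm A) = det (transpose (\<chi> i j. cnj (A$i$j)))"
    by (simp add: adjm_def transpose_def)
  also have "\<dots> = cnj (det A)"
    unfolding det_transpose by (simp add: det_def)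
  finally show ?thesis .
qed

lemma det_mult_adjm: "det (A ** adjm A) = of_real ((cmod (det A))\<^sup>2)"
  by (simp only: det_mul det_adjm complex_norm_square[symmetric])

lemma mult_adjm_diag: "(A ** adjm A) $ i $ i = of_real ((norm (A$i))\<^sup>2)" for A :: "complex^'d^'d"
  by (simp add: matrix_matrix_mult_def adjm_def norm_vec_sq mult_cnj_eq)

lemma trace_mult_adjm: "(\<Sum>i\<in>UNIV. Re ((A ** adjm A) $ i $ i)) = (norm A)\<^sup>2" for A :: "complex^'d^'d"
  by (simp add: mult_adjm_diag norm_matrix_sq_rows)

lemma norm_adjm: "norm (adjm A) = norm (A :: complex^'d^'d)"
proof -
  have "(norm (adjm A))\<^sup>2 = (norm A)\<^sup>2"
    unfolding norm_matrix_sq by (subst sum.swap) (simp add: adjm_def)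
  then show ?thesis by simp
qed

lemma bounded_linear_adjm: "bounded_linear (adjm :: complex^'d^'d \<Rightarrow> _)"
  by (intro bounded_linear_intro[where K=1]) (auto simp: adjm_def vec_eq_iff norm_adjm[unfolded adjm_def])

lemma norm_matrix_le_sum: "norm (A :: complex^'d^'d) \<le> (\<Sum>i\<in>UNIV. \<Sum>j\<in>UNIV. cmod (A$i$j))"
proof -
  have "norm A \<le> (\<Sum>i\<in>UNIV. norm (A$i))"
    unfolding norm_vec_def by (intro L2_set_le_sum) auto
  also have "\<dots> \<le> (\<Sum>i\<in>UNIV. \<Sum>j\<in>UNIV. cmod (A$i$j))"
    unfolding norm_vec_def[of "_ :: complex^'d"] by (intro sum_mono L2_set_le_sum) auto
  finally show ?thesis .
qed

lemma norm_matrix_le: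
  fixes X :: "complex^'d^'d" and b :: real
  assumes "\<And>i j. cmod (X$i$j) \<le> b"
  shows "norm X \<le> real CARD('d) * b"
proof -
  have "b \<ge> 0" using assms[of undefined undefined] norm_ge_zero order_trans by blast
  have "(norm X)\<^sup>2 \<le> (\<Sum>i\<in>(UNIV::'d set). \<Sum>j\<in>(UNIV::'d set). b\<^sup>2)"
    unfolding norm_matrix_sq by (intro sum_mono power_mono assms) auto
  also have "\<dots> = (real CARD('d) * b)\<^sup>2"
    by (simp add: power_mult_distrib power2_eq_square)
  finally show ?thesis by (rule power2_le_imp_le) (use \<open>b \<ge> 0\<close> in simp)
qed

lemma cmod_det_le:
  fixes A :: "complex^'d^'d" and b :: real
  assumes "\<And>i j. cmod (A$i$j) \<le> b"
  shows "cmod (det A) \<le> fact CARD('d) * b ^ CARD('d)"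
proof -
  have "cmod (det A) \<le> (\<Sum>p\<in>{p. p permutes (UNIV::'d set)}. b ^ CARD('d))"
    unfolding det_def
  proof (rule sum_norm_le)
    fix p :: "'d \<Rightarrow> 'd" assume "p \<in> {p. p permutes (UNIV::'d set)}"
    have "cmod (of_int (sign p) * (\<Prod>i\<in>UNIV. A$i$p i)) = (\<Prod>i\<in>UNIV. cmod (A$i$p i))"
      by (simp add: norm_mult prod_norm sign_def)
    also have "\<dots> \<le> (\<Prod>i\<in>(UNIV::'d set). b)"
      by (intro prod_mono) (auto intro: assms)
    finally show "cmod (of_int (sign p) * (\<Prod>i\<in>UNIV. A$i$p i)) \<le> b ^ CARD('d)" by simp
  qed
  also have "\<dots> = fact CARD('d) * b ^ CARD('d)"
    by (simp add: card_permutations)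
  finally show ?thesis .
qed

lemma continuous_on_det: "continuous_on S (det :: complex^'d^'d \<Rightarrow> complex)"
  unfolding det_def by (intro continuous_intros)

text \<open>The form inside \<open>pos_def\<close>, named separately because a limit
  \<open>B\<close> of positive definite matrices is only known to satisfy
  \<open>qform B x \<ge> 0\<close>.\<close>

definition qform :: "complex^'d^'d \<Rightarrow> complex^'d \<Rightarrow> real" where
  "qform A x = Re (\<Sum>i\<in>UNIV. \<Sum>j\<in>UNIV. cnj (x $ i) * A $ i $ j * x $ j)"

lemma pos_def_iff: "pos_def A \<longleftrightarrow> adjm A = A \<and> (\<forall>x. x \<noteq> 0 \<longrightarrow> qform A x > 0)"
  by (simp add: pos_def_def qform_def)

lemma qform_zero [simp]: "qform A 0 = 0"
  by (simp add: qform_def)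

lemma continuous_on_qform: "continuous_on S (\<lambda>A. qform A x)"
  unfolding qform_def by (intro continuous_intros)

lemma pos_def_imp_det_nz:
  assumes "pos_def A"
  shows "det A \<noteq> 0"
proof
  assume "det A = 0"
  then have "\<not> invertible A" by (simp add: invertible_det_nz)
  then have "\<not> (\<exists>B. B ** A = mat 1)" by (simp add: invertible_left_inverse)
  then obtain x where x: "A *v x = 0" "x \<noteq> 0"
    using matrix_left_invertible_ker[of A] by blast
  have "(\<Sum>i\<in>UNIV. \<Sum>j\<in>UNIV. cnj (x $ i) * A $ i $ j * x $ j) = (\<Sum>i\<in>UNIV. cnj (x $ i) * (A *v x) $ i)"
    by (simp add: matrix_vector_mult_def sum_distrib_left mult.assoc)
  then have "qform A x = 0" by (simp add: qform_def x)
  with assms x show False by (auto simp: pos_def_iff)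
qed

text \<open>For hermitian \<open>D\<close> the k-th diagonal entry of \<open>D ** (A ** D)\<close>
  is the form of \<open>A\<close> at the k-th column of \<open>D\<close>. Semidefiniteness of
  \<open>A\<close> thus becomes a sign for the trace.\<close>

lemma trace_conj_qform:
  assumes "adjm D = D"
  shows "Re (trace (D ** (A ** D))) = (\<Sum>k\<in>UNIV. qform A (column k D))"
proof -
  have D: "D $ k $ i = cnj (D $ i $ k)" for i k
  proof -
    have "adjm D $ k $ i = cnj (D $ i $ k)" by (simp add: adjm_def)
    then show ?thesis using assms by simp
  qed
  have "trace (D ** (A ** D)) = (\<Sum>k\<in>UNIV. \<Sum>i\<in>UNIV. \<Sum>j\<in>UNIV. D$k$i * (A$i$j * D$j$k))"
    by (simp add: trace_def matrix_matrix_mult_def sum_distrib_left)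
  also have "\<dots> = (\<Sum>k\<in>UNIV. \<Sum>i\<in>UNIV. \<Sum>j\<in>UNIV. cnj (column k D $ i) * A $ i $ j * column k D $ j)"
    by (intro sum.cong refl, subst D) (simp add: column_def mult.assoc)
  finally show ?thesis by (simp add: qform_def)
qed

text \<open>With \<open>D = P - B\<close> one has \<open>P D + D B = 0\<close>; multiplying by \<open>D\<close> and taking traces gives
  \<open>tr (D P D) + tr (D B D) = 0\<close>, a sum of two nonnegative terms.\<close>
lemma pos_def_sqrt_unique:
  fixes P B :: "complex^'d^'d"
  assumes P: "pos_def P" and B: "adjm B = B" "\<And>x. qform B x \<ge> 0" and eq: "B ** B = P ** P"
  shows "B = P"
proof -
  define D where "D = P - B"
  have D: "adjm D = D" using P B by (simp add: D_def adjm_diff pos_def_iff)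
  have "P ** D + D ** B = 0"
    by (simp add: D_def matrix_mult.diff_left matrix_mult.diff_right eq)
  then have "D ** (P ** D) + D ** (D ** B) = 0"
    by (metis matrix_mult.add_right matrix_mult.zero_right)
  then have "trace (D ** (P ** D)) + trace (D ** (D ** B)) = 0"
    by (metis trace_add trace_0 mat_0)
  moreover have "trace (D ** (D ** B)) = trace (D ** (B ** D))"
    by (metis matrix_mul_assoc trace_mul_sym)
  ultimately have "Re (trace (D ** (P ** D))) + Re (trace (D ** (B ** D))) = 0"
    by (metis plus_complex.sel(1) zero_complex.sel(1))
  then have "(\<Sum>k\<in>UNIV. qform P (column k D)) + (\<Sum>k\<in>UNIV. qform B (column k D)) = 0"
    unfolding trace_conj_qform[OF D] .
  moreover have Pn: "qform P x \<ge> 0" for x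
    using P by (cases "x = 0") (auto simp: pos_def_iff less_imp_le)
  moreover have "(\<Sum>k\<in>UNIV. qform B (column k D)) \<ge> 0" by (intro sum_nonneg B)
  ultimately have "(\<Sum>k\<in>UNIV. qform P (column k D)) = 0"
    by (smt (verit) sum_nonneg)
  then have "qform P (column k D) = 0" for k
    using Pn by (simp add: sum_nonneg_eq_0_iff)
  \<comment> \<open>Strict positivity of \<open>P\<close> kills every column; the limit matrix
    \<open>B\<close> contributes only a nonnegative term.\<close>
  then have "column k D = 0" for k
    using P by (metis less_irrefl pos_def_iff)
  then have "D = 0" by (simp add: vec_eq_iff column_def)
  then show ?thesis by (simp add: D_def)
qed

section \<open>Matrices of maximal determinant on a Frobenius ball\<close>

lemma det_scale: "det (\<chi> k. c *s (A $ k)) = c ^ CARD('d) * det (A :: complex^'d^'d)"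
  using det_rows_mul[of "\<lambda>_. c" "\<lambda>i. A$i"] by simp

lemma norm_smult_vec: "norm (c *s (v::complex^'d)) = cmod c * norm v"
  by (simp add: norm_vec_def L2_set_def norm_mult power_mult_distrib sum_distrib_left[symmetric]
      real_sqrt_mult)

lemma norm_sq_add_smult:
  fixes a b :: "complex^'d"
  shows "(norm (a + c *s b))\<^sup>2 = (norm a)\<^sup>2 + 2 * Re (cnj c * (\<Sum>k\<in>UNIV. a$k * cnj (b$k))) + (cmod c)\<^sup>2 * (norm b)\<^sup>2"
proof -
  have "(cmod (u + c * v))\<^sup>2 = (cmod u)\<^sup>2 + 2 * Re (cnj c * (u * cnj v)) + (cmod c)\<^sup>2 * (cmod v)\<^sup>2" for u v
    unfolding cmod_power2 by (simp add: power2_eq_square algebra_simps)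
  then show ?thesis
    unfolding norm_vec_sq by (simp add: sum.distrib sum_distrib_left Re_sum)
qed

context
  fixes A :: "complex^'d^'d"
  assumes det_nz: "det A \<noteq> 0"
    and maxi: "\<And>B :: complex^'d^'d. norm B \<le> norm A \<Longrightarrow> cmod (det B) \<le> cmod (det A)"
begin

text \<open>Homogeneity: a shorter matrix with the same determinant, stretched to the norm of
  \<open>A\<close>, would have a larger determinant than \<open>A\<close>.\<close>

lemma det_max_norm_min:
  assumes "det (B :: complex^'d^'d) = det A"
  shows "norm A \<le> norm B"
proof (rule ccontr)
  assume less: "\<not> norm A \<le> norm B"
  have "B \<noteq> 0" using assms det_nz by (metis det_0 mat_0)
  define s where "s = norm A / norm B"
  have s: "s > 1" using less \<open>B \<noteq> 0\<close> by (simp add: s_def)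
  define B' where "B' = (\<chi> k. complex_of_real s *s (B$k))"
  have "(norm B')\<^sup>2 = (s * norm B)\<^sup>2"
    unfolding norm_matrix_sq_rows power_mult_distrib using s
    by (simp add: B'_def norm_smult_vec power_mult_distrib sum_distrib_left)
  then have "norm B' = s * norm B" using s by simp
  also have "\<dots> = norm A" using \<open>B \<noteq> 0\<close> by (simp add: s_def)
  finally have "cmod (det B') \<le> cmod (det A)" using maxi[of B'] by simp
  moreover have "cmod (det B') = s ^ CARD('d) * cmod (det A)"
    unfolding B'_def det_scale using s by (simp add: norm_mult norm_power assms)
  moreover have "s ^ CARD('d) > 1" using s by (simp add: one_less_power)
  ultimately show False using det_nz by simp
qed

text \<open>Removing from row \<open>i\<close> its projection on row \<open>j\<close> keeps the
  determinant and shortens the matrix strictly unless the two rows are already orthogonal.\<close>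

lemma det_max_rows_orthogonal:
  assumes "i \<noteq> j"
  shows "(\<Sum>k\<in>UNIV. A$i$k * cnj (A$j$k)) = 0"
proof (rule ccontr)
  define h where "h = (\<Sum>k\<in>UNIV. A$i$k * cnj (A$j$k))"
  assume "\<not> ?thesis"
  then have h: "h \<noteq> 0" by (simp add: h_def)
  then have j: "norm (A$j) > 0" by (auto simp: h_def)
  define c where "c = - (h / of_real ((norm (A$j))\<^sup>2))"
  define B where "B = (\<chi> k. if k = i then row i A + c *s row j A else row k A)"
  have row: "row k A = A$k" for k by (simp add: row_def vec_eq_iff)
  have "det B = det A" unfolding B_def by (rule det_row_operation[OF assms])
  then have "norm A \<le> norm B" by (rule det_max_norm_min)
  then have "(norm A)\<^sup>2 \<le> (norm B)\<^sup>2" by (intro power_mono) auto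
  then have "(norm (A$i))\<^sup>2 \<le> (norm (B$i))\<^sup>2"
    unfolding norm_matrix_sq_rows sum.remove[OF finite UNIV_I, of _ i]
    by (simp add: B_def row)
  also have "\<dots> = (norm (A$i))\<^sup>2 + 2 * Re (cnj c * h) + (cmod c)\<^sup>2 * (norm (A$j))\<^sup>2"
    by (simp add: B_def row norm_sq_add_smult h_def)
  also have "cnj c * h = of_real (- ((cmod h)\<^sup>2 / (norm (A$j))\<^sup>2))"
    by (simp add: c_def mult.commute mult_cnj_eq)
  also have "(cmod c)\<^sup>2 * (norm (A$j))\<^sup>2 = (cmod h)\<^sup>2 / (norm (A$j))\<^sup>2"
  proof -
    have "cmod c = cmod h / (norm (A$j))\<^sup>2" by (simp add: c_def norm_divide norm_power)
    then show ?thesis using j by (simp add: power_divide power2_eq_square)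
  qed
  finally have "(cmod h)\<^sup>2 / (norm (A$j))\<^sup>2 \<le> 0" by simp
  moreover have "(cmod h)\<^sup>2 / (norm (A$j))\<^sup>2 > 0" using h j by simp
  ultimately show False by simp
qed

text \<open>The AM-GM step: multiplying row \<open>i\<close> by \<open>\<alpha>\<close> and row
  \<open>j\<close> by its inverse keeps the determinant. With \<open>\<alpha>\<close> chosen to
  equalise the two lengths \<open>a\<close> and \<open>b\<close>, the sum of squares drops from
  \<open>a^2 + b^2\<close> to \<open>2 * a * b\<close>.\<close>

lemma det_max_rows_norm: "norm (A$i) = norm (A$j)"
proof (rule ccontr)
  assume ne: "\<not> ?thesis"
  then have ij: "i \<noteq> j" by auto
  have pos: "norm (A$k) > 0" for k
    using det_nz det_zero_row(2)[where F=A and j=k] by (auto simp: row_def vec_eq_iff)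
  define \<alpha> where "\<alpha> = sqrt (norm (A$j) / norm (A$i))"
  have \<alpha>: "\<alpha> > 0" "\<alpha>\<^sup>2 = norm (A$j) / norm (A$i)"
    using pos by (simp_all add: \<alpha>_def less_imp_le)
  define c where "c k = (if k = i then complex_of_real \<alpha> else if k = j then 1 / complex_of_real \<alpha> else 1)" for k
  define B where "B = (\<chi> k. c k *s (A$k))"
  have "prod c UNIV = c i * (c j * prod c (UNIV - {i} - {j}))"
    using ij by (simp add: prod.remove[OF finite UNIV_I, of _ i] prod.remove[of "UNIV - {i}" j])
  also have "prod c (UNIV - {i} - {j}) = 1" by (intro prod.neutral) (auto simp: c_def)
  finally have "prod c UNIV = 1" using \<alpha> ij by (simp add: c_def)
  then have "det B = det A" unfolding B_def det_rows_mul by simp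
  then have "norm A \<le> norm B" by (rule det_max_norm_min)
  then have "(norm A)\<^sup>2 \<le> (norm B)\<^sup>2" by (intro power_mono) auto
  moreover have split: "(norm X)\<^sup>2 = (norm (X$i))\<^sup>2 + ((norm (X$j))\<^sup>2 + (\<Sum>k\<in>UNIV - {i} - {j}. (norm (X$k))\<^sup>2))"
    for X :: "complex^'d^'d"
    using ij by (simp add: norm_matrix_sq_rows sum.remove[OF finite UNIV_I, of _ i] sum.remove[of "UNIV - {i}" j])
  moreover have "(\<Sum>k\<in>UNIV - {i} - {j}. (norm (B$k))\<^sup>2) = (\<Sum>k\<in>UNIV - {i} - {j}. (norm (A$k))\<^sup>2)"
    by (intro sum.cong) (auto simp: B_def c_def)
  ultimately have "(norm (A$i))\<^sup>2 + (norm (A$j))\<^sup>2 \<le> (norm (B$i))\<^sup>2 + (norm (B$j))\<^sup>2"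
    using split[of A] split[of B] by linarith
  also have "(norm (B$i))\<^sup>2 = norm (A$i) * norm (A$j)"
    using pos[of i] \<alpha> by (simp add: B_def c_def norm_smult_vec power_mult_distrib) (simp add: power2_eq_square)
  also have "(norm (B$j))\<^sup>2 = norm (A$i) * norm (A$j)"
    using pos[of i] pos[of j] \<alpha> ij
    by (simp add: B_def c_def norm_smult_vec power_mult_distrib norm_divide power_divide) (simp add: power2_eq_square)
  finally have "(norm (A$i) - norm (A$j))\<^sup>2 \<le> 0" by (simp add: power2_diff)
  with ne show False by simp
qed

lemma det_max_scalar:
  "A ** adjm A = mat (of_real ((norm A)\<^sup>2 / CARD('d)))"
proof -
  have eq: "(norm (A$i))\<^sup>2 = (norm A)\<^sup>2 / CARD('d)" for i
  proof -
    have "(norm A)\<^sup>2 = (\<Sum>k\<in>(UNIV::'d set). (norm (A$i))\<^sup>2)"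
      unfolding norm_matrix_sq_rows by (intro sum.cong refl) (metis det_max_rows_norm)
    then show ?thesis by simp
  qed
  have "(A ** adjm A) $ i $ j = (if i = j then of_real ((norm A)\<^sup>2 / CARD('d)) else 0)" for i j
  proof (cases "i = j")
    case True
    then show ?thesis by (simp only: mult_adjm_diag eq if_True refl)
  next
    case False
    then show ?thesis using det_max_rows_orthogonal[OF False]
      by (simp add: matrix_matrix_mult_def adjm_def)
  qed
  then show ?thesis by (simp add: vec_eq_iff mat_def)
qed

end

lemma det_mat_of: "det (mat c :: complex^'d^'d) = c ^ CARD('d)"
  by (subst det_diagonal) (auto simp: mat_def)

lemma norm_mat_1_sq: "(norm (mat 1 :: complex^'d^'d))\<^sup>2 = CARD('d)"
proof -
  have "(cmod ((mat 1 :: complex^'d^'d)$i$j))\<^sup>2 = (if i = j then 1 else 0)" for i j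
    by (simp add: mat_def)
  then show ?thesis unfolding norm_matrix_sq by simp
qed

text \<open>A maximiser of \<open>|det|\<close> on the
  Frobenius ball has orthogonal rows of equal length, since otherwise a determinant-preserving row
  operation would shorten it.\<close>
lemma unitary_if_det_1_norm_le:
  fixes C :: "complex^'d^'d"
  assumes C: "(norm C)\<^sup>2 \<le> CARD('d)" "cmod (det C) = 1"
  shows "C ** adjm C = mat 1"
proof -
  define R where "R = sqrt CARD('d)"
  have R: "norm B \<le> R \<longleftrightarrow> (norm B)\<^sup>2 \<le> CARD('d)" for B :: "complex^'d^'d"
    unfolding R_def by (metis norm_ge_zero real_le_rsqrt real_sqrt_le_iff real_sqrt_pow2 real_sqrt_power sqrt_le_D)
  obtain A :: "complex^'d^'d" where A: "norm A \<le> R" "\<And>B. norm (B :: complex^'d^'d) \<le> R \<Longrightarrow> cmod (det B) \<le> cmod (det A)"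
  proof -
    have "\<exists>A\<in>cball 0 R. \<forall>B\<in>cball 0 R. cmod (det (B::complex^'d^'d)) \<le> cmod (det (A::complex^'d^'d))"
      by (rule continuous_attains_sup)
         (auto simp: R_def intro!: continuous_on_norm continuous_on_det)
    then obtain A :: "complex^'d^'d" where "A \<in> cball 0 R" "\<forall>B\<in>cball 0 R. cmod (det (B::complex^'d^'d)) \<le> cmod (det A)"
      by blast
    then show ?thesis by (metis mem_cball_0 that)
  qed
  \<comment> \<open>Stated for an arbitrary maximiser \<open>B\<close> because it is used twice: for
    \<open>A\<close>, to see that the maximum is 1, and then for \<open>C\<close>, which attains
    this value and is therefore a maximiser too.\<close>
  have scal: "cmod (det B) \<le> 1 \<and> (cmod (det B) = 1 \<longrightarrow> B ** adjm B = mat 1)"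
    if B: "norm B \<le> R" "det B \<noteq> 0" "\<And>X. norm (X :: complex^'d^'d) \<le> R \<Longrightarrow> cmod (det X) \<le> cmod (det B)" for B :: "complex^'d^'d"
  proof -
    define l where "l = (norm B)\<^sup>2 / CARD('d)"
    have l: "0 \<le> l" "l \<le> 1" using B(1) by (auto simp: l_def R)
    have eq: "B ** adjm B = mat (of_real l)"
      unfolding l_def by (rule det_max_scalar) (use B in auto)
    have "of_real ((cmod (det B))\<^sup>2) = complex_of_real (l ^ CARD('d))"
      using arg_cong[OF eq, of det] unfolding det_mult_adjm det_mat_of by simp
    then have sq: "(cmod (det B))\<^sup>2 = l ^ CARD('d)" by (simp only: of_real_eq_iff)
    then have "cmod (det B) \<le> 1"
      using l by (metis norm_ge_zero one_power2 power2_le_imp_le power_le_one zero_le_one)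
    moreover have "B ** adjm B = mat 1" if "cmod (det B) = 1"
    proof -
      have "l ^ CARD('d) = 1" using sq that by simp
      then have "l = 1" using l by (metis power_eq_1_iff abs_of_nonneg real_norm_def zero_less_card_finite less_numeral_extra(3))
      then show ?thesis using eq by simp
    qed
    ultimately show ?thesis by blast
  qed
  have C': "norm C \<le> R" using C R by simp
  have "cmod (det A) \<ge> 1" using A(2)[OF C'] C by simp
  with scal[of A] A have "cmod (det A) = 1" by fastforce
  moreover have "det C \<noteq> 0" using C by auto
  ultimately show ?thesis using scal[of C] C C' A by auto
qed

text \<open>The adjugate in Cramer's form: column \<open>k\<close> of \<open>X\<close> is replaced
  by the j-th unit vector. Being polynomial in the entries, it stays holomorphic and is controlled
  by a power of the norm, unlike the inverse.\<close>

definition cofactor_matrix :: "complex^'d^'d \<Rightarrow> complex^'d^'d" where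
  "cofactor_matrix X = (\<chi> k j. det (\<chi> i l. if l = k then axis j 1 $ i else X $ i $ l))"

lemma cofactor_matrix_mult:
  fixes X :: "complex^'d^'d"
  assumes "det X \<noteq> 0"
  shows "cofactor_matrix X ** X = mat (det X)"
proof -
  define Y :: "complex^'d^'d" where "Y = (\<chi> k j. cofactor_matrix X $ k $ j / det X)"
  have "X *v column j Y = axis j 1" for j
  proof -
    have "column j Y = (\<chi> k. det (\<chi> i l. if l = k then axis j 1 $ i else X $ i $ l) / det X)"
      by (simp add: Y_def column_def cofactor_matrix_def)
    then show ?thesis using cramer[OF assms, of "column j Y" "axis j 1"] by blast
  qed
  then have "(X ** Y) $ i $ j = axis j 1 $ i" for i j
    by (simp add: matrix_matrix_mult_def matrix_vector_mult_def column_def vec_eq_iff)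
  then have "X ** Y = mat 1" by (simp add: vec_eq_iff mat_def axis_def)
  then have Y: "Y ** X = mat 1" by (simp add: matrix_left_right_inverse)
  have "(cofactor_matrix X ** X) $ i $ j = det X * (Y ** X) $ i $ j" for i j
    using assms by (simp add: matrix_matrix_mult_def Y_def sum_distrib_left)
  then show ?thesis by (simp add: Y vec_eq_iff mat_def)
qed

text \<open>The assumption \<open>1 \<le> b\<close> covers the entries of the inserted unit
  vector.\<close>

lemma cofactor_matrix_bound:
  fixes X :: "complex^'d^'d" and b :: real
  assumes "1 \<le> b" "norm X \<le> b"
  shows "cmod (cofactor_matrix X $ k $ j) \<le> fact CARD('d) * b ^ CARD('d)"
  unfolding cofactor_matrix_def
proof (simp, rule cmod_det_le)
  fix i l
  have "cmod (X $ i $ l) \<le> b" using norm_entry_le[of X i l] assms by simp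
  then show "cmod ((\<chi> i l. if l = k then axis j 1 $ i else X $ i $ l) $ i $ l) \<le> b"
    using assms by (auto simp: axis_def)
qed

subsection \<open>Square-integrable functions on the circle\<close>

lemma sets_T_meas [measurable_cong, simp]: "sets T_meas = sets borel"
  by (simp add: T_meas_def)

lemma space_T_meas [simp]: "space T_meas = UNIV"
  by (simp add: T_meas_def)

lemma borel_measurable_T_meas [simp]: "borel_measurable T_meas = borel_measurable borel"
  by (rule measurable_cong_sets) simp_all

lemma measurable_cis_restrict: "cis \<in> restrict_space lborel A \<rightarrow>\<^sub>M borel"
proof -
  have "cis \<in> borel_measurable borel"
    unfolding cis_conv_exp by (intro borel_measurable_continuous_onI continuous_intros)
  then show ?thesis by (simp add: measurable_restrict_space1)
qed

text \<open>Arc length is not normalised; this is the origin of the factors \<open>2 * pi\<close>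
  below.\<close>

lemma emeasure_T_meas: "emeasure T_meas UNIV = ennreal (2 * pi)"
proof -
  have "emeasure T_meas UNIV = emeasure (restrict_space lborel {0..<2*pi}) (space (restrict_space lborel {0..<2*pi}))"
    unfolding T_meas_def by (subst emeasure_distr[OF measurable_cis_restrict]) (auto)
  also have "\<dots> = ennreal (2 * pi)"
    by (simp add: emeasure_restrict_space space_restrict_space)
  finally show ?thesis .
qed

interpretation T: finite_measure T_meas
  by (rule finite_measureI) (simp add: emeasure_T_meas)

lemma measure_T_meas: "measure T_meas UNIV = 2 * pi"
  by (simp add: measure_def emeasure_T_meas)

lemma AE_T_norm: "AE w in T_meas. cmod w = 1"
  unfolding T_meas_def by (subst AE_distr_iff[OF measurable_cis_restrict]) auto

lemma integral_T_power_zero: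
  assumes "k \<ge> 1"
  shows "(\<integral>w. w ^ k \<partial>T_meas) = 0"
proof -
  have [measurable]: "(\<lambda>w::complex. w ^ k) \<in> borel_measurable borel" by simp
  have "(\<integral>w. w ^ k \<partial>T_meas) = (\<integral>t. cis t ^ k \<partial>restrict_space lborel {0..<2*pi})"
    unfolding T_meas_def by (rule integral_distr[OF measurable_cis_restrict]) simp
  also have "\<dots> = (\<integral>t. indicator {0..<2*pi} t *\<^sub>R cis t ^ k \<partial>lborel)"
    by (subst integral_restrict_space) simp_all
  \<comment> \<open>Closing the interval at \<open>2*pi\<close> changes a null set only and permits
    the fundamental theorem of calculus.\<close>
  also have "\<dots> = (\<integral>t. indicator {0..2*pi} t *\<^sub>R cis (real k * t) \<partial>lborel)"
  proof (rule integral_cong_AE)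
    have "cis \<in> borel_measurable borel"
      unfolding cis_conv_exp by (intro borel_measurable_continuous_onI continuous_intros)
    then have [measurable]: "(\<lambda>x. cis (f x)) \<in> borel_measurable borel" if "f \<in> borel_measurable borel" for f :: "real \<Rightarrow> real"
      using that by (rule measurable_compose_rev)
    show "(\<lambda>t. indicator {0..<2*pi} t *\<^sub>R cis t ^ k) \<in> borel_measurable lborel"
      "(\<lambda>t. indicator {0..2*pi} t *\<^sub>R cis (real k * t)) \<in> borel_measurable lborel" by measurable
    show "AE t in lborel. indicator {0..<2*pi} t *\<^sub>R cis t ^ k = indicator {0..2*pi} t *\<^sub>R cis (real k * t)"
      using AE_lborel_singleton[of "2*pi"] by eventually_elim (auto simp: indicator_def intro!: Complex.DeMoivre)
  qed
  also have "\<dots> = cis (real k * (2*pi)) / (\<i> * of_nat k) - cis (real k * 0) / (\<i> * of_nat k)"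
  proof (rule integral_FTC_Icc)
    show "((\<lambda>t. cis (real k * t) / (\<i> * of_nat k)) has_vector_derivative cis (real k * t)) (at t within {0..2*pi})" for t
    proof -
      have "((\<lambda>z. exp (\<i> * (of_nat k * z)) / (\<i> * of_nat k)) has_field_derivative exp (\<i> * (of_nat k * of_real t))) (at (of_real t))"
        using assms by (auto intro!: derivative_eq_intros) (simp add: ac_simps)
      from has_vector_derivative_real_field[OF this] show ?thesis
        by (simp add: cis_conv_exp)
    qed
    show "continuous_on {0..2*pi} (\<lambda>t. cis (real k * t))"
      unfolding cis_conv_exp by (intro continuous_intros)
  qed simp
  also have "cis (real k * (2*pi)) = 1"
    by (metis Complex.DeMoivre cis_2pi power_one)
  finally show ?thesis by simp
qed

text \<open>The target is a general euclidean space so that the same rules serve scalar and matrix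
  functions.\<close>

definition L2T :: "(complex \<Rightarrow> 'b::euclidean_space) \<Rightarrow> bool" where
  "L2T f \<longleftrightarrow> f \<in> borel_measurable borel \<and> integrable T_meas (\<lambda>w. (norm (f w))\<^sup>2)"

definition sqnorm :: "(complex \<Rightarrow> 'b::euclidean_space) \<Rightarrow> real" where
  "sqnorm f = (\<integral>w. (norm (f w))\<^sup>2 \<partial>T_meas)"

lemma L2T_measurable: "L2T f \<Longrightarrow> f \<in> borel_measurable borel"
  by (simp add: L2T_def)

text \<open>All L2 estimates use squared norms; this replaces the triangle inequality, and its
  factors 2 produce constants such as 10 and 7 later.\<close>

lemma norm_add_sq_le: "(norm (x + y))\<^sup>2 \<le> 2 * (norm x)\<^sup>2 + 2 * (norm (y::'b::real_normed_vector))\<^sup>2"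
proof -
  have "(norm (x + y))\<^sup>2 \<le> (norm x + norm y)\<^sup>2"
    by (intro power_mono norm_triangle_ineq) simp
  also have "\<dots> \<le> 2 * (norm x)\<^sup>2 + 2 * (norm y)\<^sup>2"
    using sum_squares_bound[of "norm x" "norm y"] by (simp add: power2_sum)
  finally show ?thesis .
qed

lemma L2T_dominated:
  assumes "f \<in> borel_measurable borel" "integrable T_meas h" "AE w in T_meas. (norm (f w))\<^sup>2 \<le> h w"
  shows "L2T f"
  unfolding L2T_def
proof (intro conjI assms(1))
  have [measurable]: "f \<in> borel_measurable borel" by fact
  show "integrable T_meas (\<lambda>w. (norm (f w))\<^sup>2)"
    by (rule Bochner_Integration.integrable_bound[OF assms(2)]) (use assms(3) in \<open>auto elim!: eventually_mono\<close>)
qed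

lemma L2T_add:
  assumes "L2T f" "L2T g"
  shows "L2T (\<lambda>w. f w + g w)" "sqnorm (\<lambda>w. f w + g w) \<le> 2 * sqnorm f + 2 * sqnorm g"
proof -
  have [measurable]: "f \<in> borel_measurable borel" "g \<in> borel_measurable borel"
    using assms by (auto simp: L2T_def)
  have i: "integrable T_meas (\<lambda>w. 2 * (norm (f w))\<^sup>2 + 2 * (norm (g w))\<^sup>2)"
    using assms by (simp add: L2T_def)
  show L: "L2T (\<lambda>w. f w + g w)"
    by (rule L2T_dominated[OF _ i]) (auto intro: norm_add_sq_le)
  have "sqnorm (\<lambda>w. f w + g w) \<le> (\<integral>w. 2 * (norm (f w))\<^sup>2 + 2 * (norm (g w))\<^sup>2 \<partial>T_meas)"
    unfolding sqnorm_def using L by (intro integral_mono i norm_add_sq_le) (simp add: L2T_def)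
  also have "\<dots> = 2 * sqnorm f + 2 * sqnorm g"
    using assms by (simp add: L2T_def sqnorm_def)
  finally show "sqnorm (\<lambda>w. f w + g w) \<le> 2 * sqnorm f + 2 * sqnorm g" .
qed

lemma L2T_uminus: "L2T f \<Longrightarrow> L2T (\<lambda>w. - f w)" "sqnorm (\<lambda>w. - f w) = sqnorm f"
  by (auto simp: L2T_def sqnorm_def)

lemma L2T_diff:
  assumes "L2T f" "L2T g"
  shows "L2T (\<lambda>w. f w - g w)" "sqnorm (\<lambda>w. f w - g w) \<le> 2 * sqnorm f + 2 * sqnorm g"
  using L2T_add[OF assms(1) L2T_uminus(1)[OF assms(2)]] by (simp_all add: L2T_uminus(2))

lemma sqnorm_nonneg: "sqnorm f \<ge> 0"
  by (simp add: sqnorm_def)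

lemma sqnorm_diff_commute: "sqnorm (\<lambda>w. f w - g w) = sqnorm (\<lambda>w. g w - f w)"
  by (simp add: sqnorm_def norm_minus_commute)

lemma L2T_cmult:
  fixes f :: "complex \<Rightarrow> complex"
  assumes "L2T f" shows "L2T (\<lambda>w. c * f w)" "sqnorm (\<lambda>w. c * f w) = (cmod c)\<^sup>2 * sqnorm f"
  using assms by (auto simp: L2T_def sqnorm_def norm_mult power_mult_distrib)

lemma L2T_integrable:
  assumes "L2T f"
  shows "integrable T_meas f"
proof (rule Bochner_Integration.integrable_bound)
  show "integrable T_meas (\<lambda>w. 1 + (norm (f w))\<^sup>2)"
    using assms by (simp add: L2T_def)
  show "f \<in> borel_measurable T_meas" using assms by (simp add: L2T_def)
  have "norm (f w) \<le> 1 + (norm (f w))\<^sup>2" for w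
    using sum_squares_bound[of 1 "norm (f w)"] by (simp add: power2_eq_square) (smt (verit) norm_ge_zero)
  then show "AE w in T_meas. norm (f w) \<le> norm (1 + (norm (f w))\<^sup>2)"
    by (auto simp: add_nonneg_nonneg)
qed

lemma memLp_2_iff: "memLp T_meas 2 f \<longleftrightarrow> L2T f"
proof -
  have "(\<integral>\<^sup>+ x. ennreal (cmod (f x) powr 2) \<partial>T_meas) = (\<integral>\<^sup>+ x. ennreal (norm ((cmod (f x))\<^sup>2)) \<partial>T_meas)"
    by (intro nn_integral_cong) (simp add: powr_numeral)
  then show ?thesis
    by (auto simp: memLp_def L2T_def integrable_iff_bounded)
qed

lemma H2_L2T: "H2 g \<Longrightarrow> L2T g"
  by (simp add: H2_def memLp_2_iff)

lemma H2_vanish: "H2 g \<Longrightarrow> k \<ge> 1 \<Longrightarrow> (\<integral>w. g w * w ^ k \<partial>T_meas) = 0"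
  by (simp add: H2_def)

subsection \<open>Cauchy and Poisson integrals\<close>

lemma cauchy_ext_0:
  fixes f :: "complex \<Rightarrow> complex"
  shows "cauchy_ext f 0 = (1 / (2 * pi)) * (\<integral>w. f w \<partial>T_meas)"
proof -
  have "(\<integral>w. f w * w / (w - 0) \<partial>T_meas) = (\<integral>w. f w \<partial>T_meas)"
  proof (cases "f \<in> borel_measurable borel")
    case True
    then have [measurable]: "f \<in> borel_measurable borel" .
    show ?thesis
    proof (rule integral_cong_AE)
      show "AE w in T_meas. f w * w / (w - 0) = f w"
        using AE_T_norm by eventually_elim auto
    qed auto
  next
    \<comment> \<open>Without measurability neither function is integrable, and both integrals are 0
      by convention; the identity therefore holds for every \<open>f\<close>.\<close>
    case False
    have "(\<lambda>w. f w * w / (w - 0)) \<notin> borel_measurable borel"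
    proof
      assume "(\<lambda>w. f w * w / (w - 0)) \<in> borel_measurable borel"
      \<comment> \<open>Only at \<open>w = 0\<close>, where the quotient is 0 by the convention for
        division, does the integrand fail to return \<open>f w\<close>; patching this one point
        recovers \<open>f\<close>.\<close>
      then have "(\<lambda>w. if w = 0 then f 0 else f w * w / (w - 0)) \<in> borel_measurable borel"
        by measurable
      also have "(\<lambda>w. if w = 0 then f 0 else f w * w / (w - 0)) = f" by auto
      finally show False using False by simp
    qed
    then have n: "\<not> integrable T_meas (\<lambda>w. f w * w / (w - 0))" "\<not> integrable T_meas f"
      using False borel_measurable_integrable by fastforce+
    show ?thesis unfolding not_integrable_integral_eq[OF n(1)] not_integrable_integral_eq[OF n(2)] ..
  qed
  then show ?thesis by (simp add: cauchy_ext_def)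
qed

text \<open>On the circle \<open>cnj w\<close> is the inverse of \<open>w\<close>, so the Cauchy
  kernel is \<open>1 / (1 - cnj w * z)\<close>.\<close>

lemma geometric_kernel:
  assumes "cmod w = 1" "cmod z < 1"
  shows "(\<lambda>k. cnj w ^ k * z ^ k) sums (w / (w - z))"
proof -
  have n: "norm (cnj w * z) < 1" using assms by (simp add: norm_mult)
  have ww: "w * cnj w = 1" using assms by (simp add: mult_cnj_eq)
  have "w \<noteq> z" using assms by auto
  have "w / (w - z) = 1 / (1 - cnj w * z)"
  proof -
    have "1 - cnj w * z \<noteq> 0" using n by (metis eq_iff_diff_eq_0 less_irrefl norm_one)
    moreover have "w * (1 - cnj w * z) = w - z" using ww by (simp add: algebra_simps)
    ultimately show ?thesis using \<open>w \<noteq> z\<close> by (simp add: field_simps)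
  qed
  then show ?thesis
    using geometric_sums[OF n] by (simp add: power_mult_distrib)
qed

text \<open>Termwise integration against an integrable \<open>g\<close> with a Weierstrass majorant
  \<open>b\<close> valid on the circle. It serves both the Taylor expansion of
  \<open>cauchy_ext\<close> and \<open>H2_mean_mult\<close>.\<close>

lemma integral_sums_mult:
  fixes g :: "complex \<Rightarrow> complex"
  assumes g: "integrable T_meas g" and b: "summable b"
    and [measurable]: "\<And>k. c k \<in> borel_measurable borel" "h \<in> borel_measurable borel"
    and cb: "\<And>k w. cmod w = 1 \<Longrightarrow> cmod (c k w) \<le> b k"
    and ch: "\<And>w. cmod w = 1 \<Longrightarrow> (\<lambda>k. c k w) sums h w"
  shows "(\<lambda>k. \<integral>w. c k w * g w \<partial>T_meas) sums (\<integral>w. h w * g w \<partial>T_meas)"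
proof -
  have [measurable]: "g \<in> borel_measurable borel" using g by (auto dest: borel_measurable_integrable)
  have le: "cmod (c k w * g w) \<le> b k * cmod (g w)" if "cmod w = 1" for k w
    using cb[OF that, of k] by (simp add: norm_mult mult_right_mono)
  have ig: "integrable T_meas (\<lambda>w. b k * cmod (g w))" for k using g by auto
  have i: "integrable T_meas (\<lambda>w. c k w * g w)" for k
  proof (rule Bochner_Integration.integrable_bound[OF ig[of k]])
    show "AE w in T_meas. norm (c k w * g w) \<le> norm (b k * cmod (g w))"
      using AE_T_norm by eventually_elim (use le abs_ge_self order_trans in \<open>fastforce simp: real_norm_def\<close>)
  qed simp
  have "(\<lambda>k. \<integral>w. c k w * g w \<partial>T_meas) sums (\<integral>w. (\<Sum>k. c k w * g w) \<partial>T_meas)"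
  proof (rule sums_integral[OF i])
    show "AE w in T_meas. summable (\<lambda>k. norm (c k w * g w))"
      using AE_T_norm
      by eventually_elim (rule summable_comparison_test[OF _ summable_mult2[OF b]], use le in auto)
    show "summable (\<lambda>k. \<integral>w. norm (c k w * g w) \<partial>T_meas)"
    proof (rule summable_comparison_test[OF _ summable_mult2[OF b]], intro exI[of _ 0] allI impI)
      fix k
      have "(\<integral>w. norm (c k w * g w) \<partial>T_meas) \<le> (\<integral>w. b k * cmod (g w) \<partial>T_meas)"
      proof (rule integral_mono_AE[OF integrable_norm[OF i] ig])
        show "AE w in T_meas. norm (c k w * g w) \<le> b k * cmod (g w)"
          using AE_T_norm by eventually_elim (rule le)
      qed
      then show "norm (\<integral>w. norm (c k w * g w) \<partial>T_meas) \<le> b k * (\<integral>w. cmod (g w) \<partial>T_meas)" by simp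
    qed
  qed
  also have "(\<integral>w. (\<Sum>k. c k w * g w) \<partial>T_meas) = (\<integral>w. h w * g w \<partial>T_meas)"
  proof (rule integral_cong_AE)
    show "AE w in T_meas. (\<Sum>k. c k w * g w) = h w * g w"
      using AE_T_norm by eventually_elim (use sums_mult2[OF ch] in \<open>simp add: sums_iff\<close>)
  qed measurable
  finally show ?thesis .
qed

lemma cauchy_ext_sums:
  fixes f :: "complex \<Rightarrow> complex"
  assumes f: "integrable T_meas f" and z: "cmod z < 1"
  shows "(\<lambda>k. (1 / (2 * pi)) * (\<integral>w. f w * cnj w ^ k \<partial>T_meas) * z ^ k) sums cauchy_ext f z"
proof -
  have [measurable]: "cnj \<in> borel_measurable borel"
    by (intro borel_measurable_continuous_onI continuous_intros)
  have "(\<lambda>k. \<integral>w. (cnj w ^ k * z ^ k) * f w \<partial>T_meas) sums (\<integral>w. w / (w - z) * f w \<partial>T_meas)"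
    by (rule integral_sums_mult[OF f, of "\<lambda>k. cmod z ^ k"])
       (use z geometric_kernel[OF _ z] in \<open>auto simp: summable_geometric norm_mult norm_power\<close>)
  moreover have "(\<integral>w. (cnj w ^ k * z ^ k) * f w \<partial>T_meas) = (\<integral>w. f w * cnj w ^ k \<partial>T_meas) * z ^ k" for k
    by (subst integral_mult_left_zero[symmetric]) (simp add: ac_simps)
  moreover have "(\<integral>w. w / (w - z) * f w \<partial>T_meas) = (\<integral>w. f w * w / (w - z) \<partial>T_meas)"
    by (simp add: mult.commute)
  ultimately show ?thesis
    unfolding cauchy_ext_def mult.assoc by (intro sums_mult) simp
qed

lemma cauchy_ext_holomorphic:
  fixes f :: "complex \<Rightarrow> complex"
  assumes f: "integrable T_meas f"
  shows "cauchy_ext f holomorphic_on ball 0 1"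
  by (rule power_series_holomorphic[where a = "\<lambda>k. (1 / (2 * pi)) * (\<integral>w. f w * cnj w ^ k \<partial>T_meas)"])
     (use cauchy_ext_sums[OF f] in auto)

text \<open>The integrals assumed to vanish are, up to \<open>2 * pi\<close>, the Taylor
  coefficients of positive order. This applies to constants and to conjugates of \<open>H2\<close>
  functions.\<close>

lemma cauchy_ext_eq_0:
  fixes f :: "complex \<Rightarrow> complex"
  assumes f: "integrable T_meas f" and z: "cmod z < 1"
    and "\<And>k. k \<ge> 1 \<Longrightarrow> (\<integral>w. f w * cnj w ^ k \<partial>T_meas) = 0"
  shows "cauchy_ext f z = cauchy_ext f 0"
proof -
  have "(\<lambda>k. (1 / (2 * pi)) * (\<integral>w. f w * cnj w ^ k \<partial>T_meas) * z ^ k) = (\<lambda>k. if k = 0 then cauchy_ext f 0 else 0)"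
    using assms(3) by (auto simp: fun_eq_iff cauchy_ext_0)
  then have "(\<lambda>k. if k = 0 then cauchy_ext f 0 else 0) sums cauchy_ext f z"
    using cauchy_ext_sums[OF f z] by simp
  moreover have "(\<lambda>k. if k = 0 then cauchy_ext f 0 else 0) sums cauchy_ext f 0"
    using sums_single[of 0 "\<lambda>_. cauchy_ext f 0"] by (simp add: eq_commute)
  ultimately show ?thesis by (rule sums_unique2)
qed

text \<open>The Poisson kernel, as the real part of the Herglotz kernel that occurs in
  \<open>is_outer\<close>. Its integral over the circle is \<open>2 * pi\<close>.\<close>

definition pkernel :: "complex \<Rightarrow> complex \<Rightarrow> real" where
  "pkernel w z = Re ((w + z) / (w - z))"

lemma pkernel_eq:
  assumes "cmod w = 1" "cmod z < 1"
  shows "pkernel w z = (1 - (cmod z)\<^sup>2) / (cmod (w - z))\<^sup>2"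
proof -
  have "w \<noteq> z" using assms by auto
  have "(w + z) / (w - z) = (w + z) * cnj (w - z) / of_real ((cmod (w - z))\<^sup>2)"
    using \<open>w \<noteq> z\<close> by (simp add: mult_cnj_eq[symmetric])
  then have "pkernel w z = Re ((w + z) * cnj (w - z)) / (cmod (w - z))\<^sup>2"
    unfolding pkernel_def by (simp only: Re_divide_of_real)
  also have "Re ((w + z) * cnj (w - z)) = (cmod w)\<^sup>2 - (cmod z)\<^sup>2"
    unfolding cmod_power2 by (simp add: power2_eq_square algebra_simps)
  finally show ?thesis using assms by simp
qed

lemma pkernel_nonneg: "cmod w = 1 \<Longrightarrow> cmod z < 1 \<Longrightarrow> pkernel w z \<ge> 0"
  by (simp add: pkernel_eq power_le_one)

lemma norm_kernel_le:
  assumes "cmod w = 1" "cmod z < 1"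
  shows "cmod (w / (w - z)) \<le> 1 / (1 - cmod z)" "cmod ((w + z) / (w - z)) \<le> 2 / (1 - cmod z)"
proof -
  have le: "1 - cmod z \<le> cmod (w - z)" using assms norm_triangle_ineq2[of w z] by simp
  have le2: "cmod (w + z) \<le> 2" using assms norm_triangle_ineq[of w z] by simp
  show "cmod (w / (w - z)) \<le> 1 / (1 - cmod z)" "cmod ((w + z) / (w - z)) \<le> 2 / (1 - cmod z)"
    unfolding norm_divide using le le2 assms by (auto intro!: frac_le)
qed

lemma integrable_herglotz_kernel:
  fixes f :: "complex \<Rightarrow> complex"
  assumes f: "integrable T_meas f" and z: "cmod z < 1"
  shows "integrable T_meas (\<lambda>w. f w * w / (w - z))" "integrable T_meas (\<lambda>w. (w + z) / (w - z) * f w)"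
proof -
  have [measurable]: "f \<in> borel_measurable borel" using f by (auto dest: borel_measurable_integrable)
  have bound: "integrable T_meas (\<lambda>w. k w * f w)"
    if [measurable]: "k \<in> borel_measurable borel" and k: "\<And>w. cmod w = 1 \<Longrightarrow> cmod (k w) \<le> c" for k c
  proof (rule Bochner_Integration.integrable_bound[of _ "\<lambda>w. c * cmod (f w)"])
    show "AE w in T_meas. norm (k w * f w) \<le> norm (c * cmod (f w))"
      using AE_T_norm
    proof eventually_elim
      case (elim w)
      have "norm (k w * f w) \<le> c * cmod (f w)"
        using k[OF elim] by (simp add: norm_mult mult_right_mono)
      then show ?case unfolding real_norm_def by (rule order_trans) (rule abs_ge_self)
    qed
  qed (use f in auto)
  show "integrable T_meas (\<lambda>w. (w + z) / (w - z) * f w)"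
    by (rule bound[OF _ norm_kernel_le(2)[OF _ z]]) auto
  have "integrable T_meas (\<lambda>w. w / (w - z) * f w)"
    by (rule bound[OF _ norm_kernel_le(1)[OF _ z]]) auto
  then show "integrable T_meas (\<lambda>w. f w * w / (w - z))" by (simp add: mult.commute)
qed

text \<open>The exponent in \<open>is_outer\<close>; for real \<open>f\<close> it is an analytic
  function whose real part is the Poisson integral of \<open>f\<close>.\<close>

definition herglotz :: "(complex \<Rightarrow> complex) \<Rightarrow> complex \<Rightarrow> complex" where
  "herglotz f z = (1 / (2 * pi)) * (\<integral>w. (w + z) / (w - z) * f w \<partial>T_meas)"

lemma herglotz_eq_cauchy_ext:
  fixes f :: "complex \<Rightarrow> complex"
  assumes f: "integrable T_meas f" and z: "cmod z < 1"
  shows "herglotz f z = 2 * cauchy_ext f z - cauchy_ext f 0"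
proof -
  have [measurable]: "f \<in> borel_measurable borel" using f by (auto dest: borel_measurable_integrable)
  have "(\<integral>w. (w + z) / (w - z) * f w \<partial>T_meas) = (\<integral>w. 2 * (f w * w / (w - z)) - f w \<partial>T_meas)"
  proof (rule integral_cong_AE)
    show "AE w in T_meas. (w + z) / (w - z) * f w = 2 * (f w * w / (w - z)) - f w"
      using AE_T_norm
    proof eventually_elim
      case (elim w)
      then have "w - z \<noteq> 0" using z by auto
      then show ?case by (simp add: field_simps)
    qed
  qed auto
  also have "\<dots> = 2 * (\<integral>w. f w * w / (w - z) \<partial>T_meas) - (\<integral>w. f w \<partial>T_meas)"
    using integrable_herglotz_kernel(1)[OF assms] f
    by (subst Bochner_Integration.integral_diff[OF integrable_mult_right])
       (simp_all only: integral_mult_right_zero)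
  finally have eq: "(\<integral>w. (w + z) / (w - z) * f w \<partial>T_meas) = 2 * (\<integral>w. f w * w / (w - z) \<partial>T_meas) - (\<integral>w. f w \<partial>T_meas)" .
  show ?thesis
    unfolding herglotz_def cauchy_ext_0 unfolding cauchy_ext_def eq by (simp add: algebra_simps)
qed

lemma herglotz_holomorphic:
  fixes f :: "complex \<Rightarrow> complex"
  assumes f: "integrable T_meas f"
  shows "herglotz f holomorphic_on ball 0 1"
proof -
  have "(\<lambda>z. 2 * cauchy_ext f z - cauchy_ext f 0) holomorphic_on ball 0 1"
    by (intro holomorphic_intros cauchy_ext_holomorphic f)
  then show ?thesis
    by (rule holomorphic_transform) (simp add: herglotz_eq_cauchy_ext[OF f])
qed

lemma integrable_pkernel:
  fixes f :: "complex \<Rightarrow> 'b::{banach, second_countable_topology}"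
  assumes f: "integrable T_meas f" and z: "cmod z < 1"
  shows "integrable T_meas (\<lambda>w. pkernel w z *\<^sub>R f w)"
proof (rule Bochner_Integration.integrable_bound[of _ "\<lambda>w. (2 / (1 - cmod z)) *\<^sub>R f w"])
  have [measurable]: "f \<in> borel_measurable borel" using f by (auto dest: borel_measurable_integrable)
  show "(\<lambda>w. pkernel w z *\<^sub>R f w) \<in> borel_measurable T_meas" unfolding pkernel_def by measurable
  show "AE w in T_meas. norm (pkernel w z *\<^sub>R f w) \<le> norm ((2 / (1 - cmod z)) *\<^sub>R f w)"
    using AE_T_norm
  proof eventually_elim
    case (elim w)
    have "\<bar>pkernel w z\<bar> \<le> 2 / (1 - cmod z)"
      using norm_kernel_le(2)[OF elim z] abs_Re_le_cmod[of "(w + z) / (w - z)"] unfolding pkernel_def by linarith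
    then have "\<bar>pkernel w z\<bar> * norm (f w) \<le> 2 / (1 - cmod z) * norm (f w)"
      by (rule mult_right_mono) simp
    then show ?case using z by simp
  qed
qed (use f in auto)

lemma Re_herglotz:
  assumes f: "integrable T_meas (f :: complex \<Rightarrow> real)" and z: "cmod z < 1"
  shows "Re (herglotz (\<lambda>w. of_real (f w)) z) = (1 / (2 * pi)) * (\<integral>w. pkernel w z * f w \<partial>T_meas)"
proof -
  have f': "integrable T_meas (\<lambda>w. complex_of_real (f w))" using f by simp
  have "Re (\<integral>w. (w + z) / (w - z) * of_real (f w) \<partial>T_meas) = (\<integral>w. Re ((w + z) / (w - z) * of_real (f w)) \<partial>T_meas)"
    using integrable_herglotz_kernel(2)[OF f' z] by (rule integral_Re[symmetric])
  also have "\<dots> = (\<integral>w. pkernel w z * f w \<partial>T_meas)"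
  proof -
    have "Re (a * of_real b) = Re a * b" for a b by simp
    then show ?thesis by (simp only: pkernel_def)
  qed
  finally show ?thesis by (simp add: herglotz_def Re_divide_of_real)
qed

lemma integral_pkernel:
  assumes z: "cmod z < 1"
  shows "(\<integral>w. pkernel w z \<partial>T_meas) = 2 * pi"
proof -
  have "(\<integral>w. 1 * cnj w ^ k \<partial>T_meas) = 0" if "k \<ge> 1" for k
  proof -
    have "(\<integral>w. 1 * cnj w ^ k \<partial>T_meas) = (\<integral>w. cnj (w ^ k) \<partial>T_meas)" by simp
    also have "\<dots> = cnj (\<integral>w. w ^ k \<partial>T_meas)" by (rule Bochner_Integration.integral_cnj)
    finally show ?thesis using integral_T_power_zero[OF that] by simp
  qed
  then have "cauchy_ext (\<lambda>_. 1) z = cauchy_ext (\<lambda>_. 1) 0"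
    by (intro cauchy_ext_eq_0 z) auto
  also have "\<dots> = 1"
    by (simp add: cauchy_ext_0 measure_T_meas scaleR_conv_of_real)
  finally have "herglotz (\<lambda>_. of_real 1) z = 1"
    using z by (simp add: herglotz_eq_cauchy_ext cauchy_ext_0 measure_T_meas scaleR_conv_of_real)
  with Re_herglotz[of "\<lambda>_. 1", OF _ z] show ?thesis by simp
qed

text \<open>Averaging a complex function with a nonnegative kernel gives Jensen's inequality and an
  L2 contraction, which the Cauchy kernel does not give directly; on \<open>H2\<close> the two
  integrals agree.\<close>

definition poisson :: "(complex \<Rightarrow> complex) \<Rightarrow> complex \<Rightarrow> complex" where
  "poisson f z = complex_of_real (1 / (2 * pi)) * (\<integral>w. pkernel w z *\<^sub>R f w \<partial>T_meas)"

lemma poisson_add: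
  "integrable T_meas f \<Longrightarrow> integrable T_meas g \<Longrightarrow> cmod z < 1 \<Longrightarrow> poisson (\<lambda>w. f w + g w) z = poisson f z + poisson g z"
  unfolding poisson_def using integrable_pkernel[of f z] integrable_pkernel[of g z]
  by (simp add: scaleR_add_right ring_distribs)

lemma poisson_diff:
  "integrable T_meas f \<Longrightarrow> integrable T_meas g \<Longrightarrow> cmod z < 1 \<Longrightarrow> poisson (\<lambda>w. f w - g w) z = poisson f z - poisson g z"
  unfolding poisson_def using integrable_pkernel[of f z] integrable_pkernel[of g z]
  by (simp add: scaleR_diff_right right_diff_distrib)

lemma poisson_cmult: "poisson (\<lambda>w. c * f w) z = c * poisson f z"
proof -
  have "(\<integral>w. pkernel w z *\<^sub>R (c * f w) \<partial>T_meas) = c * (\<integral>w. pkernel w z *\<^sub>R f w \<partial>T_meas)"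
    by (subst integral_mult_right_zero[symmetric]) (simp add: scaleR_conv_of_real algebra_simps)
  then show ?thesis by (simp add: poisson_def)
qed

lemma poisson_const: "cmod z < 1 \<Longrightarrow> poisson (\<lambda>_. c) z = c"
  using integral_pkernel[of z] integrable_pkernel[of "\<lambda>_. 1::real" z]
  by (simp add: poisson_def scaleR_conv_of_real)

text \<open>The Poisson kernel is the Cauchy kernel plus its conjugate minus 1. Against
  \<open>g\<close> the conjugate kernel yields only the integral of \<open>g\<close>, since the
  other coefficients it meets vanish for \<open>H2\<close>, and this cancels the term from
  \<open>- 1\<close>.\<close>

lemma poisson_H2:
  assumes g: "H2 g" and z: "cmod z < 1"
  shows "poisson g z = cauchy_ext g z"
proof -
  have gi: "integrable T_meas g" by (intro L2T_integrable H2_L2T g)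
  then have [measurable]: "g \<in> borel_measurable borel" by (auto dest: borel_measurable_integrable)
  have ci: "integrable T_meas (\<lambda>w. cnj (g w))" using gi by simp
  have "cauchy_ext (\<lambda>w. cnj (g w)) z = cauchy_ext (\<lambda>w. cnj (g w)) 0"
  proof (rule cauchy_ext_eq_0[OF ci z])
    fix k :: nat assume k: "k \<ge> 1"
    have "(\<integral>w. cnj (g w) * cnj w ^ k \<partial>T_meas) = (\<integral>w. cnj (g w * w ^ k) \<partial>T_meas)" by simp
    also have "\<dots> = cnj (\<integral>w. g w * w ^ k \<partial>T_meas)" by (rule Bochner_Integration.integral_cnj)
    finally show "(\<integral>w. cnj (g w) * cnj w ^ k \<partial>T_meas) = 0" using H2_vanish[OF g k] by simp
  qed
  then have *: "cnj (\<integral>w. cnj (g w) * w / (w - z) \<partial>T_meas) = (\<integral>w. g w \<partial>T_meas)"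
    by (simp add: cauchy_ext_0) (simp add: cauchy_ext_def)
  have "(\<integral>w. pkernel w z *\<^sub>R g w \<partial>T_meas) = (\<integral>w. g w * w / (w - z) + cnj (cnj (g w) * w / (w - z)) - g w \<partial>T_meas)"
  proof (rule integral_cong_AE)
    show "(\<lambda>w. pkernel w z *\<^sub>R g w) \<in> borel_measurable T_meas" unfolding pkernel_def by measurable
    have [measurable]: "cnj \<in> borel_measurable borel"
      by (intro borel_measurable_continuous_onI continuous_intros)
    show "(\<lambda>w. g w * w / (w - z) + cnj (cnj (g w) * w / (w - z)) - g w) \<in> borel_measurable T_meas"
      by measurable
    show "AE w in T_meas. pkernel w z *\<^sub>R g w = g w * w / (w - z) + cnj (cnj (g w) * w / (w - z)) - g w"
      using AE_T_norm
    proof eventually_elim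
      case (elim w)
      have "w - z \<noteq> 0" using z elim by auto
      then have "(w + z) / (w - z) = w / (w - z) + w / (w - z) - 1"
        by (simp add: add_divide_distrib[symmetric] divide_diff_eq_iff algebra_simps)
      then have "pkernel w z = Re (w / (w - z)) + Re (w / (w - z)) - 1"
        by (simp only: pkernel_def plus_complex.simps minus_complex.simps one_complex.simps)
      then have "complex_of_real (pkernel w z) = w / (w - z) + cnj (w / (w - z)) - 1"
        unfolding complex_add_cnj by simp
      then have "pkernel w z *\<^sub>R g w = (w / (w - z) + cnj (w / (w - z)) - 1) * g w"
        by (simp only: scaleR_conv_of_real)
      then show ?case by (simp add: algebra_simps)
    qed
  qed
  also have "\<dots> = (\<integral>w. g w * w / (w - z) \<partial>T_meas) + (\<integral>w. cnj (cnj (g w) * w / (w - z)) \<partial>T_meas) - (\<integral>w. g w \<partial>T_meas)"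
    using integrable_herglotz_kernel(1)[OF gi z] integrable_herglotz_kernel(1)[OF ci z] gi
    by (simp del: complex_cnj_divide complex_cnj_mult)
  also have "(\<integral>w. cnj (cnj (g w) * w / (w - z)) \<partial>T_meas) = (\<integral>w. g w \<partial>T_meas)"
    unfolding Bochner_Integration.integral_cnj by (rule *)
  finally show ?thesis by (simp add: poisson_def cauchy_ext_def)
qed

text \<open>Expand \<open>0 \<le> \<integral> pkernel |f - poisson f z|\<^sup>2\<close>.\<close>
lemma poisson_jensen:
  assumes f: "L2T f" and z: "cmod z < 1"
  shows "(cmod (poisson f z))\<^sup>2 \<le> (1 / (2 * pi)) * (\<integral>w. pkernel w z * (cmod (f w))\<^sup>2 \<partial>T_meas)"
proof -
  define c where "c = poisson f z"
  have fi: "integrable T_meas f" by (rule L2T_integrable[OF f])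
  have i1: "integrable T_meas (\<lambda>w. pkernel w z * (cmod (f w))\<^sup>2)"
    using integrable_pkernel[of "\<lambda>w. (cmod (f w))\<^sup>2" z] f z by (simp add: L2T_def)
  have i2: "integrable T_meas (\<lambda>w. pkernel w z *\<^sub>R f w)" by (rule integrable_pkernel[OF fi z])
  have i3: "integrable T_meas (\<lambda>w. pkernel w z)" using integrable_pkernel[of "\<lambda>_. 1::real" z] z by simp
  have eq: "pkernel w z * (cmod (f w - c))\<^sup>2 = pkernel w z * (cmod (f w))\<^sup>2 - 2 * Re (cnj c * (pkernel w z *\<^sub>R f w)) + pkernel w z * (cmod c)\<^sup>2" for w
    unfolding cmod_power2 by (simp add: power2_eq_square algebra_simps)
  have i4: "integrable T_meas (\<lambda>w. Re (cnj c * (pkernel w z *\<^sub>R f w)))"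
    using i2 by (intro integrable_Re integrable_mult_right) auto
  have "0 \<le> (\<integral>w. pkernel w z * (cmod (f w - c))\<^sup>2 \<partial>T_meas)"
    by (rule integral_nonneg_AE) (use AE_T_norm in \<open>eventually_elim, simp add: pkernel_nonneg z\<close>)
  also have "\<dots> = (\<integral>w. pkernel w z * (cmod (f w))\<^sup>2 \<partial>T_meas) - 2 * (\<integral>w. Re (cnj c * (pkernel w z *\<^sub>R f w)) \<partial>T_meas)
      + (\<integral>w. pkernel w z \<partial>T_meas) * (cmod c)\<^sup>2"
    unfolding eq using i1 i3 i4 by simp
  also have "(\<integral>w. Re (cnj c * (pkernel w z *\<^sub>R f w)) \<partial>T_meas) = Re (cnj c * (\<integral>w. pkernel w z *\<^sub>R f w \<partial>T_meas))"
    by (simp only: integral_Re[OF integrable_mult_right[OF i2]] integral_mult_right_zero)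
  also have "(\<integral>w. pkernel w z *\<^sub>R f w \<partial>T_meas) = of_real (2 * pi) * c"
    by (simp add: c_def poisson_def)
  also have "Re (cnj c * (of_real (2 * pi) * c)) = 2 * pi * (cmod c)\<^sup>2"
    unfolding cmod_power2 by (simp add: power2_eq_square algebra_simps)
  finally show ?thesis using integral_pkernel[OF z] by (simp add: c_def field_simps)
qed

subsection \<open>Convergence of Poisson integrals to boundary values\<close>

definition rad :: "nat \<Rightarrow> real" where
  "rad n = 1 - 1 / (real n + 2)"

lemma rad_bounds: "0 \<le> rad n" "rad n < 1"
  by (auto simp: rad_def field_simps)

lemma rad_tendsto: "rad \<longlonglongrightarrow> 1"
  unfolding rad_def by real_asymp

lemma cmod_rad_mult: "cmod w = 1 \<Longrightarrow> 0 \<le> r \<Longrightarrow> r < 1 \<Longrightarrow> cmod (of_real r * w) < 1"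
  by (simp add: norm_mult)

lemma cmod_swap:
  assumes "cmod a = 1" "cmod b = 1"
  shows "cmod (a - of_real r * b) = cmod (b - of_real r * a)"
proof -
  have "(cmod (a - of_real r * b))\<^sup>2 - (cmod (b - of_real r * a))\<^sup>2 = (1 - r\<^sup>2) * ((cmod a)\<^sup>2 - (cmod b)\<^sup>2)"
    unfolding cmod_power2 by (simp add: power2_eq_square algebra_simps)
  then have "(cmod (a - of_real r * b))\<^sup>2 = (cmod (b - of_real r * a))\<^sup>2" using assms by simp
  then show ?thesis by (simp add: power2_eq_iff_nonneg)
qed

text \<open>The symmetry that allows integration of the kernel over the evaluation point instead of
  the integration variable.\<close>

lemma pkernel_swap:
  assumes "cmod a = 1" "cmod b = 1" "0 \<le> r" "r < 1"
  shows "pkernel a (of_real r * b) = pkernel b (of_real r * a)"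
  using assms by (simp add: pkernel_eq norm_mult cmod_swap[of a b r])

lemma measurable_pkernel [measurable (raw)]:
  assumes [measurable]: "f \<in> borel_measurable M" "g \<in> borel_measurable M"
  shows "(\<lambda>x. pkernel (f x) (g x)) \<in> borel_measurable M"
  unfolding pkernel_def by measurable

lemma poisson_measurable:
  assumes [measurable]: "f \<in> borel_measurable borel"
  shows "(\<lambda>w. poisson f (of_real r * w)) \<in> borel_measurable borel"
  unfolding poisson_def by measurable

lemma sqnorm_cong_AE:
  assumes "f \<in> borel_measurable borel" "g \<in> borel_measurable borel" "AE w in T_meas. f w = g w"
  shows "sqnorm f = sqnorm g"
  unfolding sqnorm_def by (rule integral_cong_AE) (use assms in auto)

text \<open>Jensen bounds the square by a Poisson integral of \<open>|f|^2\<close>; after Tonelli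
  and \<open>pkernel_swap\<close> the inner integral of the kernel is \<open>2 * pi\<close>.
  Integrals of nonnegative functions are used throughout, so square integrability comes out together
  with the bound.\<close>

lemma poisson_contraction:
  assumes f: "L2T f" and r: "0 \<le> r" "r < 1"
  shows "L2T (\<lambda>w. poisson f (of_real r * w))" "sqnorm (\<lambda>w. poisson f (of_real r * w)) \<le> sqnorm f"
proof -
  have [measurable]: "f \<in> borel_measurable borel" using f by (rule L2T_measurable)
  have [measurable]: "(\<lambda>w. poisson f (of_real r * w)) \<in> borel_measurable borel"
    by (rule poisson_measurable) simp
  define h where "h z w = (1 / (2 * pi)) * (pkernel z (of_real r * w) * (cmod (f z))\<^sup>2)" for z w
  have [measurable]: "(\<lambda>(z, w). h z w) \<in> borel_measurable (borel \<Otimes>\<^sub>M borel)"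
    unfolding h_def by measurable
  have fi: "integrable T_meas (\<lambda>z. (cmod (f z))\<^sup>2)" using f by (simp add: L2T_def)
  have "(\<integral>\<^sup>+w. ennreal ((cmod (poisson f (of_real r * w)))\<^sup>2) \<partial>T_meas) \<le> (\<integral>\<^sup>+w. \<integral>\<^sup>+z. ennreal (h z w) \<partial>T_meas \<partial>T_meas)"
  proof (rule nn_integral_mono_AE)
    show "AE w in T_meas. ennreal ((cmod (poisson f (of_real r * w)))\<^sup>2) \<le> (\<integral>\<^sup>+z. ennreal (h z w) \<partial>T_meas)"
      using AE_T_norm
    proof eventually_elim
      case (elim w)
      have z: "cmod (of_real r * w) < 1" by (rule cmod_rad_mult[OF elim r])
      have i: "integrable T_meas (\<lambda>z. h z w)"
        unfolding h_def using integrable_pkernel[OF fi z] by simp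
      have nn: "AE z in T_meas. 0 \<le> h z w"
        using AE_T_norm by eventually_elim (simp add: h_def pkernel_nonneg z)
      have "(\<integral>\<^sup>+z. ennreal (h z w) \<partial>T_meas) = ennreal (\<integral>z. h z w \<partial>T_meas)"
        by (rule nn_integral_eq_integral[OF i nn])
      moreover have "(cmod (poisson f (of_real r * w)))\<^sup>2 \<le> (\<integral>z. h z w \<partial>T_meas)"
        using poisson_jensen[OF f z] by (simp add: h_def)
      ultimately show ?case by (simp add: ennreal_leI)
    qed
  qed
  also have "\<dots> = (\<integral>\<^sup>+z. \<integral>\<^sup>+w. ennreal (h z w) \<partial>T_meas \<partial>T_meas)"
  proof (rule pair_sigma_finite.Fubini')
    show "pair_sigma_finite T_meas T_meas" by unfold_locales
    show "(\<lambda>(x, y). ennreal (h x y)) \<in> borel_measurable (T_meas \<Otimes>\<^sub>M T_meas)" by measurable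
  qed
  also have "\<dots> \<le> (\<integral>\<^sup>+z. ennreal ((cmod (f z))\<^sup>2) \<partial>T_meas)"
  proof (rule nn_integral_mono_AE)
    show "AE z in T_meas. (\<integral>\<^sup>+w. ennreal (h z w) \<partial>T_meas) \<le> ennreal ((cmod (f z))\<^sup>2)"
      using AE_T_norm
    proof eventually_elim
      case (elim z)
      have z: "cmod (of_real r * z) < 1" by (rule cmod_rad_mult[OF elim r])
      have i: "integrable T_meas (\<lambda>w. pkernel w (of_real r * z) * ((cmod (f z))\<^sup>2 / (2 * pi)))"
        using integrable_pkernel[of "\<lambda>_. 1::real" "of_real r * z"] z by simp
      have "(\<integral>\<^sup>+w. ennreal (h z w) \<partial>T_meas) = (\<integral>\<^sup>+w. ennreal (pkernel w (of_real r * z) * ((cmod (f z))\<^sup>2 / (2 * pi))) \<partial>T_meas)"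
        by (rule nn_integral_cong_AE)
           (use AE_T_norm in \<open>eventually_elim, simp add: h_def pkernel_swap[OF elim _ r]\<close>)
      also have "\<dots> = ennreal (\<integral>w. pkernel w (of_real r * z) * ((cmod (f z))\<^sup>2 / (2 * pi)) \<partial>T_meas)"
        by (rule nn_integral_eq_integral[OF i])
           (use AE_T_norm in \<open>eventually_elim, simp add: pkernel_nonneg z\<close>)
      also have "\<dots> = ennreal ((cmod (f z))\<^sup>2)"
        using integral_pkernel[OF z] by simp
      finally show ?case by simp
    qed
  qed
  also have "\<dots> = ennreal (sqnorm f)"
    unfolding sqnorm_def by (rule nn_integral_eq_integral[OF fi]) simp
  finally have le: "(\<integral>\<^sup>+w. ennreal ((cmod (poisson f (of_real r * w)))\<^sup>2) \<partial>T_meas) \<le> ennreal (sqnorm f)" .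
  then show L: "L2T (\<lambda>w. poisson f (of_real r * w))"
    unfolding L2T_def by (intro conjI integrableI_nonneg) (auto intro: le_less_trans)
  have "ennreal (sqnorm (\<lambda>w. poisson f (of_real r * w))) = (\<integral>\<^sup>+w. ennreal ((cmod (poisson f (of_real r * w)))\<^sup>2) \<partial>T_meas)"
    unfolding sqnorm_def using L by (intro nn_integral_eq_integral[symmetric]) (auto simp: L2T_def)
  with le have "ennreal (sqnorm (\<lambda>w. poisson f (of_real r * w))) \<le> ennreal (sqnorm f)" by simp
  then show "sqnorm (\<lambda>w. poisson f (of_real r * w)) \<le> sqnorm f"
    by (subst (asm) ennreal_le_iff) (simp_all add: sqnorm_nonneg)
qed

abbreviation poisson_err :: "(complex \<Rightarrow> complex) \<Rightarrow> nat \<Rightarrow> real" where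
  "poisson_err f n \<equiv> sqnorm (\<lambda>w. poisson f (of_real (rad n) * w) - f w)"

text \<open>The class of functions recovered in L2 from their dilated Poisson integrals. It is
  enlarged from continuous functions to indicators of closed sets, of Borel sets, and finally to all
  of L2.\<close>

definition poisson_conv :: "(complex \<Rightarrow> complex) \<Rightarrow> bool" where
  "poisson_conv f \<longleftrightarrow> L2T f \<and> poisson_err f \<longlonglongrightarrow> 0"

text \<open>Uniform contractivity makes the class closed in L2: the dilation of \<open>f\<close> is
  compared with that of \<open>g\<close>, then with \<open>g\<close>, then with
  \<open>f\<close>.\<close>

lemma poisson_conv_closed:
  assumes f: "L2T f" and ap: "\<And>e. e > 0 \<Longrightarrow> \<exists>g. poisson_conv g \<and> sqnorm (\<lambda>w. f w - g w) < e"
  shows "poisson_conv f"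
  unfolding poisson_conv_def
proof (intro conjI f LIMSEQ_I)
  fix e :: real assume "e > 0"
  \<comment> \<open>The three errors enter with factors 2, 4 and 4, hence the tenth.\<close>
  then obtain g where g: "poisson_conv g" "sqnorm (\<lambda>w. f w - g w) < e / 10"
    using ap[of "e / 10"] by auto
  have Lg: "L2T g" and lim: "poisson_err g \<longlonglongrightarrow> 0"
    using g by (auto simp: poisson_conv_def)
  obtain m where m: "poisson_err g n < e / 10" if "n \<ge> m" for n
    using LIMSEQ_D[OF lim, of "e / 10"] \<open>e > 0\<close> by (auto simp: sqnorm_nonneg)
  have "poisson_err f n < e" if n: "n \<ge> m" for n
  proof -
    note r = rad_bounds[of n]
    have Lfg: "L2T (\<lambda>w. f w - g w)" by (rule L2T_diff[OF f Lg])
    note P1 = poisson_contraction[OF Lfg r] and P2 = poisson_contraction[OF Lg r] and P3 = poisson_contraction[OF f r]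
    have L2: "L2T (\<lambda>w. poisson g (of_real (rad n) * w) - g w)" by (rule L2T_diff[OF P2(1) Lg])
    have Lgf: "L2T (\<lambda>w. g w - f w)" by (rule L2T_diff[OF Lg f])
    have L3: "L2T (\<lambda>w. (poisson g (of_real (rad n) * w) - g w) + (g w - f w))" by (rule L2T_add[OF L2 Lgf])
    have "poisson_err f n
        = sqnorm (\<lambda>w. poisson (\<lambda>w. f w - g w) (of_real (rad n) * w) + ((poisson g (of_real (rad n) * w) - g w) + (g w - f w)))"
    proof (rule sqnorm_cong_AE)
      show "AE w in T_meas. poisson f (of_real (rad n) * w) - f w
          = poisson (\<lambda>w. f w - g w) (of_real (rad n) * w) + ((poisson g (of_real (rad n) * w) - g w) + (g w - f w))"
        using AE_T_norm
        by eventually_elim (use r in \<open>simp add: poisson_diff[OF L2T_integrable[OF f] L2T_integrable[OF Lg] cmod_rad_mult]\<close>)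
    qed (use L2T_measurable[OF L2T_diff(1)[OF P3(1) f]] L2T_measurable[OF L2T_add(1)[OF P1(1) L3]] in auto)
    also have "\<dots> \<le> 2 * sqnorm (\<lambda>w. poisson (\<lambda>w. f w - g w) (of_real (rad n) * w)) + 2 * (2 * poisson_err g n + 2 * sqnorm (\<lambda>w. g w - f w))"
      using L2T_add(2)[OF P1(1) L3] L2T_add(2)[OF L2 Lgf] by simp
    also have "\<dots> < e"
      using P1(2) m[OF n] g(2) sqnorm_diff_commute[of f g] by simp
    finally show ?thesis .
  qed
  then show "\<exists>no. \<forall>n\<ge>no. norm (poisson_err f n - 0) < e"
    by (auto simp: sqnorm_nonneg)
qed

lemma sqnorm_dominated_convergence:
  fixes f :: "complex \<Rightarrow> complex"
  assumes [measurable]: "f \<in> borel_measurable borel" "\<And>k. F k \<in> borel_measurable borel"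
    and h: "integrable T_meas h" "\<And>k. AE w in T_meas. (cmod (F k w))\<^sup>2 \<le> h w"
    and lim: "AE w in T_meas. (\<lambda>k. F k w) \<longlonglongrightarrow> f w"
  shows "L2T f" "(\<lambda>k. sqnorm (\<lambda>w. F k w - f w)) \<longlonglongrightarrow> 0"
proof -
  have hk: "AE w in T_meas. \<forall>k. (cmod (F k w))\<^sup>2 \<le> h w"
    using h(2) by (simp add: AE_all_countable)
  have hf: "AE w in T_meas. (cmod (f w))\<^sup>2 \<le> h w"
    using hk lim
  proof eventually_elim
    case (elim w)
    have "(\<lambda>k. (cmod (F k w))\<^sup>2) \<longlonglongrightarrow> (cmod (f w))\<^sup>2" by (intro tendsto_intros elim)
    then show ?case by (rule LIMSEQ_le_const2) (use elim in auto)
  qed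
  show "L2T f" by (rule L2T_dominated[OF _ h(1) hf]) simp
  have "(\<lambda>k. sqnorm (\<lambda>w. F k w - f w)) \<longlonglongrightarrow> (\<integral>w. 0 \<partial>T_meas)"
    unfolding sqnorm_def
  proof (rule integral_dominated_convergence)
    show "integrable T_meas (\<lambda>w. 4 * h w)" using h by simp
    show "AE w in T_meas. (\<lambda>k. (cmod (F k w - f w))\<^sup>2) \<longlonglongrightarrow> 0"
      using lim
    proof eventually_elim
      case (elim w)
      have "(\<lambda>k. (cmod (F k w - f w))\<^sup>2) \<longlonglongrightarrow> (cmod (f w - f w))\<^sup>2" by (intro tendsto_intros elim)
      then show ?case by simp
    qed
    show "AE w in T_meas. norm ((cmod (F k w - f w))\<^sup>2) \<le> 4 * h w" for k
      using h(2)[of k] hf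
    proof eventually_elim
      case (elim w)
      then show ?case using norm_add_sq_le[of "F k w" "- f w"] by simp
    qed
  qed auto
  then show "(\<lambda>k. sqnorm (\<lambda>w. F k w - f w)) \<longlonglongrightarrow> 0" by simp
qed

lemma poisson_conv_dominated:
  assumes F: "\<And>k. poisson_conv (F k)" and f: "f \<in> borel_measurable borel"
    and h: "integrable T_meas h" "\<And>k. AE w in T_meas. (cmod (F k w))\<^sup>2 \<le> h w"
    and lim: "AE w in T_meas. (\<lambda>k. F k w) \<longlonglongrightarrow> f w"
  shows "poisson_conv f"
proof -
  have "F k \<in> borel_measurable borel" for k using F by (auto simp: poisson_conv_def L2T_def)
  note conv = sqnorm_dominated_convergence[OF f this h lim]
  show ?thesis
  proof (rule poisson_conv_closed[OF conv(1)])
    fix e :: real assume "e > 0"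
    then obtain k where "sqnorm (\<lambda>w. F k w - f w) < e"
      using LIMSEQ_D[OF conv(2)] by (force simp: sqnorm_nonneg)
    with F show "\<exists>g. poisson_conv g \<and> sqnorm (\<lambda>w. f w - g w) < e"
      by (metis sqnorm_diff_commute)
  qed
qed

text \<open>The approximate identity argument: near \<open>w\<close> continuity makes
  \<open>f x - f w\<close> small, away from \<open>w\<close> the kernel itself is small.\<close>

lemma poisson_tendsto_pointwise:
  assumes [measurable]: "f \<in> borel_measurable borel" and B: "\<And>w. cmod (f w) \<le> B"
    and w: "cmod w = 1" "isCont f w"
  shows "(\<lambda>n. poisson f (of_real (rad n) * w)) \<longlonglongrightarrow> f w"
proof (rule LIMSEQ_I)
  fix e :: real assume e: "e > 0"
  then obtain d where d: "d > 0" "\<And>z. dist z w < d \<Longrightarrow> dist (f z) (f w) < e / 2"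
    using w(2) unfolding continuous_at_eps_delta by (metis half_gt_zero)
  have B0: "B \<ge> 0" using B[of 0] norm_ge_zero order_trans by blast
  \<comment> \<open>The first summand pays for points near \<open>w\<close>; the second is the far
    part, with \<open>2 * B\<close> bounding the oscillation of \<open>f\<close> and the rest
    bounding the kernel at distance at least \<open>d / 2\<close>.\<close>
  define c where "c n = e / 2 + 2 * B * ((1 - (rad n)\<^sup>2) * 4 / d\<^sup>2)" for n
  have "c \<longlonglongrightarrow> e / 2 + 2 * B * ((1 - 1\<^sup>2) * 4 / d\<^sup>2)"
    unfolding c_def by (intro tendsto_intros rad_tendsto) (use d in auto)
  then have "\<forall>\<^sub>F n in sequentially. c n < e" by (rule order_tendstoD(2)) (use e in simp)
  \<comment> \<open>This puts the evaluation point within \<open>d / 2\<close> of \<open>w\<close>,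
    so points at distance \<open>d\<close> from \<open>w\<close> keep distance \<open>d / 2\<close>
    from it.\<close>
  moreover have "\<forall>\<^sub>F n in sequentially. rad n > 1 - d / 2"
    using rad_tendsto d by (intro order_tendstoD(1)) auto
  ultimately have "\<forall>\<^sub>F n in sequentially. norm (poisson f (of_real (rad n) * w) - f w) < e"
  proof eventually_elim
    case (elim n)
    define z where "z = of_real (rad n) * w"
    have z: "cmod z < 1" unfolding z_def by (rule cmod_rad_mult[OF w(1) rad_bounds])
    have cz: "cmod z = rad n" using rad_bounds[of n] w by (simp add: z_def norm_mult)
    have fi: "integrable T_meas f" by (rule T.integrable_const_bound[of _ B]) (use B in auto)
    have fi2: "integrable T_meas (\<lambda>x. f x - f w)" using fi by simp
    have zw: "cmod (z - w) = 1 - rad n"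
    proof -
      have "z - w = of_real (rad n - 1) * w" by (simp add: z_def algebra_simps)
      then show ?thesis using w rad_bounds[of n] by (simp add: norm_mult del: of_real_diff)
    qed
    define k where "k x = pkernel x z * (e / 2) + 2 * B * ((1 - (rad n)\<^sup>2) * 4 / d\<^sup>2)" for x
    have ki: "integrable T_meas k"
      unfolding k_def using integrable_pkernel[of "\<lambda>_. 1::real" z] z by simp
    have bound: "norm (pkernel x z *\<^sub>R (f x - f w)) \<le> k x" if x: "cmod x = 1" for x
    proof -
      have pn: "pkernel x z \<ge> 0" by (rule pkernel_nonneg[OF x z])
      have rn: "0 \<le> 1 - (rad n)\<^sup>2" using rad_bounds[of n] by (simp add: power_le_one)
      have cn: "0 \<le> 2 * B * ((1 - (rad n)\<^sup>2) * 4 / d\<^sup>2)" using B0 rn by simp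
      show ?thesis
      proof (cases "dist x w < d")
        case True
        have "cmod (f x - f w) \<le> e / 2" using d(2)[OF True] by (simp add: dist_norm)
        then have "pkernel x z * cmod (f x - f w) \<le> pkernel x z * (e / 2)" using pn by (rule mult_left_mono)
        then show ?thesis using pn cn by (simp add: k_def)
      next
        case False
        have xd: "cmod (x - z) \<ge> d / 2"
          using False norm_triangle_ineq[of "x - z" "z - w"] zw elim by (simp add: dist_norm)
        then have xz: "cmod (x - z) > 0" using d by linarith
        have "(d / 2)\<^sup>2 \<le> (cmod (x - z))\<^sup>2" using d xd by (intro power_mono) auto
        then have "pkernel x z \<le> (1 - (rad n)\<^sup>2) / (d / 2)\<^sup>2"
          unfolding pkernel_eq[OF x z] cz using rn d xz by (intro divide_left_mono mult_pos_pos) auto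
        also have "\<dots> = (1 - (rad n)\<^sup>2) * 4 / d\<^sup>2" by (simp add: power_divide)
        finally have 1: "pkernel x z \<le> (1 - (rad n)\<^sup>2) * 4 / d\<^sup>2" .
        have 2: "cmod (f x - f w) \<le> 2 * B"
          using norm_triangle_ineq4[of "f x" "f w"] B[of x] B[of w] by linarith
        have "pkernel x z * cmod (f x - f w) \<le> ((1 - (rad n)\<^sup>2) * 4 / d\<^sup>2) * (2 * B)"
          using 1 2 pn rn by (intro mult_mono) auto
        also have "\<dots> = 2 * B * ((1 - (rad n)\<^sup>2) * 4 / d\<^sup>2)" by (rule mult.commute)
        also have "\<dots> \<le> k x" using pn e by (simp add: k_def)
        finally show ?thesis using pn by simp
      qed
    qed
    have "poisson f z - f w = poisson (\<lambda>x. f x - f w) z"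
      using poisson_diff[OF fi _ z, of "\<lambda>_. f w"] z by (simp add: poisson_const)
    also have "cmod \<dots> = (1 / (2 * pi)) * cmod (\<integral>x. pkernel x z *\<^sub>R (f x - f w) \<partial>T_meas)"
      by (simp add: poisson_def norm_divide norm_mult)
    also have "\<dots> \<le> (1 / (2 * pi)) * (\<integral>x. k x \<partial>T_meas)"
    proof (intro mult_left_mono integral_norm_bound_integral)
      have "cmod (\<integral>x. pkernel x z *\<^sub>R (f x - f w) \<partial>T_meas) \<le> (\<integral>x. norm (pkernel x z *\<^sub>R (f x - f w)) \<partial>T_meas)"
        by (rule integral_norm_bound)
      also have "\<dots> \<le> (\<integral>x. k x \<partial>T_meas)"
      proof (rule integral_mono_AE[OF integrable_norm[OF integrable_pkernel[OF fi2 z]] ki])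
        show "AE x in T_meas. norm (pkernel x z *\<^sub>R (f x - f w)) \<le> k x"
          using AE_T_norm by eventually_elim (rule bound)
      qed
      finally show "cmod (\<integral>x. pkernel x z *\<^sub>R (f x - f w) \<partial>T_meas) \<le> (\<integral>x. k x \<partial>T_meas)" .
    qed simp
    also have "(\<integral>x. k x \<partial>T_meas) = 2 * pi * c n"
      unfolding k_def using integrable_pkernel[of "\<lambda>_. 1::real" z] z integral_pkernel[OF z]
      by (simp add: c_def measure_T_meas algebra_simps)
    finally show ?case using elim by (simp add: z_def)
  qed
  then show "\<exists>no. \<forall>n\<ge>no. norm (poisson f (of_real (rad n) * w) - f w) < e"
    by (simp add: eventually_sequentially)
qed

lemma poisson_conv_continuous:
  assumes cont: "continuous_on UNIV f" and B: "\<And>w. cmod (f w) \<le> B"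
  shows "poisson_conv f"
proof -
  have m [measurable]: "f \<in> borel_measurable borel" by (rule borel_measurable_continuous_onI[OF cont])
  have L: "L2T f"
    by (rule L2T_dominated[of _ "\<lambda>_. B\<^sup>2"]) (use B in \<open>auto intro!: power_mono\<close>)
  have fi: "integrable T_meas f" by (rule L2T_integrable[OF L])
  have "poisson_err f \<longlonglongrightarrow> 0"
  proof (rule sqnorm_dominated_convergence(2)[where h = "\<lambda>_. B\<^sup>2"])
    show "AE w in T_meas. (\<lambda>n. poisson f (of_real (rad n) * w)) \<longlonglongrightarrow> f w"
      using AE_T_norm
      by eventually_elim (use cont B in \<open>auto intro!: poisson_tendsto_pointwise simp: continuous_on_eq_continuous_at\<close>)
    show "AE w in T_meas. (cmod (poisson f (of_real (rad n) * w)))\<^sup>2 \<le> B\<^sup>2" for n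
      using AE_T_norm
    proof eventually_elim
      case (elim w)
      have z: "cmod (of_real (rad n) * w) < 1" by (rule cmod_rad_mult[OF elim rad_bounds])
      have "(cmod (poisson f (of_real (rad n) * w)))\<^sup>2 \<le> (1 / (2 * pi)) * (\<integral>x. pkernel x (of_real (rad n) * w) * (cmod (f x))\<^sup>2 \<partial>T_meas)"
        by (rule poisson_jensen[OF L z])
      also have "\<dots> \<le> (1 / (2 * pi)) * (\<integral>x. pkernel x (of_real (rad n) * w) * B\<^sup>2 \<partial>T_meas)"
      proof (intro mult_left_mono integral_mono_AE)
        show "integrable T_meas (\<lambda>x. pkernel x (of_real (rad n) * w) * (cmod (f x))\<^sup>2)"
          using integrable_pkernel[of "\<lambda>x. (cmod (f x))\<^sup>2" "of_real (rad n) * w"] L z by (simp add: L2T_def)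
        show "integrable T_meas (\<lambda>x. pkernel x (of_real (rad n) * w) * B\<^sup>2)"
          using integrable_pkernel[of "\<lambda>_. B\<^sup>2" "of_real (rad n) * w"] z by simp
        show "AE x in T_meas. pkernel x (of_real (rad n) * w) * (cmod (f x))\<^sup>2 \<le> pkernel x (of_real (rad n) * w) * B\<^sup>2"
          using AE_T_norm
          by eventually_elim (intro mult_left_mono power_mono B pkernel_nonneg z norm_ge_zero)
      qed simp
      also have "\<dots> = B\<^sup>2" using integral_pkernel[OF z] by simp
      finally show ?case .
    qed
  qed (auto intro: poisson_measurable)
  with L show ?thesis by (simp add: poisson_conv_def)
qed

lemma poisson_conv_add:
  assumes "poisson_conv f" "poisson_conv g"
  shows "poisson_conv (\<lambda>w. f w + g w)"
proof -
  have L: "L2T f" "L2T g" using assms by (auto simp: poisson_conv_def)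
  have "(\<lambda>n. poisson_err (\<lambda>w. f w + g w) n) \<longlonglongrightarrow> 0"
  proof (rule real_tendsto_sandwich[OF _ _ tendsto_const])
    have "(\<lambda>n. 2 * poisson_err f n + 2 * poisson_err g n) \<longlonglongrightarrow> 2 * 0 + 2 * 0"
      using assms by (intro tendsto_intros) (auto simp: poisson_conv_def)
    then show "(\<lambda>n. 2 * poisson_err f n + 2 * poisson_err g n) \<longlonglongrightarrow> 0" by simp
    have "poisson_err (\<lambda>w. f w + g w) n \<le> 2 * poisson_err f n + 2 * poisson_err g n" for n
    proof -
      note r = rad_bounds[of n]
      note P = poisson_contraction(1)[OF L(1) r] poisson_contraction(1)[OF L(2) r] poisson_contraction(1)[OF L2T_add(1)[OF L] r]
      note Q = L2T_diff(1)[OF P(1) L(1)] L2T_diff(1)[OF P(2) L(2)]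
      have "poisson_err (\<lambda>w. f w + g w) n = sqnorm (\<lambda>w. (poisson f (of_real (rad n) * w) - f w) + (poisson g (of_real (rad n) * w) - g w))"
      proof (rule sqnorm_cong_AE)
        show "AE w in T_meas. poisson (\<lambda>w. f w + g w) (of_real (rad n) * w) - (f w + g w)
           = (poisson f (of_real (rad n) * w) - f w) + (poisson g (of_real (rad n) * w) - g w)"
          using AE_T_norm
          by eventually_elim (use r in \<open>simp add: poisson_add[OF L2T_integrable[OF L(1)] L2T_integrable[OF L(2)] cmod_rad_mult]\<close>)
      qed (use L2T_measurable[OF L2T_diff(1)[OF P(3) L2T_add(1)[OF L]]] L2T_measurable[OF L2T_add(1)[OF Q]] in auto)
      also have "\<dots> \<le> 2 * poisson_err f n + 2 * poisson_err g n" by (rule L2T_add(2)[OF Q])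
      finally show ?thesis .
    qed
    then show "\<forall>\<^sub>F n in sequentially. poisson_err (\<lambda>w. f w + g w) n \<le> 2 * poisson_err f n + 2 * poisson_err g n" by simp
  qed (simp add: sqnorm_nonneg)
  then show ?thesis using L2T_add(1)[OF L] by (simp add: poisson_conv_def)
qed

lemma poisson_conv_cmult:
  assumes "poisson_conv f"
  shows "poisson_conv (\<lambda>w. c * f w)"
proof -
  have L: "L2T f" using assms by (auto simp: poisson_conv_def)
  have "poisson_err (\<lambda>w. c * f w) n
      = (cmod c)\<^sup>2 * poisson_err f n" for n
    using L2T_cmult(2)[OF L2T_diff(1)[OF poisson_contraction(1)[OF L rad_bounds] L], of c n]
    by (simp add: poisson_cmult right_diff_distrib)
  moreover have "(\<lambda>n. (cmod c)\<^sup>2 * poisson_err f n) \<longlonglongrightarrow> 0"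
    using assms by (intro tendsto_mult_right_zero) (simp add: poisson_conv_def)
  ultimately show ?thesis using L2T_cmult(1)[OF L] by (simp add: poisson_conv_def)
qed

lemma poisson_conv_sum:
  assumes "finite I" "\<And>i. i \<in> I \<Longrightarrow> poisson_conv (f i)"
  shows "poisson_conv (\<lambda>w. \<Sum>i\<in>I. f i w)"
  using assms
proof (induction I)
  case empty
  show ?case by (rule poisson_conv_continuous[of _ 0]) auto
qed (auto intro: poisson_conv_add)

lemma poisson_conv_const: "poisson_conv (\<lambda>_. c)"
  by (rule poisson_conv_continuous[of _ "cmod c"]) auto

text \<open>The indicator is the pointwise limit of the continuous tent functions
  \<open>max 0 (1 - k * infdist w C)\<close>.\<close>

lemma poisson_conv_closed_set:
  assumes "closed C"
  shows "poisson_conv (\<lambda>w. indicator C w)"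
proof (cases "C = {}")
  \<comment> \<open>Separate because \<open>infdist\<close> to the empty set is 0, so the tent
    functions would converge to 1.\<close>
  case True
  then show ?thesis using poisson_conv_const[of 0] by simp
next
  case False
  define F where "F k w = complex_of_real (max 0 (1 - real k * infdist w C))" for k w
  have lim: "(\<lambda>k. F k w) \<longlonglongrightarrow> indicator C w" for w
  proof (cases "w \<in> C")
    case True
    then show ?thesis by (simp add: F_def)
  next
    case w: False
    then have pos: "infdist w C > 0"
      using assms False by (simp add: infdist_pos_not_in_closed)
    have "\<forall>\<^sub>F k in sequentially. real k \<ge> 1 / infdist w C"
      by real_asymp
    then have "\<forall>\<^sub>F k in sequentially. F k w = 0"
      by eventually_elim (use pos in \<open>simp add: F_def field_simps\<close>)
    then show ?thesis using w by (simp add: tendsto_eventually)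
  qed
  have bound: "cmod (F k w) \<le> 1" for k w
    by (auto simp: F_def infdist_nonneg max_def)
  show ?thesis
  proof (rule poisson_conv_dominated[where F = F and h = "\<lambda>_. 1"])
    show "poisson_conv (F k)" for k
      by (rule poisson_conv_continuous[OF _ bound]) (unfold F_def, intro continuous_intros)
    show "(\<lambda>w. indicator C w :: complex) \<in> borel_measurable borel" using assms by simp
    show "AE w in T_meas. (cmod (F k w))\<^sup>2 \<le> 1" for k
      using bound[of k] by (intro AE_I2) (simp add: power_le_one)
  qed (use lim in auto)
qed

text \<open>Dynkin's argument: closed sets are stable under intersection and generate the Borel
  sets, and the class is stable under complements and disjoint countable unions.\<close>

lemma poisson_conv_indicator:
  assumes "A \<in> sets (borel :: complex measure)"
  shows "poisson_conv (\<lambda>w. indicator A w)"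
proof -
  have "Int_stable (Collect closed :: complex set set)"
    by (auto simp: Int_stable_def)
  moreover have "Collect closed \<subseteq> Pow (UNIV :: complex set)" by simp
  moreover have eq: "sigma_sets UNIV (Collect closed) = sets (borel :: complex measure)"
    unfolding borel_eq_closed by simp
  with assms have "A \<in> sigma_sets UNIV (Collect closed)" by simp
  ultimately show ?thesis
  proof (induction A rule: sigma_sets_induct_disjoint)
    case (basic A)
    then show ?case by (simp add: poisson_conv_closed_set)
  next
    case empty
    then show ?case using poisson_conv_const[of 0] by simp
  next
    case (compl A)
    have "(\<lambda>w. indicator (UNIV - A) w) = (\<lambda>w. 1 + (- 1) * indicator A w :: complex)"
      by (auto simp: indicator_def)
    then show ?case
      by (simp only:) (intro poisson_conv_add poisson_conv_const poisson_conv_cmult compl)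
  next
    case (union A)
    show ?case
    proof (rule poisson_conv_dominated[where F = "\<lambda>k w. \<Sum>i<k. indicator (A i) w" and h = "\<lambda>_. 1"])
      show "poisson_conv (\<lambda>w. \<Sum>i<k. indicator (A i) w)" for k
        by (intro poisson_conv_sum union) auto
      have "range A \<subseteq> sets borel" using union eq by simp
      then show "(\<lambda>w. indicator (\<Union>(range A)) w :: complex) \<in> borel_measurable borel" by auto
      have dis: "(\<lambda>i. indicator (A i) w :: complex) sums indicator (\<Union>(range A)) w" for w
      proof (cases "w \<in> \<Union>(range A)")
        case True
        then obtain i where i: "w \<in> A i" by auto
        have "indicator (A j) w = (if j = i then 1 else (0::complex))" for j
          using i union(1) by (auto simp: disjoint_family_on_def indicator_def)
        then show ?thesis using True sums_single[of i "\<lambda>_. 1::complex"] by (auto simp: eq_commute)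
      qed (auto simp: indicator_def)
      then show "AE w in T_meas. (\<lambda>k. \<Sum>i<k. indicator (A i) w) \<longlonglongrightarrow> (indicator (\<Union>(range A)) w :: complex)"
        by (simp add: sums_def)
      have "(\<Sum>i<k. indicator (A i) w :: complex) = indicator (\<Union>i<k. A i) w" for k w
        using union(1) by (subst indicator_UN_disjoint) (auto simp: disjoint_family_on_def)
      then show "AE w in T_meas. (cmod (\<Sum>i<k. indicator (A i) w))\<^sup>2 \<le> 1" for k
        by (auto simp: indicator_def)
    qed simp
  qed
qed

lemma poisson_conv_L2T:
  assumes f: "L2T f"
  shows "poisson_conv f"
proof -
  have m: "f \<in> borel_measurable borel" using f by (rule L2T_measurable)
  obtain F where F: "\<And>i. simple_function borel (F i)" "\<And>w. (\<lambda>i. F i w) \<longlonglongrightarrow> f w"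
    "\<And>i w. dist (F i w) 0 \<le> 2 * dist (f w) 0"
    using borel_measurable_implies_sequence_metric[OF m, of 0] by auto
  show ?thesis
  proof (rule poisson_conv_dominated[where F = F and h = "\<lambda>w. 4 * (cmod (f w))\<^sup>2"])
    show "poisson_conv (F i)" for i
    proof -
      have fin: "finite (range (F i))" using F(1)[of i] by (simp add: simple_function_def)
      have "F i -` {y} \<in> sets borel" for y
      proof (cases "y \<in> range (F i)")
        case True
        then show ?thesis using F(1)[of i] by (auto simp: simple_function_def)
      next
        case False
        then have "F i -` {y} = {}" by auto
        then show ?thesis by simp
      qed
      then have "poisson_conv (\<lambda>w. \<Sum>y\<in>range (F i). y * indicator (F i -` {y}) w)"
        by (intro poisson_conv_sum fin poisson_conv_cmult poisson_conv_indicator)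
      moreover have "(\<lambda>w. \<Sum>y\<in>range (F i). y * indicator (F i -` {y}) w) = F i"
      proof
        fix w
        have "(\<Sum>y\<in>range (F i). y * indicator (F i -` {y}) w) = (\<Sum>y\<in>range (F i). if y = F i w then y else 0)"
          by (intro sum.cong) (auto simp: indicator_def)
        then show "(\<Sum>y\<in>range (F i). y * indicator (F i -` {y}) w) = F i w" using fin by simp
      qed
      ultimately show ?thesis by simp
    qed
    have "(cmod (F i w))\<^sup>2 \<le> (2 * cmod (f w))\<^sup>2" for i w
      using F(3)[of i w] by (intro power_mono) auto
    then show "AE w in T_meas. (cmod (F i w))\<^sup>2 \<le> 4 * (cmod (f w))\<^sup>2" for i
      by (simp add: power_mult_distrib)
  qed (use m F(2) f in \<open>auto simp: L2T_def\<close>)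
qed

lemma H2_dilation_tendsto:
  "H2 g \<Longrightarrow> poisson_err g \<longlonglongrightarrow> 0"
  using poisson_conv_L2T[OF H2_L2T] by (auto simp: poisson_conv_def)

text \<open>Expand \<open>f\<close> in its power series; all terms but the first are killed by \<open>g \<in> H\<^sup>2\<close>.\<close>
lemma H2_mean_mult:
  assumes g: "H2 g" and f: "f holomorphic_on ball 0 1" and r: "0 \<le> r" "r < 1"
    and p [measurable]: "p \<in> borel_measurable borel" and pf: "\<And>w. cmod w = 1 \<Longrightarrow> p w = f (of_real r * w)"
  shows "(\<integral>w. p w * g w \<partial>T_meas) = f 0 * (\<integral>w. g w \<partial>T_meas)"
proof -
  have gi: "integrable T_meas g" by (rule L2T_integrable[OF H2_L2T[OF g]])
  define a where "a n = (deriv ^^ n) f 0 / fact n" for n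
  have sums: "(\<lambda>n. a n * z ^ n) sums f z" if "cmod z < 1" for z
    using holomorphic_power_series[OF f, of z] that by (simp add: a_def)
  \<comment> \<open>Convergence at the larger radius \<open>s\<close> gives absolute convergence at
    \<open>r\<close>, hence the summable majorant on the circle.\<close>
  obtain s where s: "r < s" "s < 1" using dense r(2) by blast
  have "summable (\<lambda>n. a n * of_real s ^ n)"
    using sums[of "of_real s"] s r by (auto simp: sums_iff)
  then have "summable (\<lambda>n. norm (a n * of_real r ^ n))"
    by (rule powser_insidea) (use r s in auto)
  then have summ: "summable (\<lambda>n. cmod (a n) * r ^ n)"
    using r by (simp add: norm_mult norm_power)
  define F where "F n w = a n * (of_real r * w) ^ n * g w" for n w
  have S: "(\<lambda>n. \<integral>w. F n w \<partial>T_meas) sums (\<integral>w. p w * g w \<partial>T_meas)"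
    unfolding F_def
  proof (rule integral_sums_mult[OF gi summ])
    show "(\<lambda>n. a n * (of_real r * w) ^ n) sums p w" if "cmod w = 1" for w
      unfolding pf[OF that] by (rule sums[OF cmod_rad_mult[OF that r]])
  qed (use r in \<open>auto simp: norm_mult norm_power\<close>)
  have "(\<integral>w. F n w \<partial>T_meas) = (if n = 0 then f 0 * (\<integral>w. g w \<partial>T_meas) else 0)" for n
  proof -
    have "(\<integral>w. F n w \<partial>T_meas) = (\<integral>w. a n * of_real r ^ n * (g w * w ^ n) \<partial>T_meas)"
      by (intro Bochner_Integration.integral_cong) (auto simp: F_def power_mult_distrib)
    also have "\<dots> = a n * of_real r ^ n * (\<integral>w. g w * w ^ n \<partial>T_meas)" by simp
    finally have eq: "(\<integral>w. F n w \<partial>T_meas) = a n * of_real r ^ n * (\<integral>w. g w * w ^ n \<partial>T_meas)" .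
    show ?thesis
    proof (cases "n = 0")
      case True
      have "a 0 = f 0" by (simp add: a_def)
      with True eq show ?thesis by simp
    next
      case False
      with eq H2_vanish[OF g, of n] show ?thesis by simp
    qed
  qed
  then have "(\<lambda>n. if n = 0 then f 0 * (\<integral>w. g w \<partial>T_meas) else 0) sums (\<integral>w. p w * g w \<partial>T_meas)"
    using S by simp
  moreover have "(\<lambda>n. if n = 0 then f 0 * (\<integral>w. g w \<partial>T_meas) else 0) sums (f 0 * (\<integral>w. g w \<partial>T_meas))"
    using sums_single[of 0 "\<lambda>_. f 0 * (\<integral>w. g w \<partial>T_meas)"] by (simp add: eq_commute)
  ultimately show ?thesis by (rule sums_unique2)
qed

section \<open>Matrix-valued functions and dilations of holomorphic functions\<close>

lemma borel_measurable_matrix_iff: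
  fixes f :: "'a \<Rightarrow> complex^'n^'m"
  shows "f \<in> borel_measurable M \<longleftrightarrow> (\<forall>i j. (\<lambda>x. f x $ i $ j) \<in> borel_measurable M)"
proof safe
  fix i j assume "f \<in> borel_measurable M"
  moreover have "(\<lambda>A::complex^'n^'m. A $ i $ j) \<in> borel_measurable borel"
    by (intro borel_measurable_continuous_onI continuous_intros)
  ultimately show "(\<lambda>x. f x $ i $ j) \<in> borel_measurable M"
    by (rule measurable_compose)
next
  assume *: "\<forall>i j. (\<lambda>x. f x $ i $ j) \<in> borel_measurable M"
  have "(\<lambda>x. f x \<bullet> b) \<in> borel_measurable M" for b :: "complex^'n^'m"
    unfolding inner_vec_def using * by (intro borel_measurable_sum borel_measurable_inner) auto
  then show "f \<in> borel_measurable M"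
    using borel_measurable_euclidean_space[of f M] by blast
qed

lemma borel_measurable_matrix_nth [measurable (raw)]:
  fixes f :: "'a \<Rightarrow> complex^'n^'m"
  assumes "f \<in> borel_measurable M"
  shows "(\<lambda>x. f x $ i $ j) \<in> borel_measurable M"
  using assms borel_measurable_matrix_iff by blast

lemma borel_measurable_matrix_mult [measurable (raw)]:
  fixes f :: "'a \<Rightarrow> complex^'n^'m" and g :: "'a \<Rightarrow> complex^'p^'n"
  assumes [measurable]: "f \<in> borel_measurable M" "g \<in> borel_measurable M"
  shows "(\<lambda>x. f x ** g x) \<in> borel_measurable M"
  unfolding borel_measurable_matrix_iff
  by (simp add: matrix_matrix_mult_def)

lemma borel_measurable_det [measurable (raw)]:
  fixes f :: "'a \<Rightarrow> complex^'d^'d"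
  assumes [measurable]: "f \<in> borel_measurable M"
  shows "(\<lambda>x. det (f x)) \<in> borel_measurable M"
  unfolding det_def by measurable

lemma L2T_matrix_iff:
  fixes f :: "complex \<Rightarrow> complex^'d^'d"
  shows "L2T f \<longleftrightarrow> (\<forall>i j. L2T (\<lambda>w. f w $ i $ j))"
proof
  assume f: "L2T f"
  show "\<forall>i j. L2T (\<lambda>w. f w $ i $ j)"
  proof (intro allI)
    fix i j
    show "L2T (\<lambda>w. f w $ i $ j)"
      by (rule L2T_dominated[of _ "\<lambda>w. (norm (f w))\<^sup>2"])
         (use f borel_measurable_matrix_nth[OF L2T_measurable[OF f]] in \<open>auto simp: L2T_def intro!: power_mono norm_entry_le\<close>)
  qed
qed (auto simp: L2T_def borel_measurable_matrix_iff norm_matrix_sq)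

lemma sqnorm_matrix:
  fixes f :: "complex \<Rightarrow> complex^'d^'d"
  assumes "L2T f"
  shows "sqnorm f = (\<Sum>i\<in>UNIV. \<Sum>j\<in>UNIV. sqnorm (\<lambda>w. f w $ i $ j))"
  using assms unfolding L2T_matrix_iff by (simp add: sqnorm_def L2T_def norm_matrix_sq Bochner_Integration.integral_sum)

lemma L2T_bounded_mult:
  fixes P G :: "complex \<Rightarrow> complex^'d^'d"
  assumes [measurable]: "P \<in> borel_measurable borel" and B: "\<And>w. norm (P w) \<le> B" and G: "L2T G"
  shows "L2T (\<lambda>w. P w ** G w)" "sqnorm (\<lambda>w. P w ** G w) \<le> B\<^sup>2 * sqnorm G"
proof -
  have [measurable]: "G \<in> borel_measurable borel" using G by (rule L2T_measurable)
  have le: "(norm (P w ** G w))\<^sup>2 \<le> B\<^sup>2 * (norm (G w))\<^sup>2" for w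
  proof -
    have "norm (P w ** G w) \<le> B * norm (G w)"
      using norm_matrix_mult_le[of "P w" "G w"] mult_right_mono[OF B[of w], of "norm (G w)"] by simp
    then show ?thesis by (metis norm_ge_zero power_mono power_mult_distrib)
  qed
  have i: "integrable T_meas (\<lambda>w. B\<^sup>2 * (norm (G w))\<^sup>2)" using G by (simp add: L2T_def)
  show L: "L2T (\<lambda>w. P w ** G w)"
    by (rule L2T_dominated[OF _ i]) (use le in auto)
  have "sqnorm (\<lambda>w. P w ** G w) \<le> (\<integral>w. B\<^sup>2 * (norm (G w))\<^sup>2 \<partial>T_meas)"
    unfolding sqnorm_def using L by (intro integral_mono i le) (simp add: L2T_def)
  then show "sqnorm (\<lambda>w. P w ** G w) \<le> B\<^sup>2 * sqnorm G" by (simp add: sqnorm_def)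
qed

lemma holomorphic_on_det:
  fixes f :: "complex \<Rightarrow> complex^'d^'d"
  assumes "\<And>i j. (\<lambda>z. f z $ i $ j) holomorphic_on S"
  shows "(\<lambda>z. det (f z)) holomorphic_on S"
  unfolding det_def by (intro holomorphic_intros assms)

lemma H2_const: "H2 (\<lambda>_. 1)"
  using integral_T_power_zero by (simp add: H2_def memLp_2_iff L2T_def)

lemma cmod_mult_less_1:
  assumes "cmod w \<le> 1" "0 \<le> r" "r < 1"
  shows "cmod (of_real r * w) < 1"
proof -
  have "r * cmod w \<le> r * 1" using assms by (intro mult_left_mono) auto
  then show ?thesis using assms by (simp add: norm_mult)
qed

text \<open>Nothing is known about \<open>f\<close> outside the disc, so the dilation is cut off to
  0 beyond the closed disc; this gives a Borel function on the whole plane with the right values on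
  the circle.\<close>

lemma measurable_dilation:
  assumes "f holomorphic_on ball 0 1" "0 \<le> r" "r < 1"
  shows "(\<lambda>w. if cmod w \<le> 1 then f (of_real r * w) else 0) \<in> borel_measurable borel"
proof -
  have "continuous_on (cball 0 1) (\<lambda>w. f (of_real r * w))"
  proof (rule continuous_on_compose2[OF holomorphic_on_imp_continuous_on[OF assms(1)]])
    show "(\<lambda>w. complex_of_real r * w) ` cball 0 1 \<subseteq> ball 0 1"
      using assms by (auto intro!: cmod_mult_less_1)
  qed (intro continuous_intros)
  then have "(\<lambda>w. indicator (cball 0 1) w *\<^sub>R f (of_real r * w)) \<in> borel_measurable borel"
    by (intro borel_measurable_continuous_on_indicator) auto
  also have "(\<lambda>w. indicator (cball 0 1) w *\<^sub>R f (of_real r * w)) = (\<lambda>w. if cmod w \<le> 1 then f (of_real r * w) else 0)"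
    by (auto simp: indicator_def)
  finally show ?thesis .
qed

subsection \<open>Bounded analytic approximate inverses of an outer matrix\<close>

locale outer_matrix =
  fixes G :: "complex \<Rightarrow> complex^'d^'d"
  assumes H2: "\<And>i j. H2 (\<lambda>w. G w $ i $ j)"
    and outer: "is_outer (\<lambda>z. det (mat_ext G z)) (\<lambda>w. det (G w))"
begin

lemma L2T: "L2T G"
  unfolding L2T_matrix_iff using H2 H2_L2T by blast

lemma mat_ext_eq_poisson: "cmod z < 1 \<Longrightarrow> mat_ext G z $ i $ j = poisson (\<lambda>w. G w $ i $ j) z"
  by (simp add: mat_ext_def poisson_H2[OF H2])

lemma mat_ext_holomorphic: "(\<lambda>z. mat_ext G z $ i $ j) holomorphic_on ball 0 1"
  using cauchy_ext_holomorphic[OF L2T_integrable[OF H2_L2T[OF H2[of i j]]]]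
  by (simp add: mat_ext_def)

definition lndet :: "complex \<Rightarrow> real" where "lndet w = ln (cmod (det (G w)))"

lemma integrable_lndet: "integrable T_meas lndet"
  using outer by (simp add: is_outer_def lndet_def[abs_def])

lemma det_mat_ext:
  obtains c where "cmod c = 1" "\<And>z. cmod z < 1 \<Longrightarrow> det (mat_ext G z) = c * exp (herglotz (\<lambda>w. of_real (lndet w)) z)"
  using outer unfolding is_outer_def herglotz_def lndet_def by auto

text \<open>An outer determinant is a unimodular constant times an exponential, so
  \<open>mat_ext G\<close> is invertible throughout the disc although nothing bounds the
  inverse.\<close>

lemma det_mat_ext_nz: "cmod z < 1 \<Longrightarrow> det (mat_ext G z) \<noteq> 0"
  using det_mat_ext by (metis exp_not_eq_zero mult_eq_0_iff norm_zero zero_neq_one)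

definition nsq :: "complex \<Rightarrow> real" where "nsq w = (norm (G w))\<^sup>2"

lemma integrable_nsq: "integrable T_meas nsq"
  using L2T by (simp add: L2T_def nsq_def[abs_def])

text \<open>Jensen summed over the entries. The harmonic majorant of the squared norm is the real
  part of an analytic function, which allows \<open>vfun\<close> to dominate
  \<open>mat_ext G\<close> while remaining holomorphic.\<close>

lemma norm_mat_ext_sq_le:
  assumes z: "cmod z < 1"
  shows "(norm (mat_ext G z))\<^sup>2 \<le> Re (herglotz (\<lambda>w. of_real (nsq w)) z)"
proof -
  have i: "integrable T_meas (\<lambda>w. pkernel w z * (cmod (G w $ i $ j))\<^sup>2)" for i j
    using integrable_pkernel[of "\<lambda>w. (cmod (G w $ i $ j))\<^sup>2" z] H2_L2T[OF H2[of i j]] z by (simp add: L2T_def)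
  have "(norm (mat_ext G z))\<^sup>2 \<le> (\<Sum>i\<in>UNIV. \<Sum>j\<in>UNIV. (1 / (2 * pi)) * (\<integral>w. pkernel w z * (cmod (G w $ i $ j))\<^sup>2 \<partial>T_meas))"
    unfolding norm_matrix_sq mat_ext_eq_poisson[OF z] by (intro sum_mono poisson_jensen z H2_L2T H2)
  also have "\<dots> = (1 / (2 * pi)) * (\<integral>w. pkernel w z * nsq w \<partial>T_meas)"
    by (simp add: nsq_def norm_matrix_sq sum_distrib_left Bochner_Integration.integral_sum i)
  also have "\<dots> = Re (herglotz (\<lambda>w. of_real (nsq w)) z)"
    by (rule Re_herglotz[OF integrable_nsq z, symmetric])
  finally show ?thesis .
qed

text \<open>\<open>Phi\<close> is the inverse of \<open>G\<close> on the disc times a scalar \<open>phi\<close> chosen to make it bounded: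
  the exponential in \<open>phi\<close> divided by \<open>det G\<close> is at most \<open>exp k\<close> in modulus because \<open>trunc k \<le> k + lndet\<close>, and the powers
  of \<open>vfun k\<close> absorb the cofactors because \<open>Re (vfun k) \<ge> 1 + |G|\<^sup>2 / (k + 1)\<close>. As \<open>k\<close> grows, \<open>phi k\<close> tends to 1.\<close>

definition trunc :: "nat \<Rightarrow> complex \<Rightarrow> real" where
  "trunc k w = min 0 (real k + lndet w)"

definition vfun :: "nat \<Rightarrow> complex \<Rightarrow> complex" where
  "vfun k z = 1 + of_real (1 / (real k + 1)) * herglotz (\<lambda>w. of_real (nsq w)) z"

definition phi :: "nat \<Rightarrow> complex \<Rightarrow> complex" where
  "phi k z = exp (herglotz (\<lambda>w. of_real (trunc k w)) z) / vfun k z ^ CARD('d)"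

definition Phi :: "nat \<Rightarrow> complex \<Rightarrow> complex^'d^'d" where
  "Phi k z = (\<chi> i j. phi k z / det (mat_ext G z) * cofactor_matrix (mat_ext G z) $ i $ j)"

lemma integrable_trunc: "integrable T_meas (trunc k)"
  unfolding trunc_def using integrable_lndet by (intro integrable_min) auto

lemma Re_herglotz_mono:
  assumes "integrable T_meas f" "integrable T_meas g" "cmod z < 1" "\<And>w. f w \<le> (g w :: real)"
  shows "Re (herglotz (\<lambda>w. of_real (f w)) z) \<le> Re (herglotz (\<lambda>w. of_real (g w)) z)"
proof -
  have "(\<integral>w. pkernel w z * f w \<partial>T_meas) \<le> (\<integral>w. pkernel w z * g w \<partial>T_meas)"
  proof (rule integral_mono_AE)
    show "integrable T_meas (\<lambda>w. pkernel w z * f w)" "integrable T_meas (\<lambda>w. pkernel w z * g w)"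
      using integrable_pkernel[OF assms(1,3)] integrable_pkernel[OF assms(2,3)] by auto
    show "AE w in T_meas. pkernel w z * f w \<le> pkernel w z * g w"
      using AE_T_norm by eventually_elim (use assms in \<open>auto intro!: mult_left_mono pkernel_nonneg\<close>)
  qed
  then show ?thesis
    by (simp add: Re_herglotz assms(1,2,3) divide_right_mono)
qed

lemma Re_herglotz_const: "cmod z < 1 \<Longrightarrow> Re (herglotz (\<lambda>w. of_real c) z) = c"
  using Re_herglotz[of "\<lambda>_. c" z] integral_pkernel[of z] by simp

lemma Re_vfun:
  assumes z: "cmod z < 1"
  shows "Re (vfun k z) \<ge> 1 + (norm (mat_ext G z))\<^sup>2 / (real k + 1)" "cmod (vfun k z) \<ge> 1"
    "norm (mat_ext G z) \<le> (real k + 1) * cmod (vfun k z)"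
proof -
  have "Re (vfun k z) = 1 + Re (herglotz (\<lambda>w. of_real (nsq w)) z) / (real k + 1)"
  proof -
    have "Re (1 + of_real a * u) = 1 + a * Re u" for a u by simp
    then show ?thesis unfolding vfun_def by simp
  qed
  with norm_mat_ext_sq_le[OF z]
  show 1: "Re (vfun k z) \<ge> 1 + (norm (mat_ext G z))\<^sup>2 / (real k + 1)"
    by (simp add: divide_right_mono)
  have le: "Re (vfun k z) \<le> cmod (vfun k z)" by (rule complex_Re_le_cmod)
  have "(norm (mat_ext G z))\<^sup>2 / (real k + 1) \<ge> 0" by simp
  with 1 le show v1: "cmod (vfun k z) \<ge> 1" by linarith
  have "norm (mat_ext G z) \<le> 1 + (norm (mat_ext G z))\<^sup>2"
  proof -
    have "0 \<le> (norm (mat_ext G z) - 1 / 2)\<^sup>2" by simp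
    then show ?thesis unfolding power2_diff by (simp add: power2_eq_square)
  qed
  also have "\<dots> \<le> (real k + 1) * (1 + (norm (mat_ext G z))\<^sup>2 / (real k + 1))"
    by (simp add: field_simps)
  also have "\<dots> \<le> (real k + 1) * cmod (vfun k z)"
    using 1 le by (intro mult_left_mono) auto
  finally show "norm (mat_ext G z) \<le> (real k + 1) * cmod (vfun k z)" .
qed

lemma cmod_phi_le: "cmod z < 1 \<Longrightarrow> cmod (phi k z) \<le> 1"
proof -
  assume z: "cmod z < 1"
  have "Re (herglotz (\<lambda>w. of_real (trunc k w)) z) \<le> Re (herglotz (\<lambda>w. of_real 0) z)"
    by (intro Re_herglotz_mono integrable_trunc z) (auto simp: trunc_def)
  then have "cmod (exp (herglotz (\<lambda>w. of_real (trunc k w)) z)) \<le> 1"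
    using Re_herglotz_const[OF z, of 0] by simp
  moreover have "cmod (vfun k z) ^ CARD('d) \<ge> 1"
    using Re_vfun(2)[OF z] by (simp add: one_le_power)
  ultimately show ?thesis
    unfolding phi_def norm_divide norm_power
    using frac_le[of 1 "cmod (exp (herglotz (\<lambda>w. of_real (trunc k w)) z))" 1 "cmod (vfun k z) ^ CARD('d)"] by simp
qed

lemma Phi_bound:
  assumes z: "cmod z < 1"
  shows "norm (Phi k z) \<le> CARD('d) * (exp (real k) * (fact CARD('d) * (real k + 1) ^ CARD('d)))"
proof (rule norm_matrix_le)
  fix i j
  obtain c where c: "cmod c = 1" "\<And>z. cmod z < 1 \<Longrightarrow> det (mat_ext G z) = c * exp (herglotz (\<lambda>w. of_real (lndet w)) z)"
    using det_mat_ext by blast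
  define v where "v = cmod (vfun k z)"
  have v: "v \<ge> 1" unfolding v_def by (rule Re_vfun(2)[OF z])
  have ki: "integrable T_meas (\<lambda>w. real k + lndet w)" using integrable_lndet by simp
  have "Re (herglotz (\<lambda>w. of_real (trunc k w)) z) \<le> Re (herglotz (\<lambda>w. of_real (real k + lndet w)) z)"
    by (intro Re_herglotz_mono integrable_trunc z ki) (auto simp: trunc_def)
  also have "\<dots> = real k + Re (herglotz (\<lambda>w. of_real (lndet w)) z)"
  proof -
    have "herglotz (\<lambda>w. of_real (real k + lndet w)) z = herglotz (\<lambda>w. of_real (real k)) z + herglotz (\<lambda>w. of_real (lndet w)) z"
      unfolding herglotz_def of_real_add distrib_left
      using integrable_herglotz_kernel(2)[of "\<lambda>w. of_real (real k)" z] integrable_herglotz_kernel(2)[of "\<lambda>w. of_real (lndet w)" z] integrable_lndet z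
      by (subst Bochner_Integration.integral_add) (auto simp: distrib_left)
    then show ?thesis using Re_herglotz_const[OF z, of "real k"] by simp
  qed
  finally have 1: "cmod (exp (herglotz (\<lambda>w. of_real (trunc k w)) z)) / cmod (det (mat_ext G z)) \<le> exp (real k)"
    unfolding c(2)[OF z] by (simp add: norm_mult c(1) exp_diff[symmetric] flip: exp_diff)
  have "cmod (cofactor_matrix (mat_ext G z) $ i $ j) \<le> fact CARD('d) * ((real k + 1) * v) ^ CARD('d)"
  proof (rule cofactor_matrix_bound)
    show "1 \<le> (real k + 1) * v" using v mult_mono[of 1 "real k + 1" 1 v] by simp
    show "norm (mat_ext G z) \<le> (real k + 1) * v" unfolding v_def by (rule Re_vfun(3)[OF z])
  qed
  then have 2: "cmod (cofactor_matrix (mat_ext G z) $ i $ j) / v ^ CARD('d) \<le> fact CARD('d) * (real k + 1) ^ CARD('d)"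
    unfolding power_mult_distrib using v by (simp add: pos_divide_le_eq mult.assoc)
  have "cmod (Phi k z $ i $ j) = (cmod (exp (herglotz (\<lambda>w. of_real (trunc k w)) z)) / cmod (det (mat_ext G z)))
      * (cmod (cofactor_matrix (mat_ext G z) $ i $ j) / v ^ CARD('d))"
    by (simp add: Phi_def phi_def norm_mult norm_divide norm_power v_def)
  also have "\<dots> \<le> exp (real k) * (fact CARD('d) * (real k + 1) ^ CARD('d))"
    by (intro mult_mono 1 2) (use v in auto)
  finally show "cmod (Phi k z $ i $ j) \<le> exp (real k) * (fact CARD('d) * (real k + 1) ^ CARD('d))" .
qed

lemma Phi_mult:
  assumes z: "cmod z < 1"
  shows "Phi k z ** mat_ext G z = mat (phi k z)"
proof -
  have "(Phi k z ** mat_ext G z) $ i $ j = phi k z / det (mat_ext G z) * (cofactor_matrix (mat_ext G z) ** mat_ext G z) $ i $ j" for i j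
    by (simp add: Phi_def matrix_matrix_mult_def sum_distrib_left mult.assoc)
  then show ?thesis
    using det_mat_ext_nz[OF z] by (simp add: cofactor_matrix_mult vec_eq_iff mat_def)
qed

lemma phi_holomorphic: "phi k holomorphic_on ball 0 1"
proof -
  have "vfun k holomorphic_on ball 0 1"
    unfolding vfun_def using integrable_nsq by (intro holomorphic_intros herglotz_holomorphic) auto
  moreover have "vfun k z \<noteq> 0" if "z \<in> ball 0 1" for z
    using Re_vfun(2)[of z k] that by auto
  moreover have "herglotz (\<lambda>w. of_real (trunc k w)) holomorphic_on ball 0 1"
    using integrable_trunc by (intro herglotz_holomorphic) auto
  ultimately show ?thesis
    unfolding phi_def by (intro holomorphic_intros) auto
qed

lemma Phi_holomorphic: "(\<lambda>z. Phi k z $ i $ j) holomorphic_on ball 0 1"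
proof -
  have "(\<lambda>z. cofactor_matrix (mat_ext G z) $ i $ j) holomorphic_on ball 0 1"
    unfolding cofactor_matrix_def
  proof (simp, rule holomorphic_on_det)
    fix a b
    show "(\<lambda>z. (\<chi> i' l. if l = i then axis j 1 $ i' else mat_ext G z $ i' $ l) $ a $ b) holomorphic_on ball 0 1"
      by (cases "b = i") (simp_all add: mat_ext_holomorphic)
  qed
  moreover have "(\<lambda>z. det (mat_ext G z)) holomorphic_on ball 0 1"
    by (intro holomorphic_on_det mat_ext_holomorphic)
  ultimately show ?thesis
    unfolding Phi_def using det_mat_ext_nz by (auto intro!: holomorphic_intros phi_holomorphic)
qed

lemma herglotz_0: "herglotz (\<lambda>w. of_real (f w)) 0 = of_real ((1 / (2 * pi)) * (\<integral>w. f w \<partial>T_meas))"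
  if "integrable T_meas f" for f :: "complex \<Rightarrow> real"
  using herglotz_eq_cauchy_ext[of "\<lambda>w. of_real (f w)" 0] that by (simp add: cauchy_ext_0)

lemma phi_0: "phi k 0 = of_real (exp ((1 / (2 * pi)) * (\<integral>w. trunc k w \<partial>T_meas)) / (1 + (1 / (real k + 1)) * ((1 / (2 * pi)) * (\<integral>w. nsq w \<partial>T_meas))) ^ CARD('d))"
proof -
  have "exp (complex_of_real x) / (1 + complex_of_real y * complex_of_real u) ^ n = complex_of_real (exp x / (1 + y * u) ^ n)" for x y u n
    by (simp add: exp_of_real)
  then show ?thesis
    unfolding phi_def vfun_def herglotz_0[OF integrable_trunc] herglotz_0[OF integrable_nsq] .
qed

text \<open>Convergence at the single point 0 suffices: as \<open>cmod (phi k z) \<le> 1\<close>,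
  the mean of \<open>|phi k - 1|^2\<close> on a circle of radius below 1 is at most
  \<open>2 * (1 - Re (phi k 0))\<close>.\<close>

lemma phi_0_tendsto: "(\<lambda>k. Re (phi k 0)) \<longlonglongrightarrow> 1"
proof -
  have "(\<lambda>k. \<integral>w. trunc k w \<partial>T_meas) \<longlonglongrightarrow> (\<integral>w. 0 \<partial>T_meas)"
  proof (rule integral_dominated_convergence[where w = "\<lambda>w. \<bar>lndet w\<bar>"])
    show "AE w in T_meas. (\<lambda>k. trunc k w) \<longlonglongrightarrow> 0"
    proof (rule AE_I2)
      fix w
      have "\<forall>\<^sub>F k in sequentially. real k \<ge> - lndet w"
        using filterlim_real_sequentially unfolding filterlim_at_top by blast
      then have "\<forall>\<^sub>F k in sequentially. trunc k w = 0"
        by eventually_elim (simp add: trunc_def)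
      then show "(\<lambda>k. trunc k w) \<longlonglongrightarrow> 0" by (rule tendsto_eventually)
    qed
    show "trunc k \<in> borel_measurable T_meas" for k using integrable_trunc by (rule borel_measurable_integrable)
    show "AE w in T_meas. norm (trunc k w) \<le> \<bar>lndet w\<bar>" for k
      by (intro AE_I2) (auto simp: trunc_def)
  qed (use integrable_lndet in auto)
  then have 1: "(\<lambda>k. \<integral>w. trunc k w \<partial>T_meas) \<longlonglongrightarrow> 0" by simp
  have 2: "(\<lambda>k. 1 / (real k + 1)) \<longlonglongrightarrow> 0" by real_asymp
  have "(\<lambda>k. exp ((1 / (2 * pi)) * (\<integral>w. trunc k w \<partial>T_meas)) / (1 + (1 / (real k + 1)) * ((1 / (2 * pi)) * (\<integral>w. nsq w \<partial>T_meas))) ^ CARD('d))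
    \<longlonglongrightarrow> exp ((1 / (2 * pi)) * 0) / (1 + 0 * ((1 / (2 * pi)) * (\<integral>w. nsq w \<partial>T_meas))) ^ CARD('d)"
    by (intro tendsto_intros 1 2) auto
  then show ?thesis unfolding phi_0 by simp
qed

text \<open>\<open>P\<close> is \<open>Phi k\<close> dilated to a radius \<open>r < 1\<close>, and
  \<open>C\<close> is \<open>Phi k 0\<close>. With \<open>Gr\<close> the dilation of
  \<open>G\<close> and \<open>p\<close> that of \<open>phi k\<close>, one has
  \<open>P ** G - mat 1 = P ** (G - Gr) + mat (p - 1)\<close> on the circle. The third property says
  that multiplication by \<open>P\<close> acts on means of \<open>H2\<close> functions as the
  constant matrix \<open>C\<close>.\<close>

lemma approx_inverse:
  assumes "e > 0"
  obtains P :: "complex \<Rightarrow> complex^'d^'d" and B C where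
    "P \<in> borel_measurable borel" "\<And>w. norm (P w) \<le> B"
    "\<And>i j g. H2 g \<Longrightarrow> (\<integral>w. P w $ i $ j * g w \<partial>T_meas) = C $ i $ j * (\<integral>w. g w \<partial>T_meas)"
    "sqnorm (\<lambda>w. P w ** G w - mat 1) < e"
proof -
  define d where "d = real CARD('d)"
  have d: "d > 0" by (simp add: d_def)
  \<comment> \<open>The degree \<open>k\<close> of truncation is chosen first, to make
    \<open>mat (p - 1)\<close> small; the bound \<open>B\<close> on \<open>Phi k\<close> depends on
    it, and only then is \<open>n\<close> chosen so that the dilation error of \<open>G\<close>
    beats \<open>B\<^sup>2\<close>. The outer factors 2 come from the squared triangle
    inequality.\<close>
  have "(\<lambda>k. 2 * (d * (2 * (2 * pi * (1 - Re (phi k 0)))))) \<longlonglongrightarrow> 2 * (d * (2 * (2 * pi * (1 - 1))))"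
    by (intro tendsto_intros phi_0_tendsto)
  then have "\<forall>\<^sub>F k in sequentially. 2 * (d * (2 * (2 * pi * (1 - Re (phi k 0))))) < e / 2"
    by (rule order_tendstoD(2)) (use assms in simp)
  then obtain k where k: "2 * (d * (2 * (2 * pi * (1 - Re (phi k 0))))) < e / 2"
    by (auto simp: eventually_sequentially)
  define B where "B = CARD('d) * (exp (real k) * (fact CARD('d) * (real k + 1) ^ CARD('d)))"
  have B0: "B \<ge> 0" by (simp add: B_def)
  have "(\<lambda>n. 2 * (B\<^sup>2 * (\<Sum>i\<in>UNIV. \<Sum>j\<in>UNIV. poisson_err (\<lambda>w. G w $ i $ j) n)))
      \<longlonglongrightarrow> 2 * (B\<^sup>2 * (\<Sum>i\<in>(UNIV::'d set). \<Sum>j\<in>(UNIV::'d set). 0))"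
    by (intro tendsto_intros H2_dilation_tendsto H2)
  then have "\<forall>\<^sub>F n in sequentially. 2 * (B\<^sup>2 * (\<Sum>i\<in>UNIV. \<Sum>j\<in>UNIV. poisson_err (\<lambda>w. G w $ i $ j) n)) < e / 2"
    by (rule order_tendstoD(2)) (use assms in simp)
  then obtain n where n: "2 * (B\<^sup>2 * (\<Sum>i\<in>UNIV. \<Sum>j\<in>UNIV. poisson_err (\<lambda>w. G w $ i $ j) n)) < e / 2"
    by (auto simp: eventually_sequentially)
  define r where "r = rad n"
  have r: "0 \<le> r" "r < 1" using rad_bounds by (auto simp: r_def)
  define P where "P w = (\<chi> i j. if cmod w \<le> 1 then Phi k (of_real r * w) $ i $ j else 0)" for w
  have P1: "P w = Phi k (of_real r * w)" if "cmod w \<le> 1" for w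
    using that by (simp add: P_def vec_eq_iff)
  have Pm [measurable]: "P \<in> borel_measurable borel"
    unfolding borel_measurable_matrix_iff P_def using measurable_dilation[OF Phi_holomorphic r] by simp
  have PB: "norm (P w) \<le> B" for w
  proof (cases "cmod w \<le> 1")
    case True
    then have "cmod (of_real r * w) < 1"
      using r by (intro cmod_mult_less_1)
    then show ?thesis unfolding P1[OF True] B_def by (rule Phi_bound)
  next
    case False
    then have "P w = 0" by (simp add: P_def vec_eq_iff)
    then show ?thesis using B0 by simp
  qed
  have mean: "(\<integral>w. P w $ i $ j * g w \<partial>T_meas) = Phi k 0 $ i $ j * (\<integral>w. g w \<partial>T_meas)" if "H2 g" for i j g
    by (rule H2_mean_mult[OF that Phi_holomorphic r]) (auto simp: P1)
  define Gr where "Gr w = (\<chi> i j. poisson (\<lambda>w. G w $ i $ j) (of_real r * w))" for w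
  have LGr: "L2T Gr"
    unfolding L2T_matrix_iff using poisson_contraction(1)[OF H2_L2T[OF H2] r] by (simp add: Gr_def)
  have Gr: "Gr w = mat_ext G (of_real r * w)" if "cmod w = 1" for w
    by (simp add: Gr_def vec_eq_iff mat_ext_eq_poisson cmod_rad_mult[OF that r])
  have LD: "L2T (\<lambda>w. G w - Gr w)" by (rule L2T_diff[OF L2T LGr])
  have sD: "sqnorm (\<lambda>w. G w - Gr w) = (\<Sum>i\<in>UNIV. \<Sum>j\<in>UNIV. poisson_err (\<lambda>w. G w $ i $ j) n)"
    unfolding sqnorm_matrix[OF LD] by (intro sum.cong refl) (simp add: Gr_def r_def sqnorm_diff_commute)
  define p where "p w = (if cmod w \<le> 1 then phi k (of_real r * w) else 0)" for w
  have pm [measurable]: "p \<in> borel_measurable borel"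
    unfolding p_def by (rule measurable_dilation[OF phi_holomorphic r])
  have p1: "cmod (p w) \<le> 1" for w
  proof (cases "cmod w \<le> 1")
    case True
    then have "cmod (of_real r * w) < 1"
      using r by (intro cmod_mult_less_1)
    then show ?thesis using True by (simp add: p_def cmod_phi_le)
  qed (simp add: p_def)
  have pmean: "(\<integral>w. p w \<partial>T_meas) = of_real (2 * pi) * phi k 0"
    using H2_mean_mult[OF H2_const phi_holomorphic r pm, of k] by (simp add: p_def measure_T_meas scaleR_conv_of_real)
  have pint: "integrable T_meas p"
    by (rule T.integrable_const_bound[of _ 1]) (use p1 in auto)
  have pre: "integrable T_meas (\<lambda>w. Re (p w))" using pint by (rule integrable_Re)
  have normM: "(norm (mat c :: complex^'d^'d))\<^sup>2 = d * (cmod c)\<^sup>2" for c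
  proof -
    have "(cmod ((mat c :: complex^'d^'d)$i$j))\<^sup>2 = (if i = j then (cmod c)\<^sup>2 else 0)" for i j
      by (simp add: mat_def)
    then show ?thesis unfolding norm_matrix_sq by (simp add: d_def)
  qed
  have Mm: "(\<lambda>w. mat (p w - 1) :: complex^'d^'d) \<in> borel_measurable borel"
    unfolding borel_measurable_matrix_iff mat_def by simp
  \<comment> \<open>A contraction close to 1 in the mean is close to 1 in L2:
    \<open>|p - 1|^2 = |p|^2 + 1 - 2 * Re p\<close>, and \<open>|p| \<le> 1\<close>.\<close>
  have ple: "(norm (mat (p w - 1) :: complex^'d^'d))\<^sup>2 \<le> d * (2 * (1 - Re (p w)))" for w
  proof -
    have "(cmod (p w - 1))\<^sup>2 = (cmod (p w))\<^sup>2 + 1 - 2 * Re (p w)"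
      unfolding cmod_power2 by (simp add: power2_eq_square algebra_simps)
    also have "\<dots> \<le> 2 * (1 - Re (p w))"
      using p1[of w] by (simp add: power_le_one)
    finally show ?thesis unfolding normM using d by (intro mult_left_mono) auto
  qed
  have Mi: "integrable T_meas (\<lambda>w. d * (2 * (1 - Re (p w))))" using pre by simp
  have LM: "L2T (\<lambda>w. mat (p w - 1) :: complex^'d^'d)"
    by (rule L2T_dominated[OF Mm Mi]) (use ple in auto)
  have "sqnorm (\<lambda>w. mat (p w - 1) :: complex^'d^'d) \<le> (\<integral>w. d * (2 * (1 - Re (p w))) \<partial>T_meas)"
    unfolding sqnorm_def using LM by (intro integral_mono Mi ple) (simp add: L2T_def)
  also have "\<dots> = d * (2 * (2 * pi * (1 - Re (phi k 0))))"
    using pre pint pmean by (simp add: measure_T_meas algebra_simps)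
  finally have sM: "sqnorm (\<lambda>w. mat (p w - 1) :: complex^'d^'d) \<le> d * (2 * (2 * pi * (1 - Re (phi k 0))))" .
  note LPD = L2T_bounded_mult[OF Pm PB LD]
  have GM [measurable]: "G \<in> borel_measurable borel" by (rule L2T_measurable[OF L2T])
  have "sqnorm (\<lambda>w. P w ** G w - mat 1) = sqnorm (\<lambda>w. P w ** (G w - Gr w) + mat (p w - 1))"
  proof (rule sqnorm_cong_AE)
    show "AE w in T_meas. P w ** G w - mat 1 = P w ** (G w - Gr w) + mat (p w - 1)"
      using AE_T_norm
    proof eventually_elim
      case (elim w)
      have "P w ** Gr w = mat (p w)"
        using elim Phi_mult[OF cmod_rad_mult[OF elim r]] by (simp add: P1 Gr p_def)
      moreover have "mat (p w - 1) = mat (p w) - (mat 1 :: complex^'d^'d)"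
        by (simp add: vec_eq_iff mat_def)
      ultimately show ?case by (simp add: matrix_mult.diff_right)
    qed
    show "(\<lambda>w. P w ** (G w - Gr w) + mat (p w - 1)) \<in> borel_measurable borel"
      by (rule L2T_measurable[OF L2T_add(1)[OF LPD(1) LM]])
  qed measurable
  also have "\<dots> \<le> 2 * sqnorm (\<lambda>w. P w ** (G w - Gr w)) + 2 * sqnorm (\<lambda>w. mat (p w - 1) :: complex^'d^'d)"
    by (rule L2T_add(2)[OF LPD(1) LM])
  also have "\<dots> < e"
    using LPD(2) sM k n unfolding sD by linarith
  finally have "sqnorm (\<lambda>w. P w ** G w - mat 1) < e" .
  with that[OF Pm PB mean] show thesis by blast
qed

end

subsection \<open>Convergence of outer factors in one variable\<close>

lemma mat_ext_0:
  assumes X: "L2T X"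
  shows "mat_ext X 0 = (1 / (2 * pi)) *\<^sub>R (\<integral>w. X w \<partial>T_meas)"
proof -
  have i: "integrable T_meas X" by (rule L2T_integrable[OF X])
  have "(\<integral>w. X w \<partial>T_meas) $ i $ j = (\<integral>w. X w $ i $ j \<partial>T_meas)" for i j
    using integral_bounded_linear[OF bounded_linear_compose[OF bounded_linear_vec_nth[of j] bounded_linear_vec_nth[of i]] i]
    by (simp add: o_def)
  then show ?thesis
    by (simp add: mat_ext_def vec_eq_iff cauchy_ext_0) (simp add: scaleR_conv_of_real)
qed

lemma sqnorm_minus_const:
  fixes X :: "complex \<Rightarrow> complex^'d^'d"
  assumes X: "L2T X"
  shows "sqnorm (\<lambda>w. X w - c) = sqnorm X - 4 * pi * (mat_ext X 0 \<bullet> c) + 2 * pi * (norm c)\<^sup>2"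
proof -
  have i: "integrable T_meas X" by (rule L2T_integrable[OF X])
  have i2: "integrable T_meas (\<lambda>w. (norm (X w))\<^sup>2)" using X by (simp add: L2T_def)
  have "(norm (X w - c))\<^sup>2 = (norm (X w))\<^sup>2 - 2 * (X w \<bullet> c) + (norm c)\<^sup>2" for w
    by (simp add: power2_norm_eq_inner inner_diff inner_commute)
  then have "sqnorm (\<lambda>w. X w - c) = sqnorm X - 2 * (\<integral>w. X w \<bullet> c \<partial>T_meas) + 2 * pi * (norm c)\<^sup>2"
    unfolding sqnorm_def using i i2 by (simp add: measure_T_meas)
  also have "(\<integral>w. X w \<bullet> c \<partial>T_meas) = (\<integral>w. X w \<partial>T_meas) \<bullet> c"
    by (rule integral_inner_left) (use i in auto)
  finally show ?thesis by (simp add: mat_ext_0[OF X])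
qed

lemma sqnorm_minus_mean:
  fixes X :: "complex \<Rightarrow> complex^'d^'d"
  assumes X: "L2T X"
  shows "sqnorm (\<lambda>w. X w - mat_ext X 0) = sqnorm X - 2 * pi * (norm (mat_ext X 0))\<^sup>2"
  by (simp add: sqnorm_minus_const[OF X] power2_norm_eq_inner)

lemma mean_le_sqnorm:
  fixes X :: "complex \<Rightarrow> complex^'d^'d"
  assumes X: "L2T X"
  shows "2 * pi * (norm (mat_ext X 0))\<^sup>2 \<le> sqnorm X"
  using sqnorm_minus_mean[OF X] sqnorm_nonneg[of "\<lambda>w. X w - mat_ext X 0"] by linarith

text \<open>Pythagoras: the mean is the orthogonal projection of \<open>X\<close> on the
  constants.\<close>

lemma sqnorm_minus_const_split:
  fixes X :: "complex \<Rightarrow> complex^'d^'d"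
  assumes X: "L2T X"
  shows "sqnorm (\<lambda>w. X w - c) = sqnorm (\<lambda>w. X w - mat_ext X 0) + 2 * pi * (norm (mat_ext X 0 - c))\<^sup>2"
  unfolding sqnorm_minus_const[OF X] sqnorm_minus_mean[OF X]
  by (simp add: power2_norm_eq_inner inner_diff inner_commute algebra_simps)

lemma integrable_L2T_mult:
  assumes f: "L2T f" and g: "L2T g"
  shows "integrable T_meas (\<lambda>w. norm (f w) * norm (g w))"
proof (rule Bochner_Integration.integrable_bound)
  show "integrable T_meas (\<lambda>w. (norm (f w))\<^sup>2 + (norm (g w))\<^sup>2)" using f g by (simp add: L2T_def)
  have [measurable]: "f \<in> borel_measurable borel" "g \<in> borel_measurable borel"
    using f g by (auto simp: L2T_def)
  show "(\<lambda>w. norm (f w) * norm (g w)) \<in> borel_measurable T_meas" by simp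
  have "norm (f w) * norm (g w) \<le> (norm (f w))\<^sup>2 + (norm (g w))\<^sup>2" for w
    using sum_squares_bound[of "norm (f w)" "norm (g w)"]
      mult_nonneg_nonneg[OF norm_ge_zero[of "f w"] norm_ge_zero[of "g w"]] by linarith
  then show "AE w in T_meas. norm (norm (f w) * norm (g w)) \<le> norm ((norm (f w))\<^sup>2 + (norm (g w))\<^sup>2)"
    by (auto simp: add_nonneg_nonneg)
qed

lemma young: "t > 0 \<Longrightarrow> x * y \<le> (t * x\<^sup>2 + y\<^sup>2 / t) / 2" for x y t :: real
proof -
  assume t: "t > 0"
  have "0 \<le> (t * x - y)\<^sup>2 / t" using t by simp
  also have "\<dots> = t * x\<^sup>2 + y\<^sup>2 / t - 2 * (x * y)"
    using t by (simp add: power2_eq_square field_simps)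
  finally have "2 * (x * y) \<le> t * x\<^sup>2 + y\<^sup>2 / t" by (simp only: diff_ge_0_iff_ge)
  then show ?thesis by simp
qed

text \<open>Plays the part of Cauchy-Schwarz for integrals; the weight \<open>t\<close> is matched
  later to the sizes of the two factors, avoiding square roots.\<close>

lemma integral_mult_le_young:
  assumes f: "L2T f" and g: "L2T g" and t: "t > 0"
  shows "(\<integral>w. norm (f w) * norm (g w) \<partial>T_meas) \<le> (t * sqnorm f + sqnorm g / t) / 2"
proof -
  have "(\<integral>w. norm (f w) * norm (g w) \<partial>T_meas) \<le> (\<integral>w. (t * (norm (f w))\<^sup>2 + (norm (g w))\<^sup>2 / t) / 2 \<partial>T_meas)"
    by (rule integral_mono[OF integrable_L2T_mult[OF f g]]) (use f g young[OF t] in \<open>auto simp: L2T_def\<close>)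
  also have "\<dots> = (t * sqnorm f + sqnorm g / t) / 2"
    using f g by (simp add: L2T_def sqnorm_def)
  finally show ?thesis .
qed

lemma L2T_const: "L2T (\<lambda>_. c)"
  by (simp add: L2T_def)

lemma sqnorm_const: "sqnorm (\<lambda>_. c) = 2 * pi * (norm c)\<^sup>2"
  by (simp add: sqnorm_def measure_T_meas)

text \<open>Bolzano-Weierstrass: indices that stay \<open>e\<close> away from \<open>L\<close> would
  give a subsequence with a convergent subsequence of its own. This suits the means
  \<open>mat_ext (Gs n) 0\<close>, whose limits can be identified only once they exist.\<close>

lemma tendsto_unique_subseq_limit:
  fixes A :: "nat \<Rightarrow> 'a::euclidean_space"
  assumes bd: "\<And>n. norm (A n) \<le> K"
    and lim: "\<And>s B. strict_mono s \<Longrightarrow> (A \<circ> s) \<longlonglongrightarrow> B \<Longrightarrow> B = L"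
  shows "A \<longlonglongrightarrow> L"
proof (rule ccontr)
  assume "\<not> A \<longlonglongrightarrow> L"
  then obtain e where e: "e > 0" "\<not> (\<forall>\<^sub>F n in sequentially. dist (A n) L < e)"
    by (auto simp: tendsto_iff)
  define X where "X = {n. \<not> dist (A n) L < e}"
  have "infinite X"
    using e(2) unfolding X_def cofinite_eq_sequentially[symmetric] eventually_cofinite .
  from infinite_enumerate[OF this] obtain s :: "nat \<Rightarrow> nat" where s: "strict_mono s" "\<And>n. s n \<in> X"
    by blast
  have "bounded (range (A \<circ> s))" using bd by (auto simp: bounded_iff)
  then obtain B r where r: "strict_mono r" "((A \<circ> s) \<circ> r) \<longlonglongrightarrow> B"
    using bounded_imp_convergent_subsequence by blast
  have "B = L"
    by (rule lim[of "s \<circ> r"]) (use s r in \<open>auto simp: strict_mono_o o_assoc\<close>)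
  then have "\<forall>\<^sub>F n in sequentially. dist (((A \<circ> s) \<circ> r) n) L < e"
    using r(2) e(1) by (auto simp: tendsto_iff)
  then obtain n where "dist (A (s (r n))) L < e" by (auto simp: eventually_sequentially)
  with s(2)[of "r n"] show False by (simp add: X_def)
qed

text \<open>The data on one line in the first variable. The logarithmic integrals enter as
  \<open>detconv\<close>, and positive definiteness of the limit density as
  \<open>nz\<close>.\<close>

locale outer_sequence = outer_matrix G for G :: "complex \<Rightarrow> complex^'d^'d" +
  fixes Gs :: "nat \<Rightarrow> complex \<Rightarrow> complex^'d^'d"
    and Q :: "complex \<Rightarrow> complex^'d^'d" and Qs :: "nat \<Rightarrow> complex \<Rightarrow> complex^'d^'d"
  assumes Gs: "\<And>n i j. H2 (\<lambda>w. Gs n w $ i $ j)"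
    and Q: "AE w in T_meas. Q w = G w ** adjm (G w)"
    and Qs: "\<And>n. AE w in T_meas. Qs n w = Gs n w ** adjm (Gs n w)"
    and Qint: "\<And>i j. integrable T_meas (\<lambda>w. Q w $ i $ j)"
    and Qsint: "\<And>n i j. integrable T_meas (\<lambda>w. Qs n w $ i $ j)"
    and Qconv: "\<And>i j. (\<lambda>n. \<integral>w. cmod (Qs n w $ i $ j - Q w $ i $ j) \<partial>T_meas) \<longlonglongrightarrow> 0"
    and pd: "pos_def (mat_ext G 0)" "\<And>n. pos_def (mat_ext (Gs n) 0)"
    and detconv: "(\<lambda>n. cmod (det (mat_ext (Gs n) 0))) \<longlonglongrightarrow> cmod (det (mat_ext G 0))"
    and nz: "AE w in T_meas. det (G w) \<noteq> 0"
begin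

lemma L2Ts: "L2T (Gs n)"
  unfolding L2T_matrix_iff using Gs H2_L2T by blast

lemma measurable_G [measurable]: "G \<in> borel_measurable borel" "Gs n \<in> borel_measurable borel"
  using L2T L2Ts by (auto dest: L2T_measurable)

lemma measurable_Q [measurable]: "Q \<in> borel_measurable borel" "Qs n \<in> borel_measurable borel"
  using Qint[THEN borel_measurable_integrable] Qsint[THEN borel_measurable_integrable]
  by (simp_all add: borel_measurable_matrix_iff)

text \<open>The squared norm of \<open>P ** X\<close> is a trace linear in
  \<open>X ** adjm X\<close>, so L1 convergence of \<open>Qs\<close> is enough and nothing about
  \<open>Gs n\<close> itself is needed.\<close>

lemma sqnorm_mult_tendsto:
  fixes P :: "complex \<Rightarrow> complex^'d^'d"
  assumes Pm [measurable]: "P \<in> borel_measurable borel" and B: "\<And>w. norm (P w) \<le> B"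
  shows "(\<lambda>n. sqnorm (\<lambda>w. P w ** Gs n w)) \<longlonglongrightarrow> sqnorm (\<lambda>w. P w ** G w)"
proof -
  have B0: "B \<ge> 0" using B[of 0] norm_ge_zero order_trans by blast
  \<comment> \<open>The cardinality bounds a trace by the norm; one factor \<open>B\<close> stands
    for \<open>P\<close> and one for \<open>adjm P\<close>.\<close>
  define c where "c = real CARD('d) * (B * B)"
  define q where "q n = (\<Sum>i\<in>UNIV. \<Sum>j\<in>UNIV. \<integral>w. cmod (Qs n w $ i $ j - Q w $ i $ j) \<partial>T_meas)" for n
  have qi: "integrable T_meas (\<lambda>w. cmod (Qs n w $ i $ j - Q w $ i $ j))" for n i j
    using Qint Qsint by auto
  have expand: "(norm (P w ** X))\<^sup>2 = (\<Sum>i\<in>UNIV. Re ((P w ** (X ** adjm X) ** adjm (P w)) $ i $ i))" for w X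
  proof -
    have "(P w ** X) ** adjm (P w ** X) = P w ** (X ** adjm X) ** adjm (P w)"
      by (simp add: adjm_mult matrix_mul_assoc)
    then show ?thesis using trace_mult_adjm[of "P w ** X"] by simp
  qed
  have bound: "\<bar>sqnorm (\<lambda>w. P w ** Gs n w) - sqnorm (\<lambda>w. P w ** G w)\<bar> \<le> c * q n" for n
  proof -
    note L1 = L2T_bounded_mult(1)[OF Pm B L2Ts[of n]] and L2 = L2T_bounded_mult(1)[OF Pm B L2T]
    have i1: "integrable T_meas (\<lambda>w. (norm (P w ** Gs n w))\<^sup>2)" "integrable T_meas (\<lambda>w. (norm (P w ** G w))\<^sup>2)"
      using L1 L2 by (auto simp: L2T_def)
    have "\<bar>sqnorm (\<lambda>w. P w ** Gs n w) - sqnorm (\<lambda>w. P w ** G w)\<bar>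
        = \<bar>\<integral>w. (norm (P w ** Gs n w))\<^sup>2 - (norm (P w ** G w))\<^sup>2 \<partial>T_meas\<bar>"
      using i1 by (simp add: sqnorm_def)
    also have "\<dots> \<le> (\<integral>w. \<bar>(norm (P w ** Gs n w))\<^sup>2 - (norm (P w ** G w))\<^sup>2\<bar> \<partial>T_meas)"
      by (rule integral_abs_bound)
    also have "\<dots> \<le> (\<integral>w. c * (\<Sum>i\<in>UNIV. \<Sum>j\<in>UNIV. cmod (Qs n w $ i $ j - Q w $ i $ j)) \<partial>T_meas)"
    proof (rule integral_mono_AE)
      show "integrable T_meas (\<lambda>w. \<bar>(norm (P w ** Gs n w))\<^sup>2 - (norm (P w ** G w))\<^sup>2\<bar>)" using i1 by auto
      show "integrable T_meas (\<lambda>w. c * (\<Sum>i\<in>UNIV. \<Sum>j\<in>UNIV. cmod (Qs n w $ i $ j - Q w $ i $ j)))"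
        using qi by auto
      show "AE w in T_meas. \<bar>(norm (P w ** Gs n w))\<^sup>2 - (norm (P w ** G w))\<^sup>2\<bar>
          \<le> c * (\<Sum>i\<in>UNIV. \<Sum>j\<in>UNIV. cmod (Qs n w $ i $ j - Q w $ i $ j))"
        using Q Qs[of n]
      proof eventually_elim
        case (elim w)
        let ?M = "P w ** (Qs n w - Q w) ** adjm (P w)"
        have "(norm (P w ** Gs n w))\<^sup>2 - (norm (P w ** G w))\<^sup>2 = (\<Sum>i\<in>UNIV. Re (?M $ i $ i))"
          unfolding expand elim[symmetric]
          by (simp add: sum_subtractf matrix_mult.diff_left matrix_mult.diff_right)
        also have "\<bar>\<dots>\<bar> \<le> (\<Sum>i\<in>(UNIV::'d set). norm ?M)"
          by (rule order_trans[OF sum_abs sum_mono]) (use abs_Re_le_cmod norm_entry_le order_trans in blast)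
        also have "\<dots> = CARD('d) * norm ?M" by simp
        also have "norm ?M \<le> (B * norm (Qs n w - Q w)) * B"
        proof -
          have "norm (P w ** (Qs n w - Q w)) \<le> B * norm (Qs n w - Q w)"
            using norm_matrix_mult_le[of "P w" "Qs n w - Q w"] mult_right_mono[OF B[of w], of "norm (Qs n w - Q w)"] by simp
          then show ?thesis
            using norm_matrix_mult_le[of "P w ** (Qs n w - Q w)" "adjm (P w)"] B[of w] B0
            by (smt (verit) norm_adjm mult_mono mult_nonneg_nonneg norm_ge_zero)
        qed
        also have "CARD('d) * ((B * norm (Qs n w - Q w)) * B) = c * norm (Qs n w - Q w)"
          by (simp add: c_def)
        also have "\<dots> \<le> c * (\<Sum>i\<in>UNIV. \<Sum>j\<in>UNIV. cmod (Qs n w $ i $ j - Q w $ i $ j))"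
          using norm_matrix_le_sum[of "Qs n w - Q w"] B0 by (intro mult_left_mono) (auto simp: c_def)
        finally show ?case by simp
      qed
    qed
    also have "\<dots> = c * q n"
      unfolding q_def using qi by (simp add: Bochner_Integration.integral_sum)
    finally show ?thesis .
  qed
  have "(\<lambda>n. c * q n) \<longlonglongrightarrow> c * (\<Sum>i\<in>(UNIV::'d set). \<Sum>j\<in>(UNIV::'d set). 0)"
    unfolding q_def by (intro tendsto_intros Qconv)
  then have "(\<lambda>n. c * q n) \<longlonglongrightarrow> 0" by simp
  then have "(\<lambda>n. sqnorm (\<lambda>w. P w ** Gs n w) - sqnorm (\<lambda>w. P w ** G w)) \<longlonglongrightarrow> 0"
    by (rule Lim_null_comparison[rotated]) (use bound in auto)
  then show ?thesis by (simp add: LIM_zero_iff)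
qed

lemma sqnorm_tendsto: "(\<lambda>n. sqnorm (Gs n)) \<longlonglongrightarrow> sqnorm G"
  using sqnorm_mult_tendsto[of "\<lambda>_. mat 1" "norm (mat 1 :: complex^'d^'d)"] by simp

lemma sqnorm_bounded: obtains K where "\<And>n. sqnorm (Gs n) \<le> K"
proof -
  have "Bseq (\<lambda>n. sqnorm (Gs n))" using sqnorm_tendsto by (rule convergent_imp_Bseq[OF convergentI])
  then show ?thesis using that by (auto simp: Bseq_def abs_le_iff)
qed

lemma mean_mult:
  fixes P X :: "complex \<Rightarrow> complex^'d^'d"
  assumes X: "\<And>i j. H2 (\<lambda>w. X w $ i $ j)"
    and P: "P \<in> borel_measurable borel" "\<And>w. norm (P w) \<le> B"
    and mean: "\<And>i j g. H2 g \<Longrightarrow> (\<integral>w. P w $ i $ j * g w \<partial>T_meas) = C $ i $ j * (\<integral>w. g w \<partial>T_meas)"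
  shows "mat_ext (\<lambda>w. P w ** X w) 0 = C ** mat_ext X 0"
proof -
  have [measurable]: "P \<in> borel_measurable borel" by fact
  have i: "integrable T_meas (\<lambda>w. P w $ i $ k * X w $ k $ j)" for i j k
  proof (rule Bochner_Integration.integrable_bound)
    have Xi: "integrable T_meas (\<lambda>w. X w $ k $ j)" by (rule L2T_integrable[OF H2_L2T[OF X]])
    then show "integrable T_meas (\<lambda>w. B * cmod (X w $ k $ j))" by auto
    show "(\<lambda>w. P w $ i $ k * X w $ k $ j) \<in> borel_measurable T_meas"
      using borel_measurable_integrable[OF Xi] by simp
    show "AE w in T_meas. norm (P w $ i $ k * X w $ k $ j) \<le> norm (B * cmod (X w $ k $ j))"
    proof (rule AE_I2)
      fix w
      have "cmod (P w $ i $ k) \<le> B" using norm_entry_le[of "P w" i k] P(2)[of w] by simp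
      then show "norm (P w $ i $ k * X w $ k $ j) \<le> norm (B * cmod (X w $ k $ j))"
        by (auto simp: norm_mult abs_mult intro!: mult_right_mono)
    qed
  qed
  have "(\<integral>w. (P w ** X w) $ i $ j \<partial>T_meas) = (\<Sum>k\<in>UNIV. C $ i $ k * (\<integral>w. X w $ k $ j \<partial>T_meas))" for i j
    using i by (simp add: matrix_matrix_mult_def Bochner_Integration.integral_sum mean[OF X])
  then show ?thesis
    by (simp add: mat_ext_def vec_eq_iff cauchy_ext_0 matrix_matrix_mult_def sum_divide_distrib)
qed

text \<open>The functions \<open>P\<close> disappear here: from each one only the constant
  \<open>C\<close> is kept, with \<open>C ** A\<close> close to the identity and
  \<open>C ** B\<close> of squared norm at most about \<open>CARD('d)\<close>. In the limit
  \<open>C\<close> is replaced by the inverse \<open>R\<close> of \<open>A\<close>, and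
  \<open>R ** B\<close> turns out to be unitary.\<close>

lemma subsequence_limit_eq:
  assumes s: "strict_mono s" and lim: "(\<lambda>n. mat_ext (Gs (s n)) 0) \<longlonglongrightarrow> B"
  shows "B = mat_ext G 0"
proof -
  define A where "A = mat_ext G 0"
  have detA: "det A \<noteq> 0" using pd(1) by (simp add: A_def pos_def_imp_det_nz)
  then have "invertible A" by (simp add: invertible_det_nz)
  then obtain R where R: "A ** R = mat 1" "R ** A = mat 1" by (auto simp: invertible_def)
  have herm: "adjm B = B"
  proof -
    have "(\<lambda>n. adjm (mat_ext (Gs (s n)) 0)) \<longlonglongrightarrow> adjm B"
      by (rule bounded_linear.tendsto[OF bounded_linear_adjm lim])
    moreover have "adjm (mat_ext (Gs (s n)) 0) = mat_ext (Gs (s n)) 0" for n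
      using pd(2) by (simp add: pos_def_iff)
    ultimately show ?thesis using lim LIMSEQ_unique by simp
  qed
  have psd: "qform B x \<ge> 0" for x
  proof -
    have "(\<lambda>n. qform (mat_ext (Gs (s n)) 0) x) \<longlonglongrightarrow> qform B x"
      by (rule continuous_on_tendsto_compose[OF continuous_on_qform[of UNIV x] lim]) auto
    moreover have "qform (mat_ext (Gs (s n)) 0) x \<ge> 0" for n
      using pd(2)[of "s n"] by (cases "x = 0") (auto simp: pos_def_iff less_imp_le)
    ultimately show ?thesis by (intro LIMSEQ_le_const) auto
  qed
  have detB: "cmod (det B) = cmod (det A)"
  proof -
    have "(\<lambda>n. cmod (det (mat_ext (Gs (s n)) 0))) \<longlonglongrightarrow> cmod (det B)"
      by (rule continuous_on_tendsto_compose[OF continuous_on_norm[OF continuous_on_det[of UNIV]] lim]) auto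
    moreover have "(\<lambda>n. cmod (det (mat_ext (Gs (s n)) 0))) \<longlonglongrightarrow> cmod (det A)"
      using LIMSEQ_subseq_LIMSEQ[OF detconv s] by (simp add: o_def A_def)
    ultimately show ?thesis by (rule LIMSEQ_unique)
  qed
  define d where "d = real CARD('d)"
  \<comment> \<open>One null sequence serves as accuracy and as weight in \<open>young\<close>. The
    error is required to be \<open>(h k)\<^sup>2\<close> so that
    \<open>(1 + 1 / h k) * (h k)\<^sup>2 = (h k)\<^sup>2 + h k\<close> still tends to 0.\<close>
  define h where "h k = 1 / (real k + 1)" for k
  have h0: "h k > 0" for k by (simp add: h_def)
  have "\<exists>C :: complex^'d^'d. 2 * pi * (norm (C ** A - mat 1))\<^sup>2 \<le> (h k)\<^sup>2 \<and>
      2 * pi * (norm (C ** B))\<^sup>2 \<le> (1 + h k) * (2 * pi * d) + (h k)\<^sup>2 + h k" for k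
  proof -
    obtain P :: "complex \<Rightarrow> complex^'d^'d" and C Bd where P: "P \<in> borel_measurable borel" "\<And>w. norm (P w) \<le> Bd"
      and mean: "\<And>i j g. H2 g \<Longrightarrow> (\<integral>w. P w $ i $ j * g w \<partial>T_meas) = C $ i $ j * (\<integral>w. g w \<partial>T_meas)"
      and e: "sqnorm (\<lambda>w. P w ** G w - mat 1) < (h k)\<^sup>2"
      by (rule approx_inverse[OF zero_less_power[OF h0[of k], of 2]]) (rule that)
    note LP = L2T_bounded_mult(1)[OF P L2T] and LPs = L2T_bounded_mult(1)[OF P L2Ts]
    have LP1: "L2T (\<lambda>w. P w ** G w - mat 1)" by (rule L2T_diff[OF LP L2T_const])
    have "2 * pi * (norm (C ** A - mat 1))\<^sup>2 \<le> sqnorm (\<lambda>w. P w ** G w - mat 1)"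
      using sqnorm_minus_const_split[OF LP, of "mat 1"] sqnorm_nonneg[of "\<lambda>w. P w ** G w - mat_ext (\<lambda>w. P w ** G w) 0"]
        mean_mult[OF H2 P mean] by (simp add: A_def)
    then have 1: "2 * pi * (norm (C ** A - mat 1))\<^sup>2 \<le> (h k)\<^sup>2" using e by simp
    let ?b = "\<lambda>w. (1 + h k) * (norm (mat 1 :: complex^'d^'d))\<^sup>2 + (1 + 1 / h k) * (norm (P w ** G w - mat 1))\<^sup>2"
    \<comment> \<open>With \<open>P\<close> fixed, \<open>n\<close> tends to infinity along
      \<open>s\<close> in the inequality between the mean and the norm of
      \<open>P ** Gs (s n)\<close>.\<close>
    have "2 * pi * (norm (C ** B))\<^sup>2 \<le> sqnorm (\<lambda>w. P w ** G w)"
    proof (rule LIMSEQ_le)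
      show "(\<lambda>n. 2 * pi * (norm (C ** mat_ext (Gs (s n)) 0))\<^sup>2) \<longlonglongrightarrow> 2 * pi * (norm (C ** B))\<^sup>2"
        by (intro tendsto_intros matrix_mult.tendsto lim)
      show "(\<lambda>n. sqnorm (\<lambda>w. P w ** Gs (s n) w)) \<longlonglongrightarrow> sqnorm (\<lambda>w. P w ** G w)"
        using LIMSEQ_subseq_LIMSEQ[OF sqnorm_mult_tendsto[OF P] s] by (simp add: o_def)
      show "\<exists>N. \<forall>n\<ge>N. 2 * pi * (norm (C ** mat_ext (Gs (s n)) 0))\<^sup>2 \<le> sqnorm (\<lambda>w. P w ** Gs (s n) w)"
        using mean_le_sqnorm[OF LPs] mean_mult[OF Gs P mean] by metis
    qed
    also have "sqnorm (\<lambda>w. P w ** G w) \<le> (\<integral>w. ?b w \<partial>T_meas)"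
      unfolding sqnorm_def
    proof (rule integral_mono)
      show "integrable T_meas (\<lambda>w. (norm (P w ** G w))\<^sup>2)" using LP by (simp add: L2T_def)
      show "integrable T_meas ?b"
        using LP1 by (simp add: L2T_def)
      fix w
      define x where "x = norm (mat 1 :: complex^'d^'d)"
      define y where "y = norm (P w ** G w - mat 1)"
      have "norm (P w ** G w) \<le> x + y"
        unfolding x_def y_def using norm_triangle_ineq[of "mat 1" "P w ** G w - mat 1"] by simp
      then have "(norm (P w ** G w))\<^sup>2 \<le> (x + y)\<^sup>2" by (intro power_mono) auto
      also have "\<dots> = x\<^sup>2 + y\<^sup>2 + 2 * (x * y)" by (simp add: power2_sum)
      also have "\<dots> \<le> (1 + h k) * x\<^sup>2 + (1 + 1 / h k) * y\<^sup>2"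
        using young[OF h0[of k], of x y] by (simp add: algebra_simps)
      finally show "(norm (P w ** G w))\<^sup>2 \<le> ?b w"
        by (simp add: x_def y_def)
    qed
    also have "\<dots> = (1 + h k) * (2 * pi * d) + (1 + 1 / h k) * sqnorm (\<lambda>w. P w ** G w - mat 1)"
      using LP1 by (simp add: L2T_def sqnorm_def measure_T_meas norm_mat_1_sq d_def)
    also have "\<dots> \<le> (1 + h k) * (2 * pi * d) + (1 + 1 / h k) * (h k)\<^sup>2"
      using e h0[of k] by (intro add_left_mono mult_left_mono) auto
    also have "\<dots> = (1 + h k) * (2 * pi * d) + (h k)\<^sup>2 + h k"
      using h0[of k] by (simp add: field_simps power2_eq_square)
    finally show ?thesis using 1 by blast
  qed
  then obtain C where C: "\<And>k. 2 * pi * (norm (C k ** A - mat 1))\<^sup>2 \<le> (h k)\<^sup>2"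
      "\<And>k. 2 * pi * (norm (C k ** B))\<^sup>2 \<le> (1 + h k) * (2 * pi * d) + (h k)\<^sup>2 + h k"
    by metis
  have h_lim: "h \<longlonglongrightarrow> 0" unfolding h_def by real_asymp
  have "(\<lambda>k. C k ** A - mat 1) \<longlonglongrightarrow> 0"
  proof (rule Lim_null_comparison[OF _ h_lim])
    have "norm (C k ** A - mat 1) \<le> h k" for k
    proof (rule power2_le_imp_le)
      have "(norm (C k ** A - mat 1))\<^sup>2 * 1 \<le> (norm (C k ** A - mat 1))\<^sup>2 * (2 * pi)"
        using pi_gt3 by (intro mult_left_mono) auto
      then show "(norm (C k ** A - mat 1))\<^sup>2 \<le> (h k)\<^sup>2" using C(1)[of k] by (simp add: mult.commute)
    qed (use h0[of k] in simp)
    then show "\<forall>\<^sub>F k in sequentially. norm (C k ** A - mat 1) \<le> h k" by simp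
  qed
  then have "(\<lambda>k. C k ** A) \<longlonglongrightarrow> mat 1" by (simp add: LIM_zero_iff)
  \<comment> \<open>Inserting \<open>A ** R = mat 1\<close> transfers the convergence of
    \<open>C k ** A\<close> to \<open>C k ** B\<close>.\<close>
  then have "(\<lambda>k. (C k ** A) ** (R ** B)) \<longlonglongrightarrow> mat 1 ** (R ** B)"
    by (intro matrix_mult.tendsto tendsto_const)
  moreover have "(C k ** A) ** (R ** B) = C k ** B" for k
    by (metis R(1) matrix_mul_assoc matrix_mul_lid)
  ultimately have CB: "(\<lambda>k. C k ** B) \<longlonglongrightarrow> R ** B" by simp
  have "2 * pi * (norm (R ** B))\<^sup>2 \<le> (1 + 0) * (2 * pi * d) + 0\<^sup>2 + 0"
  proof (rule LIMSEQ_le)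
    show "(\<lambda>k. 2 * pi * (norm (C k ** B))\<^sup>2) \<longlonglongrightarrow> 2 * pi * (norm (R ** B))\<^sup>2"
      by (intro tendsto_intros CB)
    show "(\<lambda>k. (1 + h k) * (2 * pi * d) + (h k)\<^sup>2 + h k) \<longlonglongrightarrow> (1 + 0) * (2 * pi * d) + 0\<^sup>2 + 0"
      by (intro tendsto_intros h_lim)
  qed (use C(2) in auto)
  then have "(norm (R ** B))\<^sup>2 \<le> CARD('d)" by (simp add: d_def)
  moreover have "cmod (det (R ** B)) = 1"
  proof -
    have "det R * det A = 1" using R(2) by (metis det_I det_mul)
    then have "cmod (det R) * cmod (det A) = 1" by (metis norm_mult norm_one)
    then show ?thesis by (simp add: det_mul norm_mult detB)
  qed
  ultimately have U: "(R ** B) ** adjm (R ** B) = mat 1" by (rule unitary_if_det_1_norm_le)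
  have AB: "A ** (R ** B) = B" by (metis R(1) matrix_mul_assoc matrix_mul_lid)
  have hermA: "adjm A = A" using pd(1) by (simp add: A_def pos_def_iff)
  have "B ** B = B ** adjm B" by (simp add: herm)
  also have "\<dots> = (A ** (R ** B)) ** adjm (A ** (R ** B))" by (simp only: AB)
  also have "\<dots> = A ** ((R ** B) ** adjm (R ** B)) ** adjm A"
    by (subst adjm_mult[of A]) (simp only: matrix_mul_assoc)
  also have "\<dots> = A ** A" by (simp add: U hermA)
  finally have "B ** B = A ** A" .
  then have "B = A" by (rule pos_def_sqrt_unique[OF pd(1)[folded A_def] herm psd])
  then show ?thesis by (simp add: A_def)
qed

lemma mean_tendsto: "(\<lambda>n. mat_ext (Gs n) 0) \<longlonglongrightarrow> mat_ext G 0"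
proof -
  obtain K where K: "\<And>n. sqnorm (Gs n) \<le> K" using sqnorm_bounded by blast
  show ?thesis
  proof (rule tendsto_unique_subseq_limit)
    fix n
    have "(norm (mat_ext (Gs n) 0))\<^sup>2 \<le> K / (2 * pi)"
      using mean_le_sqnorm[OF L2Ts[of n]] K[of n] by (simp add: field_simps)
    then show "norm (mat_ext (Gs n) 0) \<le> sqrt (K / (2 * pi))" by (rule real_le_rsqrt)
  next
    fix s B assume "strict_mono s" "((\<lambda>n. mat_ext (Gs n) 0) \<circ> s) \<longlonglongrightarrow> B"
    then show "B = mat_ext G 0" by (intro subsequence_limit_eq) (auto simp: o_def)
  qed
qed

definition Dif :: "nat \<Rightarrow> complex \<Rightarrow> complex^'d^'d" where
  "Dif n w = Gs n w - G w"

lemma L2T_Dif: "L2T (Dif n)"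
  unfolding Dif_def using L2T_diff(1)[OF L2Ts L2T] .

lemma measurable_Dif [measurable]: "Dif n \<in> borel_measurable borel"
  by (rule L2T_measurable[OF L2T_Dif])

lemma sqnorm_Dif_bounded: obtains K where "\<And>n. sqnorm (Dif n) \<le> K"
proof -
  obtain K where K: "\<And>n. sqnorm (Gs n) \<le> K" using sqnorm_bounded by blast
  have "sqnorm (Dif n) \<le> 2 * K + 2 * sqnorm G" for n
    using L2T_diff(2)[OF L2Ts[of n] L2T] K[of n] by (simp add: Dif_def[abs_def])
  then show thesis by (rule that)
qed

text \<open>The distance of \<open>P ** Gs n\<close> from its mean is a difference of two convergent
  quantities, so it tends to that of \<open>P ** G\<close>, which is below \<open>e\<close>; the
  means converge as well. Applying the squared triangle inequality twice gives a bound whose limit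
  is below \<open>6 * e\<close>, so the constant 7 is not sharp.\<close>

lemma eventually_sqnormorm_mult_Dif:
  fixes P :: "complex \<Rightarrow> complex^'d^'d"
  assumes P: "P \<in> borel_measurable borel" "\<And>w. norm (P w) \<le> Bd"
    and mean: "\<And>i j g. H2 g \<Longrightarrow> (\<integral>w. P w $ i $ j * g w \<partial>T_meas) = C $ i $ j * (\<integral>w. g w \<partial>T_meas)"
    and e: "sqnorm (\<lambda>w. P w ** G w - mat 1) < e"
  shows "\<forall>\<^sub>F n in sequentially. sqnorm (\<lambda>w. P w ** Dif n w) < 7 * e"
proof -
  define A where "A = mat_ext G 0"
  define As where "As n = mat_ext (Gs n) 0" for n
  have As: "As \<longlonglongrightarrow> A" unfolding As_def A_def by (rule mean_tendsto)
  note LP = L2T_bounded_mult(1)[OF P L2T] and LPs = L2T_bounded_mult(1)[OF P L2Ts]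
  have m: "mat_ext (\<lambda>w. P w ** G w) 0 = C ** A" "mat_ext (\<lambda>w. P w ** Gs n w) 0 = C ** As n" for n
    unfolding A_def As_def using mean_mult[OF H2 P mean] mean_mult[OF Gs P mean] by auto
  have e0: "sqnorm (\<lambda>w. P w ** G w - C ** A) < e"
  proof -
    have "0 \<le> 2 * pi * (norm (C ** A - mat 1))\<^sup>2" by simp
    then show ?thesis using sqnorm_minus_const_split[OF LP, of "mat 1"] e unfolding m by linarith
  qed
  let ?u = "\<lambda>n. 2 * sqnorm (\<lambda>w. P w ** Gs n w - C ** As n) + 2 * (2 * (2 * pi * (norm (C ** As n - C ** A))\<^sup>2) + 2 * sqnorm (\<lambda>w. P w ** G w - C ** A))"
    and ?l = "2 * sqnorm (\<lambda>w. P w ** G w - C ** A) + 2 * (2 * (2 * pi * (norm (C ** A - C ** A))\<^sup>2) + 2 * sqnorm (\<lambda>w. P w ** G w - C ** A))"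
  have "(\<lambda>n. sqnorm (\<lambda>w. P w ** Gs n w) - 2 * pi * (norm (C ** As n))\<^sup>2) \<longlonglongrightarrow> sqnorm (\<lambda>w. P w ** G w) - 2 * pi * (norm (C ** A))\<^sup>2"
    by (intro tendsto_intros sqnorm_mult_tendsto[OF P] matrix_mult.tendsto As)
  then have "(\<lambda>n. sqnorm (\<lambda>w. P w ** Gs n w - C ** As n)) \<longlonglongrightarrow> sqnorm (\<lambda>w. P w ** G w - C ** A)"
    using sqnorm_minus_mean[OF LP] sqnorm_minus_mean[OF LPs] by (simp add: m)
  then have "?u
     \<longlonglongrightarrow> ?l"
    by (intro tendsto_intros matrix_mult.tendsto As)
  moreover have "?l < 7 * e"
    using e0 sqnorm_nonneg[of "\<lambda>w. P w ** G w - C ** A"] by simp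
  ultimately have "\<forall>\<^sub>F n in sequentially. ?u n < 7 * e"
    by (rule order_tendstoD(2))
  then show ?thesis
  proof eventually_elim
    case (elim n)
    have L1: "L2T (\<lambda>w. P w ** Gs n w - C ** As n)" by (rule L2T_diff[OF LPs L2T_const])
    have L2: "L2T (\<lambda>w. P w ** G w - C ** A)" by (rule L2T_diff[OF LP L2T_const])
    have L3: "L2T (\<lambda>w. (C ** As n - C ** A) - (P w ** G w - C ** A))" by (rule L2T_diff[OF L2T_const L2])
    have "sqnorm (\<lambda>w. P w ** Dif n w) = sqnorm (\<lambda>w. (P w ** Gs n w - C ** As n) + ((C ** As n - C ** A) - (P w ** G w - C ** A)))"
      by (simp add: Dif_def matrix_mult.diff_right)
    also have "\<dots> \<le> ?u n"
      using L2T_add(2)[OF L1 L3] L2T_diff(2)[OF L2T_const L2, of "C ** As n - C ** A"] by (simp add: sqnorm_const)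
    finally show ?case using elim by simp
  qed
qed

text \<open>Where \<open>G\<close> and, through the cofactors, its inverse are bounded by constants
  depending on \<open>m\<close>; the summand 1 keeps the thresholds positive for
  \<open>m = 0\<close>.\<close>

definition good :: "nat \<Rightarrow> complex set" where
  "good m = {w. norm (G w) \<le> real m + 1 \<and> cmod (det (G w)) \<ge> 1 / (real m + 1)}"

abbreviation good_part :: "nat \<Rightarrow> nat \<Rightarrow> real" where
  "good_part m n \<equiv> (\<integral>w. indicator (good m) w * \<bar>G w \<bullet> Dif n w\<bar> \<partial>T_meas)"

abbreviation bad_part :: "nat \<Rightarrow> real" where
  "bad_part m \<equiv> (\<integral>w. indicator (- good m) w * (norm (G w))\<^sup>2 \<partial>T_meas)"

lemma sets_good [measurable]: "good m \<in> sets borel"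
  unfolding good_def by measurable

lemma integrable_inner_Dif: "integrable T_meas (\<lambda>w. G w \<bullet> Dif n w)"
  by (rule Bochner_Integration.integrable_bound[OF integrable_L2T_mult[OF L2T L2T_Dif[of n]]])
     (auto intro!: borel_measurable_inner simp: Cauchy_Schwarz_ineq2)

lemma good_inverse:
  assumes "w \<in> good m"
  obtains R :: "complex^'d^'d" where "R ** G w = mat 1"
    "norm R \<le> CARD('d) * (fact CARD('d) * (real m + 1) ^ CARD('d) * (real m + 1))"
proof -
  define R where "R = (\<chi> i j. cofactor_matrix (G w) $ i $ j / det (G w))"
  have g: "norm (G w) \<le> real m + 1" "cmod (det (G w)) \<ge> 1 / (real m + 1)" using assms by (auto simp: good_def)
  have "1 / (real m + 1) > 0" by simp
  then have pos: "cmod (det (G w)) > 0" using g(2) by linarith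
  have "(R ** G w) $ i $ j = (cofactor_matrix (G w) ** G w) $ i $ j / det (G w)" for i j
    by (simp add: R_def matrix_matrix_mult_def sum_divide_distrib)
  then have "R ** G w = mat 1" using pos by (simp add: cofactor_matrix_mult vec_eq_iff mat_def)
  moreover have "norm R \<le> CARD('d) * (fact CARD('d) * (real m + 1) ^ CARD('d) * (real m + 1))"
  proof (rule norm_matrix_le)
    fix i j
    have "cmod (R $ i $ j) = cmod (cofactor_matrix (G w) $ i $ j) * (1 / cmod (det (G w)))"
      by (simp add: R_def norm_divide)
    also have "\<dots> \<le> (fact CARD('d) * (real m + 1) ^ CARD('d)) * (real m + 1)"
    proof (intro mult_mono cofactor_matrix_bound)
      show "1 / cmod (det (G w)) \<le> real m + 1" using g(2) pos by (simp add: field_simps)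
    qed (use g in auto)
    finally show "cmod (R $ i $ j) \<le> fact CARD('d) * (real m + 1) ^ CARD('d) * (real m + 1)" .
  qed
  ultimately show thesis using that by blast
qed

text \<open>With \<open>R\<close> the inverse of \<open>g\<close>, the identity
  \<open>D = g ** (p ** D) - g ** ((p ** g - mat 1) ** (R ** D))\<close> is exact. The size of
  \<open>P\<close> does not appear, only \<open>P ** Dif n\<close> and
  \<open>P ** G - mat 1\<close>, both of which are small. One factor \<open>real m + 1\<close> comes
  from this identity, the other from pairing with \<open>G\<close>.\<close>

lemma inner_Dif_good_bound:
  fixes P :: "complex \<Rightarrow> complex^'d^'d"
  assumes w: "w \<in> good m"
  defines "\<kappa> \<equiv> CARD('d) * (fact CARD('d) * (real m + 1) ^ CARD('d) * (real m + 1))"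
  shows "\<bar>G w \<bullet> Dif n w\<bar> \<le> (real m + 1)\<^sup>2 * norm (P w ** Dif n w) + (real m + 1)\<^sup>2 * \<kappa> * (norm (P w ** G w - mat 1) * norm (Dif n w))"
proof -
  define g where "g = G w"
  define D where "D = Dif n w"
  define p where "p = P w"
  define M where "M = real m + 1"
  obtain R where R: "R ** g = mat 1" "norm R \<le> \<kappa>" using good_inverse[OF w] unfolding g_def \<kappa>_def by blast
  have R': "g ** R = mat 1" using R(1) by (simp add: matrix_left_right_inverse)
  have gM: "norm g \<le> M" using w by (simp add: g_def M_def good_def)
  have M0: "M > 0" by (simp add: M_def)
  have k0: "\<kappa> \<ge> 0" using R(2) norm_ge_zero order_trans by blast
  have "g ** ((p ** g - mat 1) ** (R ** D)) = (g ** p) ** ((g ** R) ** D) - (g ** R) ** D"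
    by (simp add: matrix_mult.diff_left matrix_mult.diff_right matrix_mul_assoc)
  then have D: "D = g ** (p ** D) - g ** ((p ** g - mat 1) ** (R ** D))"
    by (simp add: R' matrix_mul_assoc)
  have n1: "norm (g ** (p ** D)) \<le> M * norm (p ** D)"
    using norm_matrix_mult_le[of g "p ** D"] mult_right_mono[OF gM, of "norm (p ** D)"] by simp
  have n2: "norm (g ** ((p ** g - mat 1) ** (R ** D))) \<le> M * (norm (p ** g - mat 1) * (\<kappa> * norm D))"
  proof -
    have a: "norm (R ** D) \<le> \<kappa> * norm D"
      using norm_matrix_mult_le[of R D] mult_right_mono[OF R(2), of "norm D"] by simp
    have b: "norm ((p ** g - mat 1) ** (R ** D)) \<le> norm (p ** g - mat 1) * (\<kappa> * norm D)"
      using norm_matrix_mult_le[of "p ** g - mat 1" "R ** D"] mult_left_mono[OF a, of "norm (p ** g - mat 1)"] by simp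
    show ?thesis
      using norm_matrix_mult_le[of g "(p ** g - mat 1) ** (R ** D)"] mult_mono[OF gM b] M0 by simp
  qed
  have "norm D \<le> M * norm (p ** D) + M * (norm (p ** g - mat 1) * (\<kappa> * norm D))"
    by (subst D) (use norm_triangle_ineq4 n1 n2 add_mono order_trans in blast)
  then have "norm g * norm D \<le> M * (M * norm (p ** D) + M * (norm (p ** g - mat 1) * (\<kappa> * norm D)))"
    using gM M0 by (intro mult_mono) auto
  moreover have "\<bar>g \<bullet> D\<bar> \<le> norm g * norm D" by (rule Cauchy_Schwarz_ineq2)
  ultimately show ?thesis
    by (simp add: g_def D_def p_def M_def power2_eq_square algebra_simps)
qed

lemma inner_Dif_good_tendsto:
  "(\<lambda>n. good_part m n) \<longlonglongrightarrow> 0"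
proof (rule LIMSEQ_I)
  let ?M = "(real m + 1)\<^sup>2"
  fix e :: real assume e: "e > 0"
  obtain K' where K': "\<And>n. sqnorm (Dif n) \<le> K'" using sqnorm_Dif_bounded by blast
  define \<kappa> where "\<kappa> = CARD('d) * (fact CARD('d) * (real m + 1) ^ CARD('d) * (real m + 1))"
  have \<kappa>: "\<kappa> \<ge> 0" by (simp add: \<kappa>_def)
  have K'0: "K' \<ge> 0" using K'[of 0] sqnorm_nonneg[of "Dif 0"] by linarith
  \<comment> \<open>Collects the constants so that the final bound is \<open>c * s\<close>. The
    first half is Young with weight \<open>s\<close>, where the constant 1 has squared norm
    \<open>2 * pi\<close> and \<open>P ** Dif n\<close> less than \<open>7 * s\<^sup>2\<close>; the
    second is Young with weight \<open>1 / s\<close>, where \<open>K'\<close> bounds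
    \<open>sqnorm (Dif n)\<close>.\<close>
  define c where "c = ?M * ((2 * pi + 7) / 2) + ?M * \<kappa> * ((K' + 1) / 2)"
  have c0: "c \<ge> 0" unfolding c_def using \<kappa> K'0 by (intro add_nonneg_nonneg mult_nonneg_nonneg) auto
  define s where "s = e / (c + 1)"
  have s: "s > 0" using c0 e by (simp add: s_def)
  obtain P :: "complex \<Rightarrow> complex^'d^'d" and C Bd where P: "P \<in> borel_measurable borel" "\<And>w. norm (P w) \<le> Bd"
      and mean: "\<And>i j g. H2 g \<Longrightarrow> (\<integral>w. P w $ i $ j * g w \<partial>T_meas) = C $ i $ j * (\<integral>w. g w \<partial>T_meas)"
      and Pe: "sqnorm (\<lambda>w. P w ** G w - mat 1) < s\<^sup>2"
    by (rule approx_inverse[OF zero_less_power[OF s, of 2]]) (rule that)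
  have "\<forall>\<^sub>F n in sequentially. sqnorm (\<lambda>w. P w ** Dif n w) < 7 * s\<^sup>2"
    by (rule eventually_sqnormorm_mult_Dif[OF P mean Pe])
  then have "\<forall>\<^sub>F n in sequentially. norm (good_part m n - 0) < e"
  proof eventually_elim
    case (elim n)
    let ?f = "\<lambda>w. norm (1::real) * norm (P w ** Dif n w)" and ?h = "\<lambda>w. norm (P w ** G w - mat 1) * norm (Dif n w)"
    have LPD: "L2T (\<lambda>w. P w ** Dif n w)" by (rule L2T_bounded_mult(1)[OF P L2T_Dif])
    have LPG: "L2T (\<lambda>w. P w ** G w - mat 1)"
      by (rule L2T_diff[OF L2T_bounded_mult(1)[OF P L2T] L2T_const])
    have i1: "integrable T_meas (\<lambda>w. ?f w)"
      by (rule integrable_L2T_mult[OF L2T_const LPD])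
    have i2: "integrable T_meas (\<lambda>w. ?h w)"
      by (rule integrable_L2T_mult[OF LPG L2T_Dif])
    have "good_part m n
       \<le> (\<integral>w. ?M * ?f w + ?M * \<kappa> * ?h w \<partial>T_meas)"
    proof (rule integral_mono)
      show "integrable T_meas (\<lambda>w. indicator (good m) w * \<bar>G w \<bullet> Dif n w\<bar>)"
        by (rule Bochner_Integration.integrable_bound[OF integrable_inner_Dif[of n]])
           (auto simp: indicator_def intro!: borel_measurable_times borel_measurable_inner)
      show "integrable T_meas (\<lambda>w. ?M * ?f w + ?M * \<kappa> * ?h w)"
        by (intro Bochner_Integration.integrable_add integrable_mult_right i1 i2)
      show "indicator (good m) w * \<bar>G w \<bullet> Dif n w\<bar> \<le> ?M * ?f w + ?M * \<kappa> * ?h w" for w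
      proof (cases "w \<in> good m")
        case True
        then show ?thesis using inner_Dif_good_bound[OF True, of n P] by (simp add: \<kappa>_def)
      qed (use \<kappa> in simp)
    qed
    also have "\<dots> = ?M * (\<integral>w. ?f w \<partial>T_meas) + ?M * \<kappa> * (\<integral>w. ?h w \<partial>T_meas)"
      by (simp only: Bochner_Integration.integral_add[OF integrable_mult_right[OF i1] integrable_mult_right[OF i2]] integral_mult_right_zero)
    also have "\<dots> \<le> ?M * (s * ((2 * pi + 7) / 2)) + ?M * \<kappa> * (s * ((K' + 1) / 2))"
    proof (intro add_mono mult_left_mono)
      have "(\<integral>w. ?f w \<partial>T_meas) \<le> (s * sqnorm (\<lambda>_. 1::real) + sqnorm (\<lambda>w. P w ** Dif n w) / s) / 2"
        by (rule integral_mult_le_young[OF L2T_const LPD s])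
      also have "\<dots> \<le> (s * (2 * pi) + (7 * s\<^sup>2) / s) / 2"
        using elim s by (intro divide_right_mono add_mono) (auto simp: sqnorm_const)
      also have "\<dots> = s * ((2 * pi + 7) / 2)" using s by (simp add: power2_eq_square algebra_simps)
      finally show "(\<integral>w. ?f w \<partial>T_meas) \<le> s * ((2 * pi + 7) / 2)" .
      have "(\<integral>w. ?h w \<partial>T_meas) \<le> ((1 / s) * sqnorm (\<lambda>w. P w ** G w - mat 1) + sqnorm (Dif n) / (1 / s)) / 2"
        by (rule integral_mult_le_young[OF LPG L2T_Dif]) (use s in simp)
      also have "\<dots> \<le> ((1 / s) * s\<^sup>2 + K' / (1 / s)) / 2"
        using Pe s K'[of n] by (intro divide_right_mono add_mono mult_left_mono) (auto intro: mult_right_mono)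
      also have "\<dots> = s * ((K' + 1) / 2)" using s by (simp add: power2_eq_square algebra_simps)
      finally show "(\<integral>w. ?h w \<partial>T_meas) \<le> s * ((K' + 1) / 2)" .
    qed (use \<kappa> in auto)
    also have "\<dots> = c * s" by (simp add: c_def algebra_simps)
    also have "\<dots> < (c + 1) * s" using s by simp
    also have "\<dots> = e" using c0 by (simp add: s_def)
    finally show ?case by simp
  qed
  then show "\<exists>no. \<forall>n\<ge>no. norm (good_part m n - 0) < e"
    by (simp add: eventually_sequentially)
qed

text \<open>A point can stay outside all late good sets only if \<open>det (G w) = 0\<close>, which
  \<open>nz\<close> makes a null event; \<open>|G|^2\<close> dominates.\<close>

lemma bad_tendsto: "(\<lambda>m. bad_part m) \<longlonglongrightarrow> 0"
proof -
  have "(\<lambda>m. bad_part m) \<longlonglongrightarrow> (\<integral>w. 0 \<partial>T_meas)"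
  proof (rule integral_dominated_convergence[where w = "\<lambda>w. (norm (G w))\<^sup>2"])
    show "AE w in T_meas. (\<lambda>m. indicator (- good m) w * (norm (G w))\<^sup>2) \<longlonglongrightarrow> 0"
      using nz
    proof eventually_elim
      case (elim w)
      then have p: "cmod (det (G w)) > 0" by simp
      have "\<forall>\<^sub>F m in sequentially. norm (G w) - 1 \<le> real m"
        using filterlim_real_sequentially unfolding filterlim_at_top by blast
      moreover have "\<forall>\<^sub>F m in sequentially. 1 / (real m + 1) < cmod (det (G w))"
        by (rule order_tendstoD(2)[OF _ p]) real_asymp
      ultimately have "\<forall>\<^sub>F m in sequentially. indicator (- good m) w * (norm (G w))\<^sup>2 = 0"
        by eventually_elim (simp add: good_def)
      then show ?case by (rule tendsto_eventually)
    qed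
    show "(\<lambda>w. indicator (- good m) w * (norm (G w))\<^sup>2) \<in> borel_measurable T_meas" for m by simp
    show "AE w in T_meas. norm (indicator (- good m) w * (norm (G w))\<^sup>2) \<le> (norm (G w))\<^sup>2" for m
      by (auto simp: indicator_def)
  qed (use L2T in \<open>auto simp: L2T_def\<close>)
  then show ?thesis by simp
qed

text \<open>Since \<open>|Gs n|^2 = |G|^2 + 2 * (G \<bullet> Dif n) + |Dif n|^2\<close>, convergence
  of the norms reduces everything to a lower bound for the integral of
  \<open>G \<bullet> Dif n\<close>, taken separately on and off a good set.\<close>

lemma sqnorm_Dif_tendsto: "(\<lambda>n. sqnorm (Dif n)) \<longlonglongrightarrow> 0"
proof (rule LIMSEQ_I)
  fix e :: real assume e: "e > 0"
  obtain K' where K': "\<And>n. sqnorm (Dif n) \<le> K'" using sqnorm_Dif_bounded by blast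
  have K'0: "K' \<ge> 0" using K'[of 0] sqnorm_nonneg[of "Dif 0"] by linarith
  \<comment> \<open>The Young weight off the good set: \<open>t * sqnorm (Dif n)\<close> is at most
    \<open>e / 4\<close> for all \<open>n\<close>, and \<open>m\<close> is then chosen so that the
    companion term \<open>bad_part m / t\<close> is below \<open>e / 4\<close>.\<close>
  define t where "t = e / (4 * (K' + 1))"
  have t: "t > 0" using e K'0 by (simp add: t_def)
  have tK: "t * K' \<le> e / 4" using e K'0 by (simp add: t_def field_simps)
  have "\<forall>\<^sub>F m in sequentially. bad_part m < t * (e / 4)"
    by (rule order_tendstoD(2)[OF bad_tendsto]) (use t e in simp)
  then obtain m where m: "bad_part m < t * (e / 4)"
    by (auto simp: eventually_sequentially)
  have "(\<lambda>n. (sqnorm (Gs n) - sqnorm G) + 2 * good_part m n) \<longlonglongrightarrow> (sqnorm G - sqnorm G) + 2 * 0"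
    by (intro tendsto_intros sqnorm_tendsto inner_Dif_good_tendsto)
  then have "\<forall>\<^sub>F n in sequentially. (sqnorm (Gs n) - sqnorm G) + 2 * good_part m n < e / 2"
    by (rule order_tendstoD(2)) (use e in simp)
  then have "\<forall>\<^sub>F n in sequentially. norm (sqnorm (Dif n) - 0) < e"
  proof eventually_elim
    case (elim n)
    let ?k = "\<lambda>w. indicator (good m) w * \<bar>G w \<bullet> Dif n w\<bar> + ((indicator (- good m) w * (norm (G w))\<^sup>2) / t + t * (norm (Dif n w))\<^sup>2) / 2"
    have iD: "integrable T_meas (\<lambda>w. (norm (Dif n w))\<^sup>2)" using L2T_Dif by (simp add: L2T_def)
    have iG: "integrable T_meas (\<lambda>w. (norm (G w))\<^sup>2)" using L2T by (simp add: L2T_def)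
    have iI: "integrable T_meas (\<lambda>w. G w \<bullet> Dif n w)" by (rule integrable_inner_Dif)
    have iI': "integrable T_meas (\<lambda>w. indicator (good m) w * \<bar>G w \<bullet> Dif n w\<bar>)"
      by (rule Bochner_Integration.integrable_bound[OF iI])
         (auto simp: indicator_def intro!: borel_measurable_times borel_measurable_inner)
    have iB: "integrable T_meas (\<lambda>w. indicator (- good m) w * (norm (G w))\<^sup>2)"
      by (rule Bochner_Integration.integrable_bound[OF iG]) (auto simp: indicator_def)
    have "(norm (Gs n w))\<^sup>2 = (norm (G w))\<^sup>2 + 2 * (G w \<bullet> Dif n w) + (norm (Dif n w))\<^sup>2" for w
      unfolding power2_norm_eq_inner Dif_def by (simp add: inner_diff inner_commute)
    then have "sqnorm (Gs n) = sqnorm G + 2 * (\<integral>w. G w \<bullet> Dif n w \<partial>T_meas) + sqnorm (Dif n)"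
      unfolding sqnorm_def using iD iG iI by simp
    moreover have "- (\<integral>w. G w \<bullet> Dif n w \<partial>T_meas)
       \<le> (\<integral>w. ?k w \<partial>T_meas)"
      unfolding Bochner_Integration.integral_minus[symmetric]
    proof (rule integral_mono)
      show "integrable T_meas (\<lambda>w. - (G w \<bullet> Dif n w))" using iI by simp
      show "integrable T_meas ?k"
        using iI' iB iD by (intro Bochner_Integration.integrable_add integrable_divide_zero integrable_mult_right) auto
      fix w
      show "- (G w \<bullet> Dif n w) \<le> ?k w"
      proof (cases "w \<in> good m")
        case True
        have "0 \<le> t * (norm (Dif n w))\<^sup>2" using t by simp
        with True show ?thesis by (simp add: abs_if)
      next
        case False
        have "- (G w \<bullet> Dif n w) \<le> norm (Dif n w) * norm (G w)"
          using Cauchy_Schwarz_ineq2[of "G w" "Dif n w"] by (simp add: mult.commute)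
        also have "\<dots> \<le> (t * (norm (Dif n w))\<^sup>2 + (norm (G w))\<^sup>2 / t) / 2" by (rule young[OF t])
        finally show ?thesis using False by simp
      qed
    qed
    moreover have "(\<integral>w. ?k w \<partial>T_meas)
       = good_part m n + (bad_part m / t + t * sqnorm (Dif n)) / 2"
      unfolding sqnorm_def using iI' iB iD by simp
    moreover have "bad_part m / t < e / 4"
      using m t by (simp add: field_simps)
    moreover have "t * sqnorm (Dif n) \<le> e / 4"
      using mult_left_mono[OF K'[of n], of t] t tK by linarith
    ultimately have "sqnorm (Dif n) < e" using elim by argo
    then show ?case by (simp add: sqnorm_nonneg)
  qed
  then show "\<exists>no. \<forall>n\<ge>no. norm (sqnorm (Dif n) - 0) < e" by (simp add: eventually_sequentially)
qed

end

section \<open>The one-variable theorem in terms of spectral densities\<close>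

lemma memLp_1_iff: "memLp M 1 f \<longleftrightarrow> integrable M f"
  by (auto simp: memLp_def integrable_iff_bounded)

lemma Lp_conv_1_iff:
  "Lp_conv M 1 fs f \<longleftrightarrow> (\<forall>n. integrable M (fs n)) \<and> integrable M f \<and>
     (\<lambda>n. \<integral>\<^sup>+x. ennreal (cmod (fs n x - f x)) \<partial>M) \<longlonglongrightarrow> 0"
  by (simp add: Lp_conv_def memLp_1_iff)

text \<open>At \<open>z = 0\<close> the exponent in \<open>is_outer\<close> is the mean of
  \<open>ln |det G|\<close>; since \<open>det Q = |det G|^2\<close>, the factor
  \<open>1 / (2 * pi)\<close> is halved. This is how the logarithmic hypothesis becomes convergence
  of determinants at 0.\<close>

lemma outer_spectral_factor_det_0:
  fixes G Q :: "complex \<Rightarrow> complex^'d^'d"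
  assumes G: "outer_spectral_factor Q G" and Q: "\<And>i j. integrable T_meas (\<lambda>w. Q w $ i $ j)"
  shows "cmod (det (mat_ext G 0)) = exp ((1 / (4 * pi)) * (\<integral>w. ln (Re (det (Q w))) \<partial>T_meas))"
proof -
  interpret outer_matrix G
    using G by unfold_locales (auto simp: outer_spectral_factor_def)
  have eq: "AE w in T_meas. Q w = G w ** adjm (G w)" using G by (simp add: outer_spectral_factor_def)
  have [measurable]: "Q \<in> borel_measurable borel" "G \<in> borel_measurable borel"
    using Q[THEN borel_measurable_integrable] L2T_measurable[OF L2T]
    by (simp_all add: borel_measurable_matrix_iff)
  have "(\<integral>w. ln (Re (det (Q w))) \<partial>T_meas) = (\<integral>w. 2 * lndet w \<partial>T_meas)"
  proof (rule integral_cong_AE)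
    show "AE w in T_meas. ln (Re (det (Q w))) = 2 * lndet w"
      using eq
    proof eventually_elim
      case (elim w)
      have "Re (det (Q w)) = (cmod (det (G w)))\<^sup>2" unfolding elim det_mult_adjm by simp
      \<comment> \<open>When the determinant vanishes both sides are 0, by the convention for
        \<open>ln 0\<close>.\<close>
      then show ?case
        by (cases "det (G w) = 0") (simp_all add: lndet_def ln_realpow)
    qed
  qed (auto simp: lndet_def)
  moreover obtain c where "cmod c = 1" "det (mat_ext G 0) = c * exp (herglotz (\<lambda>w. of_real (lndet w)) 0)"
    using det_mat_ext by (metis norm_zero zero_less_one)
  ultimately show ?thesis
    by (simp add: norm_mult herglotz_0[OF integrable_lndet])
qed

text \<open>The conclusion is an integral with values in \<open>ennreal\<close> so that it can be
  integrated over the remaining variables.\<close>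

lemma outer_spectral_factor_continuous:
  fixes G Q :: "complex \<Rightarrow> complex^'d^'d"
  assumes Gs: "\<And>n. outer_spectral_factor (Qs n) (Gs n)" and G: "outer_spectral_factor Q G"
    and Q: "\<And>i j. Lp_conv T_meas 1 (\<lambda>n w. Qs n w $ i $ j) (\<lambda>w. Q w $ i $ j)"
    and pd: "AE w in T_meas. pos_def (Q w)"
    and ln: "(\<lambda>n. \<integral>w. ln (Re (det (Qs n w))) \<partial>T_meas) \<longlonglongrightarrow> (\<integral>w. ln (Re (det (Q w))) \<partial>T_meas)"
  shows "(\<lambda>n. \<integral>\<^sup>+w. ennreal ((norm (Gs n w - G w))\<^sup>2) \<partial>T_meas) \<longlonglongrightarrow> 0"
proof -
  have int: "integrable T_meas (\<lambda>w. Qs n w $ i $ j)" "integrable T_meas (\<lambda>w. Q w $ i $ j)" for n i j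
    using Q[of i j] by (auto simp: Lp_conv_1_iff)
  interpret outer_sequence G Gs Q Qs
  proof
    show "AE w in T_meas. det (G w) \<noteq> 0"
    proof -
      have "AE w in T_meas. Q w = G w ** adjm (G w)" using G by (simp add: outer_spectral_factor_def)
      with pd show ?thesis
      proof eventually_elim
        case (elim w)
        then show ?case using pos_def_imp_det_nz[of "Q w"] by (auto simp: det_mul)
      qed
    qed
    show "(\<lambda>n. cmod (det (mat_ext (Gs n) 0))) \<longlonglongrightarrow> cmod (det (mat_ext G 0))"
      unfolding outer_spectral_factor_det_0[OF Gs int(1)] outer_spectral_factor_det_0[OF G int(2)]
      by (intro tendsto_intros ln)
    fix i j
    have "(\<lambda>n. \<integral>\<^sup>+w. ennreal (cmod (Qs n w $ i $ j - Q w $ i $ j)) \<partial>T_meas) \<longlonglongrightarrow> 0"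
      using Q[of i j] by (simp add: Lp_conv_1_iff)
    moreover have "(\<integral>\<^sup>+w. ennreal (cmod (Qs n w $ i $ j - Q w $ i $ j)) \<partial>T_meas) = ennreal (\<integral>w. cmod (Qs n w $ i $ j - Q w $ i $ j) \<partial>T_meas)" for n
      using int by (intro nn_integral_eq_integral) auto
    ultimately show "(\<lambda>n. \<integral>w. cmod (Qs n w $ i $ j - Q w $ i $ j) \<partial>T_meas) \<longlonglongrightarrow> 0"
      by (simp add: tendsto_ennreal_iff[of _ _ 0, simplified])
  qed (use G Gs int in \<open>auto simp: outer_spectral_factor_def\<close>)
  have "(\<integral>\<^sup>+w. ennreal ((norm (Gs n w - G w))\<^sup>2) \<partial>T_meas) = ennreal (sqnorm (Dif n))" for n
    unfolding sqnorm_def Dif_def[symmetric]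
    by (rule nn_integral_eq_integral) (use L2T_Dif in \<open>auto simp: L2T_def\<close>)
  moreover have "(\<lambda>n. ennreal (sqnorm (Dif n))) \<longlonglongrightarrow> ennreal 0"
    by (rule tendsto_ennrealI[OF sqnorm_Dif_tendsto])
  ultimately show ?thesis by simp
qed

subsection \<open>Slices of the torus\<close>

interpretation T_prod: product_sigma_finite "\<lambda>_::nat. T_meas"
  by unfold_locales

lemma insert_0_lessThan: "m \<ge> 1 \<Longrightarrow> {..<m} = insert 0 {1..<m::nat}"
  by auto

lemma torus_nn_integral:
  assumes m: "m \<ge> 1" and f: "f \<in> borel_measurable (torus m)"
  shows "(\<integral>\<^sup>+x. f x \<partial>torus m) = (\<integral>\<^sup>+y. (\<integral>\<^sup>+t. f (y(0 := t)) \<partial>T_meas) \<partial>torus_on {1..<m})"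
  using f unfolding torus_on_def insert_0_lessThan[OF m]
  by (intro T_prod.product_nn_integral_insert) auto

lemma measurable_upd_0:
  assumes m: "m \<ge> 1"
  shows "(\<lambda>(y, t). y(0 := t)) \<in> torus_on {1..<m} \<Otimes>\<^sub>M T_meas \<rightarrow>\<^sub>M torus m"
  unfolding torus_on_def insert_0_lessThan[OF m] by (rule measurable_add_dim)

lemma measurable_slice_nn_integral:
  assumes m: "m \<ge> 1" and f: "f \<in> borel_measurable (torus m)"
  shows "(\<lambda>y. \<integral>\<^sup>+t. f (y(0 := t)) \<partial>T_meas) \<in> borel_measurable (torus_on {1..<m})"
proof (rule T.borel_measurable_nn_integral)
  show "(\<lambda>(y, t). f (y(0 := t))) \<in> borel_measurable (torus_on {1..<m} \<Otimes>\<^sub>M T_meas)"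
    using measurable_compose[OF measurable_upd_0[OF m] f] by (simp add: case_prod_beta)
qed

text \<open>Tonelli for the indicator of a null set containing the exceptions.\<close>

lemma AE_torus_slice:
  assumes m: "m \<ge> 1" and ae: "AE x in torus m. p x"
  shows "AE y in torus_on {1..<m}. AE t in T_meas. p (y(0 := t))"
proof -
  obtain A where A: "{x \<in> space (torus m). \<not> p x} \<subseteq> A" "A \<in> null_sets (torus m)"
    using AE_E[OF ae] by (metis null_setsI)
  have [measurable]: "A \<in> sets (torus m)" using A by auto
  have im: "indicator A \<in> borel_measurable (torus m)" by simp
  have "(\<integral>\<^sup>+y. (\<integral>\<^sup>+t. indicator A (y(0 := t)) \<partial>T_meas) \<partial>torus_on {1..<m}) = 0"
    using torus_nn_integral[OF m im] A by auto
  then have "AE y in torus_on {1..<m}. (\<integral>\<^sup>+t. indicator A (y(0 := t)) \<partial>T_meas) = 0"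
    by (subst (asm) nn_integral_0_iff_AE[OF measurable_slice_nn_integral[OF m im]])
  then show ?thesis
    using AE_space
  proof eventually_elim
    case (elim y)
    have mt: "(\<lambda>t. y(0 := t)) \<in> T_meas \<rightarrow>\<^sub>M torus m"
      using measurable_compose[OF measurable_Pair1'[OF elim(2)] measurable_upd_0[OF m]] by simp
    have "(\<lambda>t. indicator A (y(0 := t)) :: ennreal) \<in> borel_measurable T_meas"
      by (rule measurable_compose[OF mt im])
    then have "AE t in T_meas. indicator A (y(0 := t)) = (0::ennreal)"
      using elim(1) by (subst (asm) nn_integral_0_iff_AE)
    then show ?case
    proof eventually_elim
      case (elim t)
      have "y(0 := t) \<in> space (torus m)" using measurable_space[OF mt, of t] by simp
      with elim A(1) show ?case by (auto simp: indicator_def split: if_splits)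
    qed
  qed
qed

text \<open>The product is taken in the order \<open>J\<close>, \<open>I\<close> because
  \<open>AE_pair\<close> makes the first factor the outer variable.\<close>

lemma AE_torus_merge:
  assumes IJ: "I \<inter> J = {}" "finite I" "finite J" and ae: "AE x in torus_on (I \<union> J). p x"
  shows "AE y in torus_on J. AE x in torus_on I. p (merge I J (x, y))"
proof -
  interpret I: finite_product_sigma_finite "\<lambda>_. T_meas" I by standard fact
  interpret J: finite_product_sigma_finite "\<lambda>_. T_meas" J by standard fact
  interpret pair_sigma_finite "torus_on J" "torus_on I"
    unfolding torus_on_def by unfold_locales
  have "distr (torus_on J \<Otimes>\<^sub>M torus_on I) (torus_on (I \<union> J)) (merge J I) = torus_on (I \<union> J)"
    using T_prod.distr_merge[of J I] IJ by (simp add: torus_on_def Un_commute Int_commute)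
  then have "AE x in distr (torus_on J \<Otimes>\<^sub>M torus_on I) (torus_on (I \<union> J)) (merge J I). p x"
    using ae by (rule ssubst[where P = "\<lambda>M. almost_everywhere M p"])
  moreover have "merge J I \<in> torus_on J \<Otimes>\<^sub>M torus_on I \<rightarrow>\<^sub>M torus_on (I \<union> J)"
    using measurable_merge[of J I "\<lambda>_. T_meas"] by (simp add: torus_on_def Un_commute)
  ultimately have "AE z in torus_on J \<Otimes>\<^sub>M torus_on I. p (merge J I z)" by (rule AE_distrD[rotated])
  from AE_pair[OF this] show ?thesis by (simp add: merge_commute[OF IJ(1)])
qed

lemma Lp_conv_singleton:
  assumes "Lp_conv (torus_on {0}) p (\<lambda>n x. fs n (x 0)) (\<lambda>x. f (x 0))"
  shows "Lp_conv T_meas p fs f"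
proof -
  have meas: "g \<in> borel_measurable T_meas" if "(\<lambda>x. g (x 0)) \<in> borel_measurable (torus_on {0})" for g :: "complex \<Rightarrow> complex"
  proof -
    \<comment> \<open>Composing with the embedding of the circle as a one-coordinate torus recovers
      measurability in the circle variable.\<close>
    have "(\<lambda>t. \<lambda>i\<in>{0::nat}. t) \<in> T_meas \<rightarrow>\<^sub>M torus_on {0}"
      unfolding torus_on_def by (rule measurable_restrict) simp
    from measurable_compose[OF this that] show ?thesis by simp
  qed
  have nn: "(\<integral>\<^sup>+x. g (x 0) \<partial>torus_on {0}) = (\<integral>\<^sup>+t. g t \<partial>T_meas)" if "g \<in> borel_measurable T_meas" for g
    unfolding torus_on_def by (rule T_prod.product_nn_integral_singleton[OF that])
  have memLp: "memLp T_meas p g" if "memLp (torus_on {0}) p (\<lambda>x. g (x 0))" for g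
  proof -
    have "(\<lambda>x. g (x 0)) \<in> borel_measurable (torus_on {0})" using that by (simp add: memLp_def)
    from meas[OF this] have g [measurable]: "g \<in> borel_measurable borel" by simp
    show ?thesis using that nn[of "\<lambda>t. ennreal (cmod (g t) powr p)"] by (simp add: memLp_def)
  qed
  have mf: "memLp T_meas p f" "memLp T_meas p (fs n)" for n
    using assms by (auto simp: Lp_conv_def intro!: memLp)
  then have [measurable]: "f \<in> borel_measurable borel" "fs n \<in> borel_measurable borel" for n
    by (auto simp: memLp_def)
  show ?thesis
    using assms mf nn[of "\<lambda>t. ennreal (cmod (fs _ t - f t) powr p)"] by (simp add: Lp_conv_def)
qed

text \<open>Dominated convergence in which the majorants \<open>2 tr S\<^sub>n + 2 tr S\<close> only converge in \<open>L\<^sup>1\<close>.\<close>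
lemma Lp_conv_of_slices:
  fixes F :: "(nat \<Rightarrow> complex) \<Rightarrow> complex^'d^'d"
  assumes m: "m \<ge> 1"
    and F: "\<And>i j. (\<lambda>x. F x $ i $ j) \<in> borel_measurable (torus m)"
    and Fs: "\<And>n i j. (\<lambda>x. Fs n x $ i $ j) \<in> borel_measurable (torus m)"
    and S: "\<And>i. Lp_conv (torus m) 1 (\<lambda>n x. Ss n x $ i $ i) (\<lambda>x. S x $ i $ i)"
    and SF: "AE y in torus_on {1..<m}. AE t in T_meas. S (y(0 := t)) = F (y(0 := t)) ** adjm (F (y(0 := t)))"
    and SFs: "\<And>n. AE y in torus_on {1..<m}. AE t in T_meas. Ss n (y(0 := t)) = Fs n (y(0 := t)) ** adjm (Fs n (y(0 := t)))"
    and conv: "AE y in torus_on {1..<m}. (\<lambda>n. \<integral>\<^sup>+t. ennreal ((norm (Fs n (y(0 := t)) - F (y(0 := t))))\<^sup>2) \<partial>T_meas) \<longlonglongrightarrow> 0"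
  shows "Lp_conv (torus m) 2 (\<lambda>n x. Fs n x $ i $ j) (\<lambda>x. F x $ i $ j)"
proof -
  have Sm: "\<And>i. (\<lambda>x. S x $ i $ i) \<in> borel_measurable (torus m)" "\<And>n i. (\<lambda>x. Ss n x $ i $ i) \<in> borel_measurable (torus m)"
    and Si: "\<And>i. integrable (torus m) (\<lambda>x. S x $ i $ i)" "\<And>n i. integrable (torus m) (\<lambda>x. Ss n x $ i $ i)"
    using S by (auto simp: Lp_conv_1_iff dest: borel_measurable_integrable)
  note [measurable] = Sm F Fs
  have Fm [measurable]: "F \<in> borel_measurable (torus m)" "Fs n \<in> borel_measurable (torus m)" for n
    using F Fs by (auto simp: borel_measurable_matrix_iff)
  have memLp: "memLp (torus m) 2 (\<lambda>x. X x $ i $ j)"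
    if X [measurable]: "X \<in> borel_measurable (torus m)" and Z: "\<And>i. integrable (torus m) (\<lambda>x. Z x $ i $ i)"
      and ZX: "AE y in torus_on {1..<m}. AE t in T_meas. Z (y(0 := t)) = X (y(0 := t)) ** adjm (X (y(0 := t)))"
    for X Z :: "(nat \<Rightarrow> complex) \<Rightarrow> complex^'d^'d"
  proof -
    have [measurable]: "(\<lambda>x. Z x $ i $ i) \<in> borel_measurable (torus m)" for i
      using Z by (rule borel_measurable_integrable)
    have "(\<integral>\<^sup>+x. ennreal (cmod (X x $ i $ j) powr 2) \<partial>torus m) \<le> (\<integral>\<^sup>+x. (\<Sum>i\<in>UNIV. ennreal (cmod (Z x $ i $ i))) \<partial>torus m)"
    proof (subst (1 2) torus_nn_integral[OF m], measurable, measurable, rule nn_integral_mono_AE)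
      show "AE y in torus_on {1..<m}. (\<integral>\<^sup>+t. ennreal (cmod (X (y(0 := t)) $ i $ j) powr 2) \<partial>T_meas)
         \<le> (\<integral>\<^sup>+t. (\<Sum>i\<in>UNIV. ennreal (cmod (Z (y(0 := t)) $ i $ i))) \<partial>T_meas)"
        using ZX
      proof eventually_elim
        case (elim y)
        show ?case
        proof (rule nn_integral_mono_AE)
          show "AE t in T_meas. ennreal (cmod (X (y(0 := t)) $ i $ j) powr 2) \<le> (\<Sum>i\<in>UNIV. ennreal (cmod (Z (y(0 := t)) $ i $ i)))"
            using elim
          proof eventually_elim
            case (elim t)
            let ?x = "y(0 := t)"
            have "cmod (X ?x $ i $ j) powr 2 = (cmod (X ?x $ i $ j))\<^sup>2" by (simp add: powr_numeral)
            also have "\<dots> \<le> (norm (X ?x))\<^sup>2" by (intro power_mono norm_entry_le) auto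
            also have "\<dots> = (\<Sum>i\<in>UNIV. Re (Z ?x $ i $ i))" unfolding elim by (rule trace_mult_adjm[symmetric])
            also have "\<dots> \<le> (\<Sum>i\<in>UNIV. cmod (Z ?x $ i $ i))" by (intro sum_mono complex_Re_le_cmod)
            finally show ?case by (simp add: ennreal_leI sum_ennreal)
          qed
        qed
      qed
    qed
    also have "\<dots> = (\<Sum>i\<in>UNIV. \<integral>\<^sup>+x. ennreal (cmod (Z x $ i $ i)) \<partial>torus m)"
      by (rule nn_integral_sum) measurable
    also have "\<dots> < \<infinity>"
      using Z by (simp add: integrable_iff_bounded)
    finally show ?thesis
      using X by (simp add: memLp_def borel_measurable_matrix_nth)
  qed
  \<comment> \<open>For each \<open>n\<close>, \<open>2 tr Ss + 2 tr S\<close> is split into a fixed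
    integrable majorant \<open>a\<close> and an error \<open>e n\<close> that tends to 0 in L1,
    using \<open>|Ss| \<le> |S| + |Ss - S|\<close> on the diagonal.\<close>
  define h where "h n x = ennreal ((norm (Fs n x - F x))\<^sup>2)" for n x
  define a where "a x = (\<Sum>i\<in>UNIV. ennreal (4 * cmod (S x $ i $ i)))" for x
  define e where "e n x = (\<Sum>i\<in>UNIV. ennreal (2 * cmod (Ss n x $ i $ i - S x $ i $ i)))" for n x
  have hm [measurable]: "h n \<in> borel_measurable (torus m)" and am [measurable]: "a \<in> borel_measurable (torus m)"
    and em [measurable]: "e n \<in> borel_measurable (torus m)" for n
    unfolding h_def a_def e_def by measurable
  \<comment> \<open>Convergence is known only after integration over the first variable, so the
    majorants are integrated over it as well and the limit theorem is applied in the remaining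
    ones.\<close>
  define D where "D n y = (\<integral>\<^sup>+t. h n (y(0 := t)) \<partial>T_meas)" for n y
  define A where "A y = (\<integral>\<^sup>+t. a (y(0 := t)) \<partial>T_meas)" for y
  define E where "E n y = (\<integral>\<^sup>+t. e n (y(0 := t)) \<partial>T_meas)" for n y
  have [measurable]: "D n \<in> borel_measurable (torus_on {1..<m})" "A \<in> borel_measurable (torus_on {1..<m})"
    "E n \<in> borel_measurable (torus_on {1..<m})" for n
    unfolding D_def A_def E_def using measurable_slice_nn_integral[OF m] hm am em by auto
  have hD: "(\<integral>\<^sup>+x. h n x \<partial>torus m) = (\<integral>\<^sup>+y. D n y \<partial>torus_on {1..<m})" for n
    unfolding D_def by (rule torus_nn_integral[OF m hm])
  have A_fin: "(\<integral>\<^sup>+y. A y \<partial>torus_on {1..<m}) < \<infinity>"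
  proof -
    have "(\<integral>\<^sup>+y. A y \<partial>torus_on {1..<m}) = (\<integral>\<^sup>+x. a x \<partial>torus m)"
      unfolding A_def by (rule torus_nn_integral[OF m am, symmetric])
    also have "\<dots> = (\<Sum>i\<in>UNIV. \<integral>\<^sup>+x. ennreal (4 * cmod (S x $ i $ i)) \<partial>torus m)"
      unfolding a_def by (rule nn_integral_sum) measurable
    also have "\<dots> = (\<Sum>i\<in>UNIV. 4 * (\<integral>\<^sup>+x. ennreal (cmod (S x $ i $ i)) \<partial>torus m))"
      by (intro sum.cong refl) (simp add: ennreal_mult nn_integral_cmult)
    also have "\<dots> < \<infinity>"
      using Si(1) by (simp add: integrable_iff_bounded ennreal_mult_less_top)
    finally show ?thesis .
  qed
  have E_lim: "(\<lambda>n. \<integral>\<^sup>+y. E n y \<partial>torus_on {1..<m}) \<longlonglongrightarrow> 0"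
  proof -
    have eq: "(\<integral>\<^sup>+y. E n y \<partial>torus_on {1..<m}) = (\<Sum>i\<in>UNIV. 2 * (\<integral>\<^sup>+x. ennreal (cmod (Ss n x $ i $ i - S x $ i $ i)) \<partial>torus m))" for n
    proof -
      have "(\<integral>\<^sup>+y. E n y \<partial>torus_on {1..<m}) = (\<integral>\<^sup>+x. e n x \<partial>torus m)"
        unfolding E_def by (rule torus_nn_integral[OF m em, symmetric])
      also have "\<dots> = (\<Sum>i\<in>UNIV. \<integral>\<^sup>+x. ennreal (2 * cmod (Ss n x $ i $ i - S x $ i $ i)) \<partial>torus m)"
        unfolding e_def by (rule nn_integral_sum) measurable
      also have "\<dots> = (\<Sum>i\<in>UNIV. 2 * (\<integral>\<^sup>+x. ennreal (cmod (Ss n x $ i $ i - S x $ i $ i)) \<partial>torus m))"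
        by (intro sum.cong refl) (simp add: ennreal_mult nn_integral_cmult)
      finally show ?thesis .
    qed
    have "(\<lambda>n. \<Sum>i\<in>(UNIV::'d set). 2 * (\<integral>\<^sup>+x. ennreal (cmod (Ss n x $ i $ i - S x $ i $ i)) \<partial>torus m)) \<longlonglongrightarrow> (\<Sum>i\<in>(UNIV::'d set). 2 * 0)"
      by (intro tendsto_sum ennreal_tendsto_cmult) (use S in \<open>auto simp: Lp_conv_1_iff\<close>)
    then show ?thesis unfolding eq by simp
  qed
  have DAE: "AE y in torus_on {1..<m}. D n y \<le> A y + E n y" for n
    using SF SFs[of n] AE_space
  proof eventually_elim
    case (elim y)
    have mt: "(\<lambda>t. y(0 := t)) \<in> T_meas \<rightarrow>\<^sub>M torus m"
      using measurable_compose[OF measurable_Pair1'[OF elim(3)] measurable_upd_0[OF m]] by simp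
    have "D n y \<le> (\<integral>\<^sup>+t. a (y(0 := t)) + e n (y(0 := t)) \<partial>T_meas)"
      unfolding D_def
    proof (rule nn_integral_mono_AE)
      show "AE t in T_meas. h n (y(0 := t)) \<le> a (y(0 := t)) + e n (y(0 := t))"
        using elim(1,2)
      proof eventually_elim
        case (elim t)
        let ?x = "y(0 := t)"
        have "(norm (Fs n ?x - F ?x))\<^sup>2 \<le> 2 * (norm (Fs n ?x))\<^sup>2 + 2 * (norm (F ?x))\<^sup>2"
          using norm_add_sq_le[of "Fs n ?x" "- F ?x"] by simp
        also have "\<dots> = (\<Sum>i\<in>UNIV. 2 * Re (Ss n ?x $ i $ i) + 2 * Re (S ?x $ i $ i))"
          unfolding elim trace_mult_adjm[symmetric] by (simp add: sum.distrib sum_distrib_left)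
        also have "\<dots> \<le> (\<Sum>i\<in>UNIV. 4 * cmod (S ?x $ i $ i) + 2 * cmod (Ss n ?x $ i $ i - S ?x $ i $ i))"
        proof (rule sum_mono)
          fix i
          show "2 * Re (Ss n ?x $ i $ i) + 2 * Re (S ?x $ i $ i) \<le> 4 * cmod (S ?x $ i $ i) + 2 * cmod (Ss n ?x $ i $ i - S ?x $ i $ i)"
            using complex_Re_le_cmod[of "S ?x $ i $ i"] complex_Re_le_cmod[of "Ss n ?x $ i $ i - S ?x $ i $ i"] by simp
        qed
        finally have "h n ?x \<le> ennreal (\<Sum>i\<in>UNIV. 4 * cmod (S ?x $ i $ i) + 2 * cmod (Ss n ?x $ i $ i - S ?x $ i $ i))"
          unfolding h_def by (rule ennreal_leI)
        also have "\<dots> = a ?x + e n ?x"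
          unfolding a_def e_def by (simp add: sum.distrib sum_nonneg sum_ennreal)
        finally show ?case .
      qed
    qed
    also have "\<dots> = A y + E n y"
      unfolding A_def E_def by (intro nn_integral_add measurable_compose[OF mt am] measurable_compose[OF mt em])
    finally show ?case .
  qed
  \<comment> \<open>From \<open>D \<le> A + E\<close> follows \<open>D \<le> min D A + E\<close>:
    the first term is dominated by the fixed function \<open>A\<close>, the second tends to 0 in
    L1.\<close>
  let ?ub = "\<lambda>n. (\<integral>\<^sup>+y. min (D n y) (A y) \<partial>torus_on {1..<m}) + (\<integral>\<^sup>+y. E n y \<partial>torus_on {1..<m})"
  have "(\<lambda>n. \<integral>\<^sup>+y. min (D n y) (A y) \<partial>torus_on {1..<m}) \<longlonglongrightarrow> (\<integral>\<^sup>+y. 0 \<partial>torus_on {1..<m})"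
  proof (rule nn_integral_dominated_convergence[where w = A])
    show "AE y in torus_on {1..<m}. (\<lambda>n. min (D n y) (A y)) \<longlonglongrightarrow> 0"
      using conv
    proof eventually_elim
      case (elim y)
      have "(\<lambda>n. D n y) \<longlonglongrightarrow> 0" using elim by (simp add: D_def h_def)
      then show ?case
        by (rule tendsto_sandwich[OF _ _ tendsto_const, rotated 2]) auto
    qed
    show "(\<lambda>y. min (D n y) (A y)) \<in> borel_measurable (torus_on {1..<m})" for n by measurable
    show "A \<in> borel_measurable (torus_on {1..<m})" by measurable
  qed (use A_fin in auto)
  then have "(\<lambda>n. ?ub n) \<longlonglongrightarrow> 0 + 0"
    by (intro tendsto_add E_lim) simp
  then have up: "(\<lambda>n. ?ub n) \<longlonglongrightarrow> 0"
    by simp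
  have hle: "(\<integral>\<^sup>+x. h n x \<partial>torus m) \<le> ?ub n" for n
  proof -
    have "(\<integral>\<^sup>+x. h n x \<partial>torus m) \<le> (\<integral>\<^sup>+y. min (D n y) (A y) + E n y \<partial>torus_on {1..<m})"
      unfolding hD
    proof (rule nn_integral_mono_AE)
      show "AE y in torus_on {1..<m}. D n y \<le> min (D n y) (A y) + E n y"
        using DAE[of n] by eventually_elim (auto simp: min_def add_increasing2)
    qed
    also have "\<dots> = ?ub n"
      by (rule nn_integral_add) measurable
    finally show ?thesis .
  qed
  have "(\<integral>\<^sup>+x. ennreal (cmod (Fs n x $ i $ j - F x $ i $ j) powr 2) \<partial>torus m) \<le> (\<integral>\<^sup>+x. h n x \<partial>torus m)" for n
  proof (rule nn_integral_mono)
    fix x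
    have "cmod (Fs n x $ i $ j - F x $ i $ j) \<le> norm (Fs n x - F x)"
      using norm_entry_le[of "Fs n x - F x" i j] by simp
    then show "ennreal (cmod (Fs n x $ i $ j - F x $ i $ j) powr 2) \<le> h n x"
      unfolding h_def by (intro ennreal_leI) (simp add: powr_numeral power_mono)
  qed
  then have "(\<integral>\<^sup>+x. ennreal (cmod (Fs n x $ i $ j - F x $ i $ j) powr 2) \<partial>torus m)
      \<le> ?ub n" for n
    using hle order_trans by blast
  then have "(\<lambda>n. \<integral>\<^sup>+x. ennreal (cmod (Fs n x $ i $ j - F x $ i $ j) powr 2) \<partial>torus m) \<longlonglongrightarrow> 0"
    by (intro tendsto_sandwich[OF _ _ tendsto_const up]) auto
  then show ?thesis
    unfolding Lp_conv_def using memLp[OF Fm(1) Si(1) SF] memLp[OF Fm(2) Si(2) SFs] by auto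
qed

theorem theorem7p1:
  fixes N :: nat
    and Ss :: "nat \<Rightarrow> (nat \<Rightarrow> complex) \<Rightarrow> complex^'d^'d"
    and S :: "(nat \<Rightarrow> complex) \<Rightarrow> complex^'d^'d"
    and Fs :: "nat \<Rightarrow> (nat \<Rightarrow> complex) \<Rightarrow> complex^'d^'d"
    and F :: "(nat \<Rightarrow> complex) \<Rightarrow> complex^'d^'d"
  assumes "N \<ge> 2"
    and "\<And>n i j. integrable (torus N) (\<lambda>x. Ss n x $ i $ j)"
    and "\<And>i j. integrable (torus N) (\<lambda>x. S x $ i $ j)"
    and "\<And>n. AE x in torus N. pos_def (Ss n x)"
    and "AE x in torus N. pos_def (S x)"
    and "\<And>n. integrable (torus N) (\<lambda>x. ln (Re (det (Ss n x))))"
    and "integrable (torus N) (\<lambda>x. ln (Re (det (S x))))"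
    and "mat_Lp_rconv N 1 Ss S"
    and "AE y in torus_on {1..<N}.
           (\<lambda>n. \<integral>t. ln (Re (det (Ss n (y(0 := t))))) \<partial>T_meas)
             \<longlonglongrightarrow> (\<integral>t. ln (Re (det (S (y(0 := t))))) \<partial>T_meas)"
    and "\<And>n. first_var_factor N (Ss n) (Fs n)"
    and "first_var_factor N S F"
  shows "mat_Lp_rconv N 2 Fs F"
proof -
  have N1: "N \<ge> 1" using assms(1) by simp
  have Fm: "(\<lambda>x. F x $ i $ j) \<in> borel_measurable (torus N)" "(\<lambda>x. Fs n x $ i $ j) \<in> borel_measurable (torus N)" for n i j
    using assms(10,11) by (auto simp: first_var_factor_def)
  \<comment> \<open>The case \<open>m = 1\<close> of the hypothesis is L1 convergence on almost
    every line in the first variable.\<close>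
  have "AE y in torus_on {1..<N}. \<forall>i j. Lp_conv T_meas 1 (\<lambda>n t. Ss n (y(0 := t)) $ i $ j) (\<lambda>t. S (y(0 := t)) $ i $ j)"
  proof -
    have "1 \<in> {1..<N}" using assms(1) by simp
    have "AE y in torus_on {1..<N}. Lp_conv (torus_on {..<1}) 1 (\<lambda>n x. Ss n (merge {..<1} {1..<N} (x, y)) $ i $ j) (\<lambda>x. S (merge {..<1} {1..<N} (x, y)) $ i $ j)" for i j
      using assms(8) \<open>1 \<in> {1..<N}\<close> unfolding mat_Lp_rconv_def Lp_rconv_def by blast
    then have "AE y in torus_on {1..<N}. \<forall>i j. Lp_conv (torus_on {..<1}) 1 (\<lambda>n x. Ss n (merge {..<1} {1..<N} (x, y)) $ i $ j) (\<lambda>x. S (merge {..<1} {1..<N} (x, y)) $ i $ j)"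
      by (simp add: AE_all_countable)
    then show ?thesis
      using AE_space
    proof eventually_elim
      case (elim y)
      \<comment> \<open>Points of the product are extensional, so \<open>merge\<close> and the
        function update agree at every index, including those outside \<open>{..<N}\<close>.\<close>
      have ext: "y i = undefined" if "i \<notin> {1..<N}" for i
        using elim(2) that by (auto simp: torus_on_def space_PiM PiE_def extensional_def)
      have "merge {..<1} {1..<N} (x, y) = y(0 := x 0)" for x
        using ext by (auto simp: merge_def fun_eq_iff)
      moreover have "{..<1::nat} = {0}" by auto
      ultimately show ?case
        using elim(1) Lp_conv_singleton[where fs = "\<lambda>n t. Ss n (y(0 := t)) $ _ $ _" and f = "\<lambda>t. S (y(0 := t)) $ _ $ _"] by simp
    qed
  qed
  moreover have "AE y in torus_on {1..<N}. \<forall>n. outer_spectral_factor (\<lambda>t. Ss n (y(0 := t))) (\<lambda>t. Fs n (y(0 := t)))"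
    using assms(10) by (simp add: first_var_factor_def AE_all_countable)
  moreover have "AE y in torus_on {1..<N}. outer_spectral_factor (\<lambda>t. S (y(0 := t))) (\<lambda>t. F (y(0 := t)))"
    using assms(11) by (simp add: first_var_factor_def)
  moreover note AE_torus_slice[OF N1 assms(5)] assms(9)
  \<comment> \<open>The one-variable theorem on almost every line. It is used directly for the whole
    torus and again, through \<open>AE_torus_merge\<close>, inside almost every slice.\<close>
  ultimately have good: "AE y in torus_on {1..<N}.
      (AE t in T_meas. S (y(0 := t)) = F (y(0 := t)) ** adjm (F (y(0 := t)))) \<and>
      (\<forall>n. AE t in T_meas. Ss n (y(0 := t)) = Fs n (y(0 := t)) ** adjm (Fs n (y(0 := t)))) \<and>
      (\<lambda>n. \<integral>\<^sup>+t. ennreal ((norm (Fs n (y(0 := t)) - F (y(0 := t))))\<^sup>2) \<partial>T_meas) \<longlonglongrightarrow> 0"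
  proof eventually_elim
    case (elim y)
    have "(\<lambda>n. \<integral>\<^sup>+t. ennreal ((norm (Fs n (y(0 := t)) - F (y(0 := t))))\<^sup>2) \<partial>T_meas) \<longlonglongrightarrow> 0"
      by (rule outer_spectral_factor_continuous[where Qs = "\<lambda>n t. Ss n (y(0 := t))" and Q = "\<lambda>t. S (y(0 := t))"])
         (use elim in auto)
    with elim show ?case by (auto simp: outer_spectral_factor_def)
  qed
  have full: "Lp_conv (torus N) 2 (\<lambda>n x. Fs n x $ i $ j) (\<lambda>x. F x $ i $ j)" for i j
  proof (rule Lp_conv_of_slices[OF N1 Fm, where Ss = Ss and S = S])
    show "Lp_conv (torus N) 1 (\<lambda>n x. Ss n x $ i $ i) (\<lambda>x. S x $ i $ i)" for i
      using assms(8) by (simp add: mat_Lp_rconv_def Lp_rconv_def)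
    show "AE y in torus_on {1..<N}. AE t in T_meas. Ss n (y(0 := t)) = Fs n (y(0 := t)) ** adjm (Fs n (y(0 := t)))" for n
      using good by eventually_elim blast
    show "AE y in torus_on {1..<N}. AE t in T_meas. S (y(0 := t)) = F (y(0 := t)) ** adjm (F (y(0 := t)))"
      using good by eventually_elim blast
    show "AE y in torus_on {1..<N}. (\<lambda>n. \<integral>\<^sup>+t. ennreal ((norm (Fs n (y(0 := t)) - F (y(0 := t))))\<^sup>2) \<partial>T_meas) \<longlonglongrightarrow> 0"
      using good by eventually_elim blast
  qed
  \<comment> \<open>For almost every choice of the last coordinates \<open>y\<close>, almost every
    choice of those in \<open>{1..<m}\<close> gives a good line, so \<open>Lp_conv_of_slices\<close>
    applies on \<open>torus m\<close> with \<open>y\<close> fixed. For \<open>m = 1\<close> the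
    space \<open>torus_on {1..<m}\<close> has a single point.\<close>
  have slice: "AE y in torus_on {m..<N}. \<forall>i j. Lp_conv (torus_on {..<m}) 2
       (\<lambda>n x. Fs n (merge {..<m} {m..<N} (x, y)) $ i $ j) (\<lambda>x. F (merge {..<m} {m..<N} (x, y)) $ i $ j)"
    if m: "m \<in> {1..<N}" for m
  proof -
    have m1: "m \<ge> 1" using m by simp
    have un: "{..<m} \<union> {m..<N} = {..<N}" "{1..<m} \<union> {m..<N} = {1..<N}" using m by auto
    let ?g = "\<lambda>x y. merge {..<m} {m..<N} (x, y)"
    have "AE y in torus_on {m..<N}. Lp_conv (torus m) 1 (\<lambda>n x. Ss n (?g x y) $ i $ i) (\<lambda>x. S (?g x y) $ i $ i)" for i
      using assms(8) m by (auto simp: mat_Lp_rconv_def Lp_rconv_def)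
    then have "AE y in torus_on {m..<N}. \<forall>i. Lp_conv (torus m) 1 (\<lambda>n x. Ss n (?g x y) $ i $ i) (\<lambda>x. S (?g x y) $ i $ i)"
      by (simp add: AE_all_countable)
    moreover have "{1..<m} \<inter> {m..<N} = {}" by auto
    note AE_torus_merge[OF this finite_atLeastLessThan finite_atLeastLessThan, unfolded un, OF good]
    ultimately show ?thesis
      using AE_space
    proof eventually_elim
      case (elim y)
      have mrg: "(merge {1..<m} {m..<N} (x, y))(0 := t) = ?g (x(0 := t)) y" for x t
        using m by (auto simp: merge_def fun_eq_iff)
      have mm: "(\<lambda>x. ?g x y) \<in> torus m \<rightarrow>\<^sub>M torus N"
        using measurable_compose[OF measurable_Pair2'[OF elim(3)[unfolded torus_on_def]] measurable_merge[of "{..<m}" "{m..<N}" "\<lambda>_. T_meas"]]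
        unfolding torus_on_def un .
      show ?case
      proof (intro allI)
        fix i j
        show "Lp_conv (torus m) 2 (\<lambda>n x. Fs n (?g x y) $ i $ j) (\<lambda>x. F (?g x y) $ i $ j)"
        proof (rule Lp_conv_of_slices[OF m1, where Ss = "\<lambda>n x. Ss n (?g x y)" and S = "\<lambda>x. S (?g x y)"
              and Fs = "\<lambda>n x. Fs n (?g x y)" and F = "\<lambda>x. F (?g x y)"])
          show "AE x in torus_on {1..<m}. AE t in T_meas. Ss n (?g (x(0 := t)) y)
              = Fs n (?g (x(0 := t)) y) ** adjm (Fs n (?g (x(0 := t)) y))" for n
            using elim(2)[unfolded mrg] by eventually_elim blast
          show "AE x in torus_on {1..<m}. AE t in T_meas. S (?g (x(0 := t)) y)
              = F (?g (x(0 := t)) y) ** adjm (F (?g (x(0 := t)) y))"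
            using elim(2)[unfolded mrg] by eventually_elim blast
          show "AE x in torus_on {1..<m}. (\<lambda>n. \<integral>\<^sup>+t. ennreal ((norm (Fs n (?g (x(0 := t)) y)
              - F (?g (x(0 := t)) y)))\<^sup>2) \<partial>T_meas) \<longlonglongrightarrow> 0"
            using elim(2)[unfolded mrg] by eventually_elim blast
        qed (use elim(1) measurable_compose[OF mm Fm(1)] measurable_compose[OF mm Fm(2)] in auto)
      qed
    qed
  qed
  show ?thesis
    unfolding mat_Lp_rconv_def Lp_rconv_def
  proof (intro allI conjI ballI full)
    fix i j m assume "m \<in> {1..<N}"
    from slice[OF this] show "AE y in torus_on {m..<N}. Lp_conv (torus_on {..<m}) 2
       (\<lambda>n x. Fs n (merge {..<m} {m..<N} (x, y)) $ i $ j) (\<lambda>x. F (merge {..<m} {m..<N} (x, y)) $ i $ j)"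
      by eventually_elim auto
  qed
qed

end
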